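(* Let $\chi_1^{(1)}:X(\mathfrak{so}_4,\mathfrak{so}_4)^{tw}\to SY^-(2)\otimes Y^-(2)$ be the algebra isomorphism obtained by composing the embedding $\varphi_1:X(\mathfrak{so}_4,\mathfrak{so}_4)^{tw}\hookrightarrow Y^-(2)\otimes Y^-(2)$, $S(u)\mapsto S^\circ(u-1/2)\,S^\bullet(u-1/2)$, with the natural projection $Y^-(2)\to SY^-(2)$ on the first tensor factor. Then $\chi_1^{(1)}$ descends to the quotients $Y(\mathfrak{so}_4,\mathfrak{so}_4)^{tw}$ of $X(\mathfrak{so}_4,\mathfrak{so}_4)^{tw}$ and $SY^-(2)\otimes SY^-(2)$ of $SY^-(2)\otimes Y^-(2)$, thus inducing an algebra isomorphism $$Y(\mathfrak{so}_4,\mathfrak{so}_4)^{tw}\cong SY^-(2)\otimes SY^-(2).$$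
   Context: All algebras are unital associative over $\mathbb C$; $P=\sum E_{ij}\otimes E_{ji}$. $2\times2$ notation: indices in $\{-1,1\}$, $(E_{ij})^{t_-}=\mathrm{sign}(i)\,\mathrm{sign}(j)E_{-j,-i}$, $R^\circ(u)=I-\frac Pu$. $Y(2)$ is generated by the coefficients of $T^\circ(u)=I+O(u^{-1})$ with relation $R^\circ(u-v)T^\circ_1(u)T^\circ_2(v)=T^\circ_2(v)T^\circ_1(u)R^\circ(u-v)$. The series $\mathrm{qdet}\,T^\circ(u)=t^\circ_{-1,-1}(u-1)t^\circ_{11}(u)-t^\circ_{-1,1}(u-1)t^\circ_{1,-1}(u)$ has central coefficients; $SY(2)=Y(2)/(\mathrm{qdet}\,T^\circ(u)-1)$, and $\mathcal T^\circ(u)$ is the image of $T^\circ(u)$. $Y^-(2)\subset Y(2)$ is the subalgebra generated by the coefficients of its generating matrix $T^\circ(u)T^\circ(-u)^{t_-}$; $SY^-(2)\subset SY(2)$ is generated by the coefficients of $\mathcal T^\circ(u)\mathcal T^\circ(-u)^{t_-}$; the natural projection $Y^-(2)\to SY^-(2)$ (restriction of $Y(2)\to SY(2)$) identifies $SY^-(2)$ with the quotient of $Y^-(2)$ by the ideal generated by the coefficients of $\mathrm{qdet}\,T^\circ(u)\,\mathrm{qdet}\,T^\circ(1-u)-1$ (equivalently, of $\mathrm{sdet}-\frac{2u+1}{2u-1}$, where $\mathrm{sdet}=\frac{2u+1}{2u-1}\,\mathrm{qdet}\,T^\circ(u)\,\mathrm{qdet}\,T^\circ(1-u)$ is the Sklyanin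 determinant). $S^\circ(u)$ and $S^\bullet(u)$ denote the generating matrices of the first and second copy of $Y^-(2)$. $\mathfrak{so}_4$: $4\times4$ matrices are indexed by $\{-2,-1,1,2\}$, $(E_{ij})^t=E_{-j,-i}$, $Q=\sum E_{ij}\otimes E_{-i,-j}$, $R(u)=I-\frac Pu+\frac Q{u-1}$. $X(\mathfrak{so}_4)$ is generated by the coefficients of the $4\times4$ matrix $T(u)=I+O(u^{-1})$ with relation $R(u-v)T_1(u)T_2(v)=T_2(v)T_1(u)R(u-v)$. $X(\mathfrak{so}_4,\mathfrak{so}_4)^{tw}\subset X(\mathfrak{so}_4)$ is the subalgebra generated by the coefficients of $S(u)=T(u-\frac12)\,T(-u+\frac12)^t$. It satisfies $S(u)S(-u)=w(u)I$ with $w(u)$ an even series with central coefficients, and $Y(\mathfrak{so}_4,\mathfrak{so}_4)^{tw}$ is here the quotient $X(\mathfrak{so}_4,\mathfrak{so}_4)^{tw}/(w(u)-1)$. Identification: $\mathbb C^4=\mathbb C^2\otimes\mathbb C^2$ via $v_{-2}=e_{-1}\otimes e_{-1}$, $v_{-1}=e_{-1}\otimes e_1$, $v_1=e_1\otimes e_{-1}$, $v_2=-e_1\otimes e_1$. In the formula for $\varphi_1$, $S^\circ$ acts on the first factor, $S^\bullet$ on the second, and $s_{ij}(u)$ is sent to the $(i,j)$ entry of the right-hand side in the basis $v_{-2},v_{-1},v_1,v_2$. *)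

theory Defs
  imports
    "HOL-Algebra.QuotRing"
    "HOL-Algebra.Module"
    "HOL-Computational_Algebra.Formal_Power_Series"
    "HOL-Library.Poly_Mapping"
begin

unbundle fps_syntax

section \<open>Unital associative complex algebras\<close>

text \<open>
  A (not necessarily commutative) algebra over the complex numbers is represented by the
  HOL-Algebra record of a ring together with a scalar multiplication. Ideals are the two-sided
  ideals of the underlying ring; since the algebras are unital, they are closed under scalars.
\<close>

type_synonym 'a calg = "(complex, 'a) module"

definition alg_hom :: "'a calg \<Rightarrow> 'b calg \<Rightarrow> ('a \<Rightarrow> 'b) set" where
  "alg_hom A B = {h \<in> ring_hom A B. \<forall>c. \<forall>x \<in> carrier A. h (c \<odot>\<^bsub>A\<^esub> x) = c \<odot>\<^bsub>B\<^esub> h x}"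

definition alg_iso :: "'a calg \<Rightarrow> 'b calg \<Rightarrow> ('a \<Rightarrow> 'b) set" where
  "alg_iso A B = {h \<in> alg_hom A B. bij_betw h (carrier A) (carrier B)}"

definition alg_quot :: "'a calg \<Rightarrow> 'a set \<Rightarrow> 'a set calg" where
  "alg_quot A I = ring.extend (A Quot I) \<lparr>smult = \<lambda>c X. \<Union>x\<in>X. I +>\<^bsub>A\<^esub> (c \<odot>\<^bsub>A\<^esub> x)\<rparr>"

inductive_set alg_gen :: "'a calg \<Rightarrow> 'a set \<Rightarrow> 'a set" for A S where
  incl: "x \<in> S \<Longrightarrow> x \<in> alg_gen A S"
| one: "\<one>\<^bsub>A\<^esub> \<in> alg_gen A S"
| add: "x \<in> alg_gen A S \<Longrightarrow> y \<in> alg_gen A S \<Longrightarrow> x \<oplus>\<^bsub>A\<^esub> y \<in> alg_gen A S"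
| mult: "x \<in> alg_gen A S \<Longrightarrow> y \<in> alg_gen A S \<Longrightarrow> x \<otimes>\<^bsub>A\<^esub> y \<in> alg_gen A S"
| smult: "x \<in> alg_gen A S \<Longrightarrow> c \<odot>\<^bsub>A\<^esub> x \<in> alg_gen A S"

definition subalg :: "'a calg \<Rightarrow> 'a set \<Rightarrow> 'a calg" where
  "subalg A S = A\<lparr>carrier := alg_gen A S\<rparr>"


subsection \<open>Tensor products\<close>

text \<open>
  \<open>pair_alg A B\<close> is the vector space with basis \<open>carrier A \<times> carrier B\<close>, multiplied by
  \<open>(a, b) (a', b') = (a a', b b')\<close>. The tensor product is its quotient by the bilinearity
  relations. The set of these relations is stable, up to scalars, under multiplication by basis
  elements, so that the ideal it generates is just its linear span.
\<close>

definition pair_alg :: "'a calg \<Rightarrow> 'b calg \<Rightarrow> ('a \<times> 'b \<Rightarrow>\<^sub>0 complex) calg" where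
  "pair_alg A B = \<lparr>carrier = {p. Poly_Mapping.keys p \<subseteq> carrier A \<times> carrier B},
     monoid.mult = (\<lambda>p q. \<Sum>(a, b)\<in>Poly_Mapping.keys p. \<Sum>(a', b')\<in>Poly_Mapping.keys q.
        Poly_Mapping.single (a \<otimes>\<^bsub>A\<^esub> a', b \<otimes>\<^bsub>B\<^esub> b')
          (Poly_Mapping.lookup p (a, b) * Poly_Mapping.lookup q (a', b'))),
     one = Poly_Mapping.single (\<one>\<^bsub>A\<^esub>, \<one>\<^bsub>B\<^esub>) 1,
     zero = 0,
     add = (+),
     smult = (\<lambda>c p. Poly_Mapping.map ((*) c) p)\<rparr>"

definition bilin_rels :: "'a calg \<Rightarrow> 'b calg \<Rightarrow> ('a \<times> 'b \<Rightarrow>\<^sub>0 complex) set" where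
  "bilin_rels A B =
     {Poly_Mapping.single (a \<oplus>\<^bsub>A\<^esub> a', b) 1
        - Poly_Mapping.single (a, b) 1 - Poly_Mapping.single (a', b) 1 | a a' b.
        a \<in> carrier A \<and> a' \<in> carrier A \<and> b \<in> carrier B}
   \<union> {Poly_Mapping.single (a, b \<oplus>\<^bsub>B\<^esub> b') 1
        - Poly_Mapping.single (a, b) 1 - Poly_Mapping.single (a, b') 1 | a b b'.
        a \<in> carrier A \<and> b \<in> carrier B \<and> b' \<in> carrier B}
   \<union> {Poly_Mapping.single (c \<odot>\<^bsub>A\<^esub> a, b) 1 - Poly_Mapping.single (a, b) c | a b c.
        a \<in> carrier A \<and> b \<in> carrier B}
   \<union> {Poly_Mapping.single (a, c \<odot>\<^bsub>B\<^esub> b) 1 - Poly_Mapping.single (a, b) c | a b c.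
        a \<in> carrier A \<and> b \<in> carrier B}"

definition tensor_ideal :: "'a calg \<Rightarrow> 'b calg \<Rightarrow> ('a \<times> 'b \<Rightarrow>\<^sub>0 complex) set" where
  "tensor_ideal A B = Idl\<^bsub>pair_alg A B\<^esub> (bilin_rels A B)"

definition tensor :: "'a calg \<Rightarrow> 'b calg \<Rightarrow> ('a \<times> 'b \<Rightarrow>\<^sub>0 complex) set calg" where
  "tensor A B = alg_quot (pair_alg A B) (tensor_ideal A B)"

definition tens :: "'a calg \<Rightarrow> 'b calg \<Rightarrow> 'a \<Rightarrow> 'b \<Rightarrow> ('a \<times> 'b \<Rightarrow>\<^sub>0 complex) set" where
  "tens A B a b = tensor_ideal A B +>\<^bsub>pair_alg A B\<^esub> Poly_Mapping.single (a, b) 1"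

text \<open>
  \<open>tensor_map A' B' f g\<close> is \<open>f \<otimes> g : A \<otimes> B \<rightarrow> A' \<otimes> B'\<close>; for linear \<open>f\<close> and \<open>g\<close> all
  representatives \<open>p\<close> of a coset yield the same coset, so that the union is that coset.
\<close>

definition tensor_map :: "'c calg \<Rightarrow> 'd calg \<Rightarrow> ('a \<Rightarrow> 'c) \<Rightarrow> ('b \<Rightarrow> 'd) \<Rightarrow>
    ('a \<times> 'b \<Rightarrow>\<^sub>0 complex) set \<Rightarrow> ('c \<times> 'd \<Rightarrow>\<^sub>0 complex) set" where
  "tensor_map A' B' f g X = (\<Union>p\<in>X. tensor_ideal A' B' +>\<^bsub>pair_alg A' B'\<^esub>
     (\<Sum>(a, b)\<in>Poly_Mapping.keys p.
        Poly_Mapping.single (f a, g b) (Poly_Mapping.lookup p (a, b))))"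


subsection \<open>Free algebras\<close>

text \<open>The free algebra is the monoid algebra of the free monoid of words.\<close>

datatype 'g word = Word (letters: "'g list")

instantiation word :: (type) monoid_add
begin

definition zero_word :: "'a word" where
  "zero_word = Word []"

definition plus_word :: "'a word \<Rightarrow> 'a word \<Rightarrow> 'a word" where
  "plus_word v w = Word (letters v @ letters w)"

instance
  by standard (simp_all add: zero_word_def plus_word_def)

end

type_synonym 'g free = "'g word \<Rightarrow>\<^sub>0 complex"

definition scal :: "complex \<Rightarrow> 'g free" where
  "scal c = Poly_Mapping.single 0 c"

definition gen :: "'g \<Rightarrow> 'g free" where
  "gen g = Poly_Mapping.single (Word [g]) 1"

definition free_alg :: "'g free calg" where
  "free_alg = \<lparr>carrier = UNIV, monoid.mult = (*), one = 1, zero = 0, add = (+),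
     smult = (\<lambda>c x. scal c * x)\<rparr>"


section \<open>RTT presentations\<close>

subsection \<open>Series in the inverse of the spectral parameter\<close>

text \<open>
  A formal power series \<open>f\<close> stands for \<open>\<Sum>n. (f $ n) u^(-n)\<close>. The re-expansion of
  \<open>f(u - c)\<close> uses \<open>(u - c)^(-r) = \<Sum>n\<ge>r. ((n - 1) choose (n - r)) c^(n - r) u^(-n)\<close>.
\<close>

definition ser_shift :: "complex \<Rightarrow> 'g free fps \<Rightarrow> 'g free fps" where
  "ser_shift c f =
     Abs_fps (\<lambda>n. \<Sum>r\<le>n. scal (of_nat ((n - 1) choose (n - r)) * c ^ (n - r)) * (f $ r))"

definition ser_neg :: "'g free fps \<Rightarrow> 'g free fps" where
  "ser_neg f = Abs_fps (\<lambda>n. (- 1) ^ n * (f $ n))"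

subsection \<open>Generating matrices and relations\<close>

text \<open>
  The letter \<open>(i, j, r)\<close> is the generator \<open>t\<^sub>i\<^sub>j\<close> with superscript \<open>(r + 1)\<close>, so that
  \<open>t\<^sub>i\<^sub>j(u) = \<delta>\<^sub>i\<^sub>j + O(u^(-1))\<close>.
\<close>

definition Tmat :: "'i \<Rightarrow> 'i \<Rightarrow> ('i \<times> 'i \<times> nat) free fps" where
  "Tmat i j = Abs_fps (\<lambda>n. case n of 0 \<Rightarrow> of_bool (i = j) | Suc r \<Rightarrow> gen (i, j, r))"

text \<open>
  Series in \<open>u\<close> and \<open>v\<close> are families \<open>G\<close> indexed by pairs of integers: \<open>G r s\<close> is the coefficient
  of \<open>u^(-r) v^(-s)\<close>. Matrices over the twofold tensor power of the defining space are indexed by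
  pairs. \<open>TT12\<close> and \<open>TT21\<close> are \<open>T\<^sub>1(u) T\<^sub>2(v)\<close> and \<open>T\<^sub>2(v) T\<^sub>1(u)\<close>.
\<close>

type_synonym 'a biser = "int \<Rightarrow> int \<Rightarrow> 'a"

definition TT12 :: "'i \<times> 'i \<Rightarrow> 'i \<times> 'i \<Rightarrow> ('i \<times> 'i \<times> nat) free biser" where
  "TT12 x y r s = (if 0 \<le> r \<and> 0 \<le> s
     then Tmat (fst x) (fst y) $ nat r * Tmat (snd x) (snd y) $ nat s else 0)"

definition TT21 :: "'i \<times> 'i \<Rightarrow> 'i \<times> 'i \<Rightarrow> ('i \<times> 'i \<times> nat) free biser" where
  "TT21 x y r s = (if 0 \<le> r \<and> 0 \<le> s
     then Tmat (snd x) (snd y) $ nat s * Tmat (fst x) (fst y) $ nat r else 0)"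

text \<open>Multiplication by \<open>u - v - c\<close>.\<close>

definition mult_uv :: "'a::ring_1 \<Rightarrow> 'a biser \<Rightarrow> 'a biser" where
  "mult_uv c G r s = G (r + 1) s - G r (s + 1) - c * G r s"

definition Pmat :: "'i \<times> 'i \<Rightarrow> 'i \<times> 'i \<Rightarrow> 'a::ring_1" where
  "Pmat x y = of_bool (fst x = snd y \<and> snd x = fst y)"

definition Qmat :: "'i::uminus \<times> 'i \<Rightarrow> 'i \<times> 'i \<Rightarrow> 'a::ring_1" where
  "Qmat x y = of_bool (snd x = - fst x \<and> snd y = - fst y)"

text \<open>
  The \<open>R\<close>-matrices with denominators cleared, each entry acting on series by multiplication:
  \<open>R2\<close> is \<open>(u - v) (I - P/(u - v))\<close>, and \<open>R4\<close> is
  \<open>(u - v) (u - v - 1) (I - P/(u - v) + Q/(u - v - 1))\<close>. The resulting relations are equivalent to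
  the original ones because \<open>u - v\<close> and \<open>u - v - 1\<close> are not zero divisors on such series.
\<close>

definition R2 :: "'i \<times> 'i \<Rightarrow> 'i \<times> 'i \<Rightarrow> 'a::ring_1 biser \<Rightarrow> 'a biser" where
  "R2 x y G r s = of_bool (x = y) * mult_uv 0 G r s - Pmat x y * G r s"

definition R4 :: "'i::uminus \<times> 'i \<Rightarrow> 'i \<times> 'i \<Rightarrow> 'a::ring_1 biser \<Rightarrow> 'a biser" where
  "R4 x y G r s = of_bool (x = y) * mult_uv 0 (mult_uv 1 G) r s
     - Pmat x y * mult_uv 1 G r s + Qmat x y * mult_uv 0 G r s"

definition RTT_rels ::
  "('i \<times> 'i \<Rightarrow> 'i \<times> 'i \<Rightarrow> ('i \<times> 'i \<times> nat) free biser \<Rightarrow> ('i \<times> 'i \<times> nat) free biser)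
    \<Rightarrow> ('i::finite \<times> 'i \<times> nat) free set" where
  "RTT_rels R = {(\<Sum>z\<in>UNIV. R x z (TT12 z y) r s) - (\<Sum>z\<in>UNIV. R z y (TT21 x z) r s) | x y r s. True}"


section \<open>The Yangians \<open>Y(2)\<close> and \<open>SY(2)\<close> and their twisted versions\<close>

text \<open>The index set \<open>{-1, 1}\<close>.\<close>

datatype ix2 = Neg | Pos

instance ix2 :: finite
proof
  have "(UNIV :: ix2 set) = {Neg, Pos}" using ix2.exhaust by auto
  then show "finite (UNIV :: ix2 set)" by (metis finite.emptyI finite.insertI)
qed

instantiation ix2 :: uminus
begin

fun uminus_ix2 :: "ix2 \<Rightarrow> ix2" where
  "- Neg = Pos"
| "- Pos = Neg"

instance ..

end

fun sgn2 :: "ix2 \<Rightarrow> 'a::ring_1" where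
  "sgn2 Neg = - 1"
| "sgn2 Pos = 1"

type_synonym gen2 = "ix2 \<times> ix2 \<times> nat"

definition Y2_ideal :: "gen2 free set" where
  "Y2_ideal = Idl\<^bsub>free_alg\<^esub> (RTT_rels R2)"

definition Y2 :: "gen2 free set calg" where
  "Y2 = alg_quot free_alg Y2_ideal"

definition Y2_class :: "gen2 free \<Rightarrow> gen2 free set" where
  "Y2_class x = Y2_ideal +>\<^bsub>free_alg\<^esub> x"

definition qdet :: "gen2 free fps" where
  "qdet = ser_shift 1 (Tmat Neg Neg) * Tmat Pos Pos - ser_shift 1 (Tmat Neg Pos) * Tmat Pos Neg"

text \<open>
  The \<open>(i, j)\<close> entry of \<open>T(u) T(-u)^t\<close> for the transposition
  \<open>E\<^sub>i\<^sub>j \<mapsto> sign(i) sign(j) E\<^sub>-\<^sub>j\<^sub>,\<^sub>-\<^sub>i\<close>, computed in the free algebra.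
\<close>

definition S2mat :: "ix2 \<Rightarrow> ix2 \<Rightarrow> gen2 free fps" where
  "S2mat i j = (\<Sum>k\<in>UNIV. Tmat i k * (sgn2 k * sgn2 j * ser_neg (Tmat (- j) (- k))))"

definition Y2m :: "gen2 free set calg" where
  "Y2m = subalg Y2 {Y2_class (S2mat i j $ n) | i j n. True}"

definition SY2_ideal :: "gen2 free set set" where
  "SY2_ideal = Idl\<^bsub>Y2\<^esub> {Y2_class ((qdet - 1) $ n) | n. True}"

definition SY2 :: "gen2 free set set calg" where
  "SY2 = alg_quot Y2 SY2_ideal"

text \<open>
  The projection from \<open>Y(2)\<close> to \<open>SY(2)\<close>; its restriction to the subalgebra \<open>Y2m\<close> is the natural
  projection onto \<open>SY2m\<close>. As it is a homomorphism, the coefficients of \<open>T(u) T(-u)^t\<close> formed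
  in \<open>SY(2)\<close> are the images of those formed in \<open>Y(2)\<close>.
\<close>

definition SY2_proj :: "gen2 free set \<Rightarrow> gen2 free set set" where
  "SY2_proj x = SY2_ideal +>\<^bsub>Y2\<^esub> x"

definition SY2m :: "gen2 free set set calg" where
  "SY2m = subalg SY2 {SY2_proj (Y2_class (S2mat i j $ n)) | i j n. True}"


section \<open>The extended Yangian of \<open>so\<^sub>4\<close> and its twisted versions\<close>

text \<open>The index set \<open>{-2, -1, 1, 2}\<close>.\<close>

datatype ix4 = Neg2 | Neg1 | Pos1 | Pos2

instance ix4 :: finite
proof
  have "(UNIV :: ix4 set) = {Neg2, Neg1, Pos1, Pos2}" using ix4.exhaust by auto
  then show "finite (UNIV :: ix4 set)" by (metis finite.emptyI finite.insertI)
qed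

instantiation ix4 :: uminus
begin

fun uminus_ix4 :: "ix4 \<Rightarrow> ix4" where
  "- Neg2 = Pos2"
| "- Neg1 = Pos1"
| "- Pos1 = Neg1"
| "- Pos2 = Neg2"

instance ..

end

type_synonym gen4 = "ix4 \<times> ix4 \<times> nat"

definition X4_ideal :: "gen4 free set" where
  "X4_ideal = Idl\<^bsub>free_alg\<^esub> (RTT_rels R4)"

definition X4 :: "gen4 free set calg" where
  "X4 = alg_quot free_alg X4_ideal"

definition X4_class :: "gen4 free \<Rightarrow> gen4 free set" where
  "X4_class x = X4_ideal +>\<^bsub>free_alg\<^esub> x"

text \<open>
  The \<open>(i, j)\<close> entry of \<open>T(u - 1/2) T(-u + 1/2)^t\<close> for the transposition
  \<open>E\<^sub>i\<^sub>j \<mapsto> E\<^sub>-\<^sub>j\<^sub>,\<^sub>-\<^sub>i\<close>, computed in the free algebra.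
\<close>

definition S4mat :: "ix4 \<Rightarrow> ix4 \<Rightarrow> gen4 free fps" where
  "S4mat i j = (\<Sum>k\<in>UNIV. ser_shift (1/2) (Tmat i k)
     * ser_shift (1/2) (ser_neg (Tmat (- j) (- k))))"

definition X4tw :: "gen4 free set calg" where
  "X4tw = subalg X4 {X4_class (S4mat i j $ n) | i j n. True}"

text \<open>The coefficients of the scalar series \<open>w(u)\<close> with \<open>S(u) S(-u) = w(u) I\<close>, the products
  being computed in the free algebra and then projected.\<close>

definition w_ser :: "nat \<Rightarrow> gen4 free set" where
  "w_ser = (THE w. \<forall>i j n. X4_class ((\<Sum>k\<in>UNIV. S4mat i k * ser_neg (S4mat k j)) $ n)
     = (if i = j then w n else \<zero>\<^bsub>X4\<^esub>))"

definition Y4tw_ideal :: "gen4 free set set" where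
  "Y4tw_ideal = Idl\<^bsub>X4tw\<^esub> {w_ser n \<ominus>\<^bsub>X4tw\<^esub> (if n = 0 then \<one>\<^bsub>X4tw\<^esub> else \<zero>\<^bsub>X4tw\<^esub>) | n. True}"

definition Y4tw :: "gen4 free set set calg" where
  "Y4tw = alg_quot X4tw Y4tw_ideal"

definition Y4tw_proj :: "gen4 free set \<Rightarrow> gen4 free set set" where
  "Y4tw_proj x = Y4tw_ideal +>\<^bsub>X4tw\<^esub> x"


section \<open>The matrix \<open>S\<^sup>\<circ>(u - 1/2) S\<^sup>\<bullet>(u - 1/2)\<close>\<close>

text \<open>
  The basis vector \<open>v\<^sub>i\<close> of the four-dimensional space is \<open>vsign i\<close> times the tensor product of
  the basis vectors with indices \<open>fac1 i\<close> and \<open>fac2 i\<close>. Hence a matrix \<open>A\<close> acting on the first and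
  a matrix \<open>B\<close> acting on the second tensor factor have the product with \<open>(i, j)\<close> entry
  \<open>vsign i * vsign j * A (fac1 i) (fac1 j) * B (fac2 i) (fac2 j)\<close>.
\<close>

fun fac1 :: "ix4 \<Rightarrow> ix2" where
  "fac1 Neg2 = Neg" | "fac1 Neg1 = Neg" | "fac1 Pos1 = Pos" | "fac1 Pos2 = Pos"

fun fac2 :: "ix4 \<Rightarrow> ix2" where
  "fac2 Neg2 = Neg" | "fac2 Neg1 = Pos" | "fac2 Pos1 = Neg" | "fac2 Pos2 = Pos"

fun vsign :: "ix4 \<Rightarrow> complex" where
  "vsign Neg2 = 1" | "vsign Neg1 = 1" | "vsign Pos1 = 1" | "vsign Pos2 = - 1"

definition phi_image :: "ix4 \<Rightarrow> ix4 \<Rightarrow> nat \<Rightarrow> (gen2 free set \<times> gen2 free set \<Rightarrow>\<^sub>0 complex) set" where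
  "phi_image i j n = (vsign i * vsign j) \<odot>\<^bsub>tensor Y2m Y2m\<^esub>
     (\<Oplus>\<^bsub>tensor Y2m Y2m\<^esub>m\<in>{..n}. tens Y2m Y2m
        (Y2_class (ser_shift (1/2) (S2mat (fac1 i) (fac1 j)) $ m))
        (Y2_class (ser_shift (1/2) (S2mat (fac2 i) (fac2 j)) $ (n - m))))"

end

theory Submission
  imports Defs
begin

text \<open>
  Under \<open>\<chi>\<close> the series \<open>w(u)\<close> becomes \<open>1 \<otimes> Z(u)\<close> with
  \<open>Z(u) = qdet T(u + 1/2) qdet T(1/2 - u)\<close>: since \<open>T(u - 1) T(u)\<^sup>t = qdet T(u)\<close>, one has
  \<open>S(u - 1/2) S(-u - 1/2) = Z(u)\<close> in \<open>Y\<^sup>-(2)\<close>, so that \<open>w(u) \<mapsto> Z(u) \<otimes> Z(u)\<close> under \<open>\<phi>\<^sub>1\<close>, and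
  \<open>Z(u) = 1\<close> in \<open>SY\<^sup>-(2)\<close>. Injectivity of \<open>\<phi>\<^sub>1\<close> also gives the existence of \<open>w(u)\<close>. By right
  exactness of the tensor product it remains to see that the kernel of \<open>Y\<^sup>-(2) \<rightarrow> SY\<^sup>-(2)\<close> is
  generated by the coefficients of \<open>Z(u) - 1\<close>. Let \<open>g(u)\<close> be the central series with
  \<open>g(u) g(u - 1) qdet T(u) = 1\<close>. The endomorphism \<open>T(u) \<mapsto> g(u) T(u)\<close> of \<open>Y(2)\<close> sends \<open>qdet T(u)\<close> to 1,
  so it kills the kernel of \<open>Y(2) \<rightarrow> SY(2)\<close>. On the other hand it multiplies \<open>S(u)\<close> by
  \<open>h(u) = g(u) g(-u)\<close>, and \<open>h(u + 1/2) h(u - 1/2) Z(u) = 1\<close> forces \<open>h(u) = 1\<close> modulo \<open>Z(u) - 1\<close>, so it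
  is the identity on \<open>Y\<^sup>-(2)\<close> modulo \<open>Z(u) - 1\<close>.
\<close>

section \<open>Complex algebras\<close>

text \<open>The kernel of Y^-(2) -> SY^-(2) is the intersection of an ideal of Y(2) with a
  subalgebra, and generators of the ideal do not yield generators of such an intersection. The
  rescaling avoids describing the intersection: it kills the large ideal, yet changes an element of
  the subalgebra only within the small one. Centrality of qdet T(u) makes this possible: each
  coefficient of g(u) is a polynomial in those of qdet T(u), so g(u) is central and g(u) T(u)
  satisfies the defining relation again. The form g(u) g(u - 1) reflects that every term of qdet
  T(u) has one entry at u - 1 and one at u; the half-integer arguments in Z(u) come from the
  argument u - 1/2 in the formula for \<open>\<phi>\<^sub>1\<close>. Since Z(u) is already 1 on the
  first tensor factor, the elements w(u) - 1 go exactly to 1 \<otimes> (Z(u) - 1), so the two ideals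
  correspond generator by generator under \<open>\<chi>\<close>.\<close>

lemma ring_truncate: "ring (ring.truncate R) \<longleftrightarrow> ring R"
  unfolding ring_def ring_axioms_def abelian_group_def abelian_group_axioms_def abelian_monoid_def
    comm_group_def group_def group_axioms_def comm_monoid_def comm_monoid_axioms_def monoid_def Units_def
  by (simp add: ring.defs)

locale calgebra = ring A for A :: "'a calg" (structure) +
  assumes smult_closed [simp, intro]: "x \<in> carrier A \<Longrightarrow> c \<odot> x \<in> carrier A"
    and smult_add_left: "x \<in> carrier A \<Longrightarrow> (c + d) \<odot> x = c \<odot> x \<oplus> d \<odot> x"
    and smult_add_right: "x \<in> carrier A \<Longrightarrow> y \<in> carrier A \<Longrightarrow> c \<odot> (x \<oplus> y) = c \<odot> x \<oplus> c \<odot> y"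
    and smult_smult: "x \<in> carrier A \<Longrightarrow> c \<odot> (d \<odot> x) = (c * d) \<odot> x"
    and smult_one: "x \<in> carrier A \<Longrightarrow> 1 \<odot> x = x"
    and smult_mult_left: "x \<in> carrier A \<Longrightarrow> y \<in> carrier A \<Longrightarrow> (c \<odot> x) \<otimes> y = c \<odot> (x \<otimes> y)"
    and smult_mult_right: "x \<in> carrier A \<Longrightarrow> y \<in> carrier A \<Longrightarrow> x \<otimes> (c \<odot> y) = c \<odot> (x \<otimes> y)"
begin

lemma smult_zero_left: "x \<in> carrier A \<Longrightarrow> 0 \<odot> x = \<zero>"
  using smult_add_left[of x 0 0] by (metis add.r_cancel_one' smult_closed add.inv_closed add_0)

lemma smult_zero_right: "c \<odot> \<zero> = \<zero>"
  using smult_add_right[of \<zero> \<zero> c] by (simp add: add.r_cancel_one')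

lemma smult_minus_one: "x \<in> carrier A \<Longrightarrow> (- 1) \<odot> x = \<ominus> x"
  using smult_add_left[of x "-1" 1] by (simp add: smult_zero_left smult_one minus_equality)

lemma smult_finsum:
  "finite I \<Longrightarrow> f \<in> I \<rightarrow> carrier A \<Longrightarrow> c \<odot> (\<Oplus>i\<in>I. f i) = (\<Oplus>i\<in>I. c \<odot> f i)"
  by (induction I rule: finite_induct) (auto simp: smult_zero_right smult_add_right Pi_iff)

lemma minus_eq_zero_iff: "x \<in> carrier A \<Longrightarrow> y \<in> carrier A \<Longrightarrow> x \<ominus> y = \<zero> \<longleftrightarrow> x = y"
  by (metis a_minus_def add.inv_closed minus_equality minus_minus r_neg)

lemma ideal_smult:
  assumes "ideal I A" "x \<in> I" shows "c \<odot> x \<in> I"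
proof -
  interpret ideal I A by fact
  have "c \<odot> x = (c \<odot> \<one>) \<otimes> x"
    using assms(2) a_subset by (auto simp: smult_mult_left)
  thus ?thesis using I_l_closed assms(2) by auto
qed

end

lemma calgebraI:
  assumes "ring A"
    "\<And>x c. x \<in> carrier A \<Longrightarrow> c \<odot>\<^bsub>A\<^esub> x \<in> carrier A"
    "\<And>x c d. x \<in> carrier A \<Longrightarrow> (c + d) \<odot>\<^bsub>A\<^esub> x = c \<odot>\<^bsub>A\<^esub> x \<oplus>\<^bsub>A\<^esub> d \<odot>\<^bsub>A\<^esub> x"
    "\<And>x y c. x \<in> carrier A \<Longrightarrow> y \<in> carrier A \<Longrightarrow>
       c \<odot>\<^bsub>A\<^esub> (x \<oplus>\<^bsub>A\<^esub> y) = c \<odot>\<^bsub>A\<^esub> x \<oplus>\<^bsub>A\<^esub> c \<odot>\<^bsub>A\<^esub> y"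
    "\<And>x c d. x \<in> carrier A \<Longrightarrow> c \<odot>\<^bsub>A\<^esub> (d \<odot>\<^bsub>A\<^esub> x) = (c * d) \<odot>\<^bsub>A\<^esub> x"
    "\<And>x. x \<in> carrier A \<Longrightarrow> 1 \<odot>\<^bsub>A\<^esub> x = x"
    "\<And>x y c. x \<in> carrier A \<Longrightarrow> y \<in> carrier A \<Longrightarrow>
       (c \<odot>\<^bsub>A\<^esub> x) \<otimes>\<^bsub>A\<^esub> y = c \<odot>\<^bsub>A\<^esub> (x \<otimes>\<^bsub>A\<^esub> y)"
    "\<And>x y c. x \<in> carrier A \<Longrightarrow> y \<in> carrier A \<Longrightarrow>
       x \<otimes>\<^bsub>A\<^esub> (c \<odot>\<^bsub>A\<^esub> y) = c \<odot>\<^bsub>A\<^esub> (x \<otimes>\<^bsub>A\<^esub> y)"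
  shows "calgebra A"
  using assms by (simp add: calgebra_def calgebra_axioms_def)

section \<open>Quotients by two-sided ideals\<close>

lemma alg_quot_simps [simp]:
  "carrier (alg_quot A I) = carrier (A Quot I)"
  "zero (alg_quot A I) = zero (A Quot I)"
  "one (alg_quot A I) = one (A Quot I)"
  "add (alg_quot A I) = add (A Quot I)"
  "monoid.mult (alg_quot A I) = monoid.mult (A Quot I)"
  by (simp_all add: alg_quot_def ring.defs)

lemma truncate_alg_quot: "ring.truncate (alg_quot A I) = A Quot I"
  by (simp add: alg_quot_def ring.defs FactRing_def)

context
  fixes A :: "'a calg" and I
  assumes alg: "calgebra A" and idl: "ideal I A"
begin

interpretation calgebra A by (fact alg)
interpretation I: ideal I A by (fact idl)

text \<open>The ring axioms read only the ring fields of a record, so they pass from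
  \<open>A Quot I\<close> to its extension by a scalar multiplication.\<close>

lemma alg_quot_ring: "ring (alg_quot A I)"
  using ring_truncate[of "alg_quot A I"] truncate_alg_quot[of A I] I.quotient_is_ring by simp

lemma alg_quot_carrier: "carrier (alg_quot A I) = (\<lambda>x. I +>\<^bsub>A\<^esub> x) ` carrier A"
  by (auto simp: FactRing_def A_RCOSETS_def' )

lemma coset_eq_iff:
  assumes "x \<in> carrier A" "y \<in> carrier A"
  shows "I +>\<^bsub>A\<^esub> x = I +>\<^bsub>A\<^esub> y \<longleftrightarrow> x \<ominus>\<^bsub>A\<^esub> y \<in> I"
  using quotient_eq_iff_same_a_r_cos[OF idl assms] by auto

lemma coset_mem:
  assumes "x \<in> carrier A" "y \<in> I +>\<^bsub>A\<^esub> x"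
  shows "y \<in> carrier A" "I +>\<^bsub>A\<^esub> y = I +>\<^bsub>A\<^esub> x"
  using assms by (meson I.a_subset a_r_coset_subset_G subsetD) (metis assms I.a_repr_independence')

lemma coset_self: "x \<in> carrier A \<Longrightarrow> x \<in> I +>\<^bsub>A\<^esub> x"
  by (rule I.a_rcos_self)

lemma alg_quot_add:
  "x \<in> carrier A \<Longrightarrow> y \<in> carrier A \<Longrightarrow>
    (I +>\<^bsub>A\<^esub> x) \<oplus>\<^bsub>alg_quot A I\<^esub> (I +>\<^bsub>A\<^esub> y) = I +>\<^bsub>A\<^esub> (x \<oplus>\<^bsub>A\<^esub> y)"
  by (simp add: FactRing_def I.a_rcos_sum)

lemma alg_quot_mult:
  "x \<in> carrier A \<Longrightarrow> y \<in> carrier A \<Longrightarrow>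
    (I +>\<^bsub>A\<^esub> x) \<otimes>\<^bsub>alg_quot A I\<^esub> (I +>\<^bsub>A\<^esub> y) = I +>\<^bsub>A\<^esub> (x \<otimes>\<^bsub>A\<^esub> y)"
  by (simp add: FactRing_def I.rcoset_mult_add)

lemma alg_quot_one: "\<one>\<^bsub>alg_quot A I\<^esub> = I +>\<^bsub>A\<^esub> \<one>\<^bsub>A\<^esub>"
  by (simp add: FactRing_def)

lemma alg_quot_zero: "\<zero>\<^bsub>alg_quot A I\<^esub> = I +>\<^bsub>A\<^esub> \<zero>\<^bsub>A\<^esub>"
  by (simp add: FactRing_def I.a_subset)

lemma coset_zero_iff: "x \<in> carrier A \<Longrightarrow> I +>\<^bsub>A\<^esub> x = \<zero>\<^bsub>alg_quot A I\<^esub> \<longleftrightarrow> x \<in> I"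
  using coset_eq_iff[of x "\<zero>\<^bsub>A\<^esub>"] alg_quot_zero by (simp add: minus_eq)

lemma alg_quot_smult:
  assumes "x \<in> carrier A"
  shows "c \<odot>\<^bsub>alg_quot A I\<^esub> (I +>\<^bsub>A\<^esub> x) = I +>\<^bsub>A\<^esub> (c \<odot>\<^bsub>A\<^esub> x)"
proof -
  \<comment> \<open>All representatives give the same coset, so the union in
    \<open>alg_quot_def\<close> is that single coset.\<close>
  have "I +>\<^bsub>A\<^esub> (c \<odot>\<^bsub>A\<^esub> y) = I +>\<^bsub>A\<^esub> (c \<odot>\<^bsub>A\<^esub> x)" if "y \<in> I +>\<^bsub>A\<^esub> x" for y
  proof -
    have y: "y \<in> carrier A" "y \<ominus>\<^bsub>A\<^esub> x \<in> I"
      using coset_mem[OF assms that] coset_eq_iff assms by auto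
    have "c \<odot>\<^bsub>A\<^esub> (y \<ominus>\<^bsub>A\<^esub> x) = c \<odot>\<^bsub>A\<^esub> y \<ominus>\<^bsub>A\<^esub> c \<odot>\<^bsub>A\<^esub> x"
      using y assms
      by (simp add: minus_eq smult_add_right flip: smult_minus_one) (simp add: smult_smult)
    thus ?thesis using ideal_smult[OF idl y(2), of c] y assms by (simp add: coset_eq_iff)
  qed
  moreover have "I +>\<^bsub>A\<^esub> x \<noteq> {}" using coset_self assms by auto
  ultimately show ?thesis by (auto simp: alg_quot_def ring.defs)
qed

lemma calgebra_alg_quot: "calgebra (alg_quot A I)"
  by (rule calgebraI, rule alg_quot_ring)
    (auto simp: alg_quot_carrier alg_quot_smult alg_quot_add alg_quot_mult smult_add_left smult_add_right
      smult_smult smult_one smult_mult_left smult_mult_right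
      simp del: alg_quot_simps)

lemma proj_alg_hom: "(\<lambda>x. I +>\<^bsub>A\<^esub> x) \<in> alg_hom A (alg_quot A I)"
  by (auto simp: alg_hom_def ring_hom_def alg_quot_carrier alg_quot_smult alg_quot_add alg_quot_mult
      alg_quot_one simp del: alg_quot_simps)

end

subsection \<open>Homomorphisms\<close>

lemma alg_homD:
  assumes "h \<in> alg_hom A B"
  shows "x \<in> carrier A \<Longrightarrow> h x \<in> carrier B"
    "x \<in> carrier A \<Longrightarrow> y \<in> carrier A \<Longrightarrow> h (x \<oplus>\<^bsub>A\<^esub> y) = h x \<oplus>\<^bsub>B\<^esub> h y"
    "x \<in> carrier A \<Longrightarrow> y \<in> carrier A \<Longrightarrow> h (x \<otimes>\<^bsub>A\<^esub> y) = h x \<otimes>\<^bsub>B\<^esub> h y"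
    "h \<one>\<^bsub>A\<^esub> = \<one>\<^bsub>B\<^esub>"
    "x \<in> carrier A \<Longrightarrow> h (c \<odot>\<^bsub>A\<^esub> x) = c \<odot>\<^bsub>B\<^esub> h x"
  using assms by (auto simp: alg_hom_def ring_hom_def)

lemma alg_hom_ring: "h \<in> alg_hom A B \<Longrightarrow> calgebra A \<Longrightarrow> calgebra B \<Longrightarrow> ring_hom_ring A B h"
  by (auto simp: alg_hom_def calgebra_def intro: ring_hom_ringI2)

lemma alg_hom_zero: "h \<in> alg_hom A B \<Longrightarrow> calgebra A \<Longrightarrow> calgebra B \<Longrightarrow> h \<zero>\<^bsub>A\<^esub> = \<zero>\<^bsub>B\<^esub>"
  using ring_hom_zero[of h A B] by (simp add: alg_hom_def calgebra_def)

lemma alg_hom_minus: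
  assumes "h \<in> alg_hom A B" "calgebra A" "calgebra B" "x \<in> carrier A" "y \<in> carrier A"
  shows "h (x \<ominus>\<^bsub>A\<^esub> y) = h x \<ominus>\<^bsub>B\<^esub> h y"
proof -
  interpret A: calgebra A by fact
  interpret B: calgebra B by fact
  have "h (x \<oplus>\<^bsub>A\<^esub> (-1) \<odot>\<^bsub>A\<^esub> y) = h x \<oplus>\<^bsub>B\<^esub> (-1) \<odot>\<^bsub>B\<^esub> h y"
    using assms by (simp add: alg_homD A.smult_closed)
  thus ?thesis using assms by (simp add: A.smult_minus_one B.smult_minus_one A.minus_eq B.minus_eq alg_homD)
qed

lemma alg_hom_finsum:
  assumes "h \<in> alg_hom A B" "calgebra A" "calgebra B" "finite I" "f \<in> I \<rightarrow> carrier A"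
  shows "h (\<Oplus>\<^bsub>A\<^esub>i\<in>I. f i) = (\<Oplus>\<^bsub>B\<^esub>i\<in>I. h (f i))"
proof -
  interpret A: calgebra A by fact
  interpret B: calgebra B by fact
  show ?thesis using assms(4,5)
    by (induction I rule: finite_induct)
      (auto simp: alg_hom_zero[OF assms(1-3)] alg_homD[OF assms(1)] Pi_iff)
qed

lemma alg_hom_comp: "h \<in> alg_hom A B \<Longrightarrow> k \<in> alg_hom B C \<Longrightarrow> (\<lambda>x. k (h x)) \<in> alg_hom A C"
  by (simp add: alg_hom_def ring_hom_def Pi_iff)

lemma alg_hom_cong: "h \<in> alg_hom A B \<Longrightarrow> calgebra A \<Longrightarrow> (\<And>x. x \<in> carrier A \<Longrightarrow> k x = h x) \<Longrightarrow> k \<in> alg_hom A B"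
proof -
  assume h: "h \<in> alg_hom A B" and A: "calgebra A" and k: "\<And>x. x \<in> carrier A \<Longrightarrow> k x = h x"
  interpret A: calgebra A by fact
  show ?thesis using h k by (auto simp: alg_hom_def ring_hom_def Pi_iff)
qed

lemma alg_hom_kernel_ideal:
  assumes "h \<in> alg_hom A B" "calgebra A" "calgebra B"
  shows "ideal {x \<in> carrier A. h x = \<zero>\<^bsub>B\<^esub>} A"
  using ring_hom_ring.kernel_is_ideal[OF alg_hom_ring[OF assms]] by (simp add: a_kernel_def')

lemma alg_hom_vimage_ideal:
  assumes "h \<in> alg_hom A B" "calgebra A" "calgebra B" "ideal J B"
  shows "ideal {x \<in> carrier A. h x \<in> J} A"
  using ring_hom_ring.ideal_vimage[OF alg_hom_ring[OF assms(1-3)] assms(4)] by simp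

lemma alg_quot_lift:
  assumes h: "h \<in> alg_hom A B" and A: "calgebra A" and B: "calgebra B"
    and I: "ideal I A" and ker: "\<And>x. x \<in> I \<Longrightarrow> h x = \<zero>\<^bsub>B\<^esub>"
  shows "\<exists>k \<in> alg_hom (alg_quot A I) B. \<forall>x \<in> carrier A. k (I +>\<^bsub>A\<^esub> x) = h x"
proof -
  interpret A: calgebra A by fact
  interpret B: calgebra B by fact
  \<comment> \<open>The choice of a representative is harmless: by \<open>eq\<close> below,
    \<open>h\<close> is constant on cosets.\<close>
  define k where "k X = h (SOME x. x \<in> carrier A \<and> I +>\<^bsub>A\<^esub> x = X)" for X
  have eq: "h x = h y" if "x \<in> carrier A" "y \<in> carrier A" "I +>\<^bsub>A\<^esub> x = I +>\<^bsub>A\<^esub> y" for x y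
  proof -
    have "h x \<ominus>\<^bsub>B\<^esub> h y = \<zero>\<^bsub>B\<^esub>"
      using that ker coset_eq_iff[OF A I that(1,2)] by (simp flip: alg_hom_minus[OF h A B])
    thus ?thesis using that alg_homD(1)[OF h] B.minus_eq_zero_iff by metis
  qed
  have k: "k (I +>\<^bsub>A\<^esub> x) = h x" if "x \<in> carrier A" for x
  proof -
    define y where "y = (SOME y. y \<in> carrier A \<and> I +>\<^bsub>A\<^esub> y = I +>\<^bsub>A\<^esub> x)"
    have "y \<in> carrier A \<and> I +>\<^bsub>A\<^esub> y = I +>\<^bsub>A\<^esub> x"
      unfolding y_def by (rule someI[of _ x]) (use that in simp)
    thus ?thesis using eq[of y x] that by (simp add: k_def flip: y_def)
  qed
  have "k \<in> alg_hom (alg_quot A I) B"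
    by (auto simp: alg_hom_def ring_hom_def alg_quot_carrier[OF A I] alg_quot_smult[OF A I] alg_quot_add[OF A I]
        alg_quot_mult[OF A I] alg_quot_one[OF A I] k alg_homD[OF h]
        simp del: alg_quot_simps)
  thus ?thesis using k by auto
qed

lemma alg_quot_induced_iso:
  assumes h: "h \<in> alg_hom A B" and A: "calgebra A" and B: "calgebra B"
    and I: "ideal I A" and surj: "h ` carrier A = carrier B"
    and ker: "\<And>x. x \<in> carrier A \<Longrightarrow> h x = \<zero>\<^bsub>B\<^esub> \<longleftrightarrow> x \<in> I"
  shows "\<exists>k \<in> alg_iso (alg_quot A I) B. \<forall>x \<in> carrier A. k (I +>\<^bsub>A\<^esub> x) = h x"
proof -
  interpret A: calgebra A by fact
  interpret B: calgebra B by fact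
  interpret I: ideal I A by fact
  obtain k where k: "k \<in> alg_hom (alg_quot A I) B" "\<And>x. x \<in> carrier A \<Longrightarrow> k (I +>\<^bsub>A\<^esub> x) = h x"
    using alg_quot_lift[OF h A B I] ker I.a_subset by blast
  have inj: "I +>\<^bsub>A\<^esub> x = I +>\<^bsub>A\<^esub> y" if "x \<in> carrier A" "y \<in> carrier A" "h x = h y" for x y
  proof -
    have "h (x \<ominus>\<^bsub>A\<^esub> y) = \<zero>\<^bsub>B\<^esub>"
      using that alg_homD(1)[OF h] B.minus_eq_zero_iff by (simp add: alg_hom_minus[OF h A B])
    thus ?thesis using that(1,2) ker[of "x \<ominus>\<^bsub>A\<^esub> y"] coset_eq_iff[OF A I that(1,2)] by simp
  qed
  have "inj_on k (carrier (alg_quot A I))"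
  proof (rule inj_onI)
    fix X Y assume XY: "X \<in> carrier (alg_quot A I)" "Y \<in> carrier (alg_quot A I)" "k X = k Y"
    then obtain x y where "x \<in> carrier A" "X = I +>\<^bsub>A\<^esub> x" "y \<in> carrier A" "Y = I +>\<^bsub>A\<^esub> y"
      unfolding alg_quot_carrier[OF A I] by blast
    with XY(3) show "X = Y" using inj[of x y] k(2) by metis
  qed
  moreover have "k ` carrier (alg_quot A I) = h ` carrier A"
    unfolding alg_quot_carrier[OF A I] image_image by (intro image_cong refl) (rule k(2))
  ultimately have "bij_betw k (carrier (alg_quot A I)) (carrier B)"
    using surj by (simp add: bij_betw_def)
  thus ?thesis using k by (auto simp: alg_iso_def)
qed

text \<open>Each direction is minimality of a generated ideal: the preimage of an ideal is an ideal,
  once under \<open>h\<close> and once under its inverse \<open>k\<close>.\<close>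

lemma alg_iso_genideal:
  assumes h: "h \<in> alg_iso A B" and A: "calgebra A" and B: "calgebra B" and G: "G \<subseteq> carrier A" and x: "x \<in> carrier A"
  shows "h x \<in> Idl\<^bsub>B\<^esub> (h ` G) \<longleftrightarrow> x \<in> Idl\<^bsub>A\<^esub> G"
proof -
  interpret A: calgebra A by fact
  interpret B: calgebra B by fact
  have hom: "h \<in> alg_hom A B" and bij: "bij_betw h (carrier A) (carrier B)" using h by (simp_all add: alg_iso_def)
  note D = alg_homD[OF hom]
  have hG: "h ` G \<subseteq> carrier B" using G D(1) by auto
  define k where "k = inv_into (carrier A) h"
  have kh: "k (h x) = x" if "x \<in> carrier A" for x
    using bij that by (simp add: k_def bij_betw_inv_into_left)
  have surj: "\<exists>x\<in>carrier A. y = h x" if "y \<in> carrier B" for y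
    using bij that by (auto simp: bij_betw_def)
  have k: "k \<in> alg_hom B A"
  proof -
    have "k (y \<otimes>\<^bsub>B\<^esub> z) = k y \<otimes>\<^bsub>A\<^esub> k z" "k (y \<oplus>\<^bsub>B\<^esub> z) = k y \<oplus>\<^bsub>A\<^esub> k z" if yz: "y \<in> carrier B" "z \<in> carrier B" for y z
    proof -
      obtain a b where ab: "a \<in> carrier A" "y = h a" "b \<in> carrier A" "z = h b" using surj yz by blast
      show "k (y \<otimes>\<^bsub>B\<^esub> z) = k y \<otimes>\<^bsub>A\<^esub> k z" "k (y \<oplus>\<^bsub>B\<^esub> z) = k y \<oplus>\<^bsub>A\<^esub> k z"
        using ab by (simp_all add: kh flip: D(2,3))
    qed
    moreover have "k y \<in> carrier A" "k (c \<odot>\<^bsub>B\<^esub> y) = c \<odot>\<^bsub>A\<^esub> k y" if y: "y \<in> carrier B" for c y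
    proof -
      obtain a where a: "a \<in> carrier A" "y = h a" using surj y by blast
      show "k y \<in> carrier A" "k (c \<odot>\<^bsub>B\<^esub> y) = c \<odot>\<^bsub>A\<^esub> k y" using a by (simp_all add: kh flip: D(5))
    qed
    moreover have "k \<one>\<^bsub>B\<^esub> = \<one>\<^bsub>A\<^esub>" using kh[of "\<one>\<^bsub>A\<^esub>"] by (simp add: D(4))
    ultimately show ?thesis by (simp add: alg_hom_def ring_hom_def)
  qed
  have 1: "Idl\<^bsub>A\<^esub> G \<subseteq> {x \<in> carrier A. h x \<in> Idl\<^bsub>B\<^esub> (h ` G)}"
    using G B.genideal_self[OF hG]
    by (intro A.genideal_minimal alg_hom_vimage_ideal[OF hom A B] B.genideal_ideal[OF hG]) auto
  have "h ` G \<subseteq> {y \<in> carrier B. k y \<in> Idl\<^bsub>A\<^esub> G}"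
  proof (rule image_subsetI)
    fix x assume "x \<in> G"
    hence "x \<in> carrier A" "x \<in> Idl\<^bsub>A\<^esub> G" using G A.genideal_self[OF G] by auto
    thus "h x \<in> {y \<in> carrier B. k y \<in> Idl\<^bsub>A\<^esub> G}" by (simp add: kh D(1))
  qed
  hence 2: "Idl\<^bsub>B\<^esub> (h ` G) \<subseteq> {y \<in> carrier B. k y \<in> Idl\<^bsub>A\<^esub> G}"
    by (intro B.genideal_minimal alg_hom_vimage_ideal[OF k B A] A.genideal_ideal[OF G])
  show ?thesis
  proof
    assume "h x \<in> Idl\<^bsub>B\<^esub> (h ` G)"
    with 2 have "k (h x) \<in> Idl\<^bsub>A\<^esub> G" by blast
    thus "x \<in> Idl\<^bsub>A\<^esub> G" using kh[OF x] by simp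
  qed (use 1 in blast)
qed

subsection \<open>Generated subalgebras\<close>

lemma subalg_simps [simp]:
  "carrier (subalg A S) = alg_gen A S"
  "zero (subalg A S) = zero A"
  "one (subalg A S) = one A"
  "add (subalg A S) = add A"
  "monoid.mult (subalg A S) = monoid.mult A"
  "smult (subalg A S) = smult A"
  by (simp_all add: subalg_def)

lemma alg_gen_subset:
  assumes "calgebra A" "S \<subseteq> carrier A"
  shows "alg_gen A S \<subseteq> carrier A"
proof
  interpret calgebra A by fact
  fix x assume "x \<in> alg_gen A S" thus "x \<in> carrier A"
    using assms(2) by induction auto
qed

lemma calgebra_subalg:
  assumes A: "calgebra A" and S: "S \<subseteq> carrier A"
  shows "calgebra (subalg A S)"
proof -
  interpret calgebra A by fact
  note sub = subsetD[OF alg_gen_subset[OF A S]]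
  have z: "\<zero>\<^bsub>A\<^esub> \<in> alg_gen A S" using alg_gen.smult[OF alg_gen.one, of A 0 S] by (simp add: smult_zero_left)
  show ?thesis
  proof (rule calgebraI)
    show "ring (subalg A S)"
    proof (rule ringI)
      show "abelian_group (subalg A S)"
      proof (rule abelian_groupI)
        fix x assume "x \<in> carrier (subalg A S)"
        hence x: "x \<in> alg_gen A S" by simp
        have "\<ominus>\<^bsub>A\<^esub> x \<in> alg_gen A S"
          using alg_gen.smult[OF x, of "-1"] sub[OF x] by (simp add: smult_minus_one)
        thus "\<exists>y\<in>carrier (subalg A S). y \<oplus>\<^bsub>subalg A S\<^esub> x = \<zero>\<^bsub>subalg A S\<^esub>"
          using sub[OF x] by (auto intro!: bexI[of _ "\<ominus>\<^bsub>A\<^esub> x"] simp: l_neg)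
      qed (auto intro: alg_gen.intros z simp: sub a_ac)
      show "Group.monoid (subalg A S)"
        by (rule monoidI) (auto intro: alg_gen.intros simp: sub m_assoc)
    qed (auto simp: sub l_distr r_distr)
  qed (auto intro: alg_gen.intros simp: sub smult_add_left smult_add_right
      smult_smult smult_one smult_mult_left smult_mult_right)
qed

lemma alg_hom_image_alg_gen:
  assumes h: "h \<in> alg_hom A B" and A: "calgebra A" and S: "S \<subseteq> carrier A"
  shows "h ` alg_gen A S = alg_gen B (h ` S)"
proof (intro equalityI subsetI)
  note sub = subsetD[OF alg_gen_subset[OF A S]]
  { fix x assume "x \<in> alg_gen A S"
    hence "h x \<in> alg_gen B (h ` S)"
      by induction (auto simp: alg_homD[OF h] sub intro: alg_gen.intros) }
  thus "y \<in> alg_gen B (h ` S)" if "y \<in> h ` alg_gen A S" for y using that by auto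
  show "y \<in> h ` alg_gen A S" if "y \<in> alg_gen B (h ` S)" for y using that
  proof induction
    case (incl x) thus ?case by (auto intro: alg_gen.intros)
  next
    case one thus ?case using alg_homD(4)[OF h] alg_gen.one by (metis imageI)
  next
    case (add x y) thus ?case by (auto simp flip: alg_homD(2)[OF h] simp: sub intro!: imageI alg_gen.add)
  next
    case (mult x y) thus ?case by (auto simp flip: alg_homD(3)[OF h] simp: sub intro!: imageI alg_gen.mult)
  next
    case (smult x c) thus ?case by (auto simp flip: alg_homD(5)[OF h] simp: sub intro!: imageI alg_gen.smult)
  qed
qed

lemma subalg_a_inv:
  assumes A: "calgebra A" and S: "S \<subseteq> carrier A" and x: "x \<in> alg_gen A S" "y \<in> alg_gen A S"
  shows "x \<ominus>\<^bsub>subalg A S\<^esub> y = x \<ominus>\<^bsub>A\<^esub> y"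
proof -
  interpret A: calgebra A by fact
  interpret S: calgebra "subalg A S" by (rule calgebra_subalg[OF A S])
  show ?thesis using x subsetD[OF alg_gen_subset[OF A S]]
    by (simp add: A.minus_eq S.minus_eq flip: A.smult_minus_one S.smult_minus_one)
qed

subsection \<open>Finitely supported functions\<close>

abbreviation "sgl \<equiv> Poly_Mapping.single"
abbreviation "lkp \<equiv> Poly_Mapping.lookup"
abbreviation "kys \<equiv> Poly_Mapping.keys"

lemma sum_singles: "(\<Sum>k\<in>kys p. sgl k (lkp p k)) = p" for p :: "'k \<Rightarrow>\<^sub>0 'b::comm_monoid_add"
  by (rule poly_mapping_eqI) (simp add: lookup_sum lookup_single when_def in_keys_iff)

text \<open>Induction over the support that keeps every intermediate sum supported in
  \<open>C\<close>. Identities that are additive in each argument and hold on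
  \<open>carrier A \<times> carrier B\<close> thus reduce to basis elements.\<close>

lemma poly_mapping_induct [consumes 1, case_names zero single add]:
  fixes p :: "'k \<Rightarrow>\<^sub>0 'b::comm_monoid_add"
  assumes "kys p \<subseteq> C" "P 0" "\<And>x c. x \<in> C \<Longrightarrow> P (sgl x c)"
    "\<And>p q. kys p \<subseteq> C \<Longrightarrow> kys q \<subseteq> C \<Longrightarrow> P p \<Longrightarrow> P q \<Longrightarrow> P (p + q)"
  shows "P p"
proof -
  have "P (\<Sum>k\<in>K. sgl k (lkp p k)) \<and> kys (\<Sum>k\<in>K. sgl k (lkp p k)) \<subseteq> C"
    if "finite K" "K \<subseteq> C" for K
    using that
  proof (induction K rule: finite_induct)
    case (insert k K)
    then have "kys (sgl k (lkp p k) + (\<Sum>k\<in>K. sgl k (lkp p k))) \<subseteq> C"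
      using keys_add[of "sgl k (lkp p k)" "\<Sum>k\<in>K. sgl k (lkp p k)"] by (auto split: if_splits)
    with insert show ?case using assms(3,4) by auto
  qed (simp add: assms(2))
  from this[of "kys p"] show ?thesis using assms(1) by (simp add: sum_singles)
qed

text \<open>The coefficient is an argument of \<open>F\<close>, so that both the product of
  \<open>pair_alg\<close> and the evaluation of the free algebra are instances; additivity in the
  coefficient then gives additivity in \<open>p\<close>.\<close>

definition psum :: "('k \<Rightarrow> complex \<Rightarrow> 'v::comm_monoid_add) \<Rightarrow> ('k \<Rightarrow>\<^sub>0 complex) \<Rightarrow> 'v" where
  "psum F p = (\<Sum>k\<in>kys p. F k (lkp p k))"

lemma psum_zero [simp]: "psum F 0 = 0"
  by (simp add: psum_def)

lemma psum_single [simp]: "F k 0 = 0 \<Longrightarrow> psum F (sgl k c) = F k c"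
  by (cases "c = 0") (simp_all add: psum_def)

lemma psum_add:
  "(\<And>k. F k 0 = 0) \<Longrightarrow> (\<And>k a b. F k (a + b) = F k a + F k b) \<Longrightarrow> psum F (p + q) = psum F p + psum F q"
  unfolding psum_def by (rule setsum_keys_plus_distrib) auto

lemma psum_zero_fun [simp]: "psum (\<lambda>k c. 0) p = 0"
  by (simp add: psum_def)

lemma psum_add_fun: "psum (\<lambda>k c. F k c + G k c) p = psum F p + psum G p"
  by (simp add: psum_def sum.distrib)

lemma lookup_pmap_times [simp]: "lkp (Poly_Mapping.map ((*) c) p) k = c * lkp p k" for c :: complex
  by (simp add: Poly_Mapping.map.rep_eq when_def)

lemma keys_pmap_times: "kys (Poly_Mapping.map ((*) c) p) \<subseteq> kys p" for c :: complex
  by (auto simp: in_keys_iff)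

lemma keys_pmap_times_subset: "kys p \<subseteq> C \<Longrightarrow> kys (Poly_Mapping.map ((*) c) p) \<subseteq> C" for c :: complex
  using keys_pmap_times[of c p] by blast

lemma pmap_times_add: "Poly_Mapping.map ((*) c) (p + q) = Poly_Mapping.map ((*) c) p + Poly_Mapping.map ((*) c) q"
  for c :: complex
  by (rule poly_mapping_eqI) (simp add: lookup_add algebra_simps)

lemma pmap_times_zero [simp]: "Poly_Mapping.map ((*) c) 0 = 0" for c :: complex
  by (rule poly_mapping_eqI) simp

lemma pmap_times_single [simp]: "Poly_Mapping.map ((*) c) (sgl k d) = sgl k (c * d)" for c :: complex
  by (rule poly_mapping_eqI) (simp add: lookup_single when_def)

subsection \<open>The algebra of pairs\<close>

definition pmul :: "'a calg \<Rightarrow> 'b calg \<Rightarrow> 'a \<times> 'b \<Rightarrow> 'a \<times> 'b \<Rightarrow> 'a \<times> 'b" where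
  "pmul A B x y = (fst x \<otimes>\<^bsub>A\<^esub> fst y, snd x \<otimes>\<^bsub>B\<^esub> snd y)"

lemma pair_alg_simps [simp]:
  "carrier (pair_alg A B) = {p. kys p \<subseteq> carrier A \<times> carrier B}"
  "zero (pair_alg A B) = 0"
  "one (pair_alg A B) = sgl (\<one>\<^bsub>A\<^esub>, \<one>\<^bsub>B\<^esub>) 1"
  "add (pair_alg A B) = (+)"
  "smult (pair_alg A B) = (\<lambda>c p. Poly_Mapping.map ((*) c) p)"
  by (simp_all add: pair_alg_def)

lemma pair_alg_mult:
  "p \<otimes>\<^bsub>pair_alg A B\<^esub> q = psum (\<lambda>x c. psum (\<lambda>y d. sgl (pmul A B x y) (c * d)) q) p"
  by (simp add: pair_alg_def psum_def pmul_def case_prod_unfold)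

lemma pair_mult_add_left: "(p + p') \<otimes>\<^bsub>pair_alg A B\<^esub> q = p \<otimes>\<^bsub>pair_alg A B\<^esub> q + p' \<otimes>\<^bsub>pair_alg A B\<^esub> q"
  unfolding pair_alg_mult
  by (rule psum_add) (simp_all add: single_add distrib_right psum_add_fun)

lemma pair_mult_add_right: "p \<otimes>\<^bsub>pair_alg A B\<^esub> (q + q') = p \<otimes>\<^bsub>pair_alg A B\<^esub> q + p \<otimes>\<^bsub>pair_alg A B\<^esub> q'"
  unfolding pair_alg_mult
  by (simp add: psum_add single_add distrib_left psum_add_fun)

lemma pair_mult_zero [simp]: "0 \<otimes>\<^bsub>pair_alg A B\<^esub> q = 0" "p \<otimes>\<^bsub>pair_alg A B\<^esub> 0 = 0"
  by (simp_all add: pair_alg_mult)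

lemma pair_mult_single [simp]: "sgl x c \<otimes>\<^bsub>pair_alg A B\<^esub> sgl y d = sgl (pmul A B x y) (c * d)"
  by (simp add: pair_alg_mult)

lemma keys_add_subset: "kys p \<subseteq> C \<Longrightarrow> kys q \<subseteq> C \<Longrightarrow> kys (p + q) \<subseteq> C" for p :: "'k \<Rightarrow>\<^sub>0 complex"
  using keys_add[of p q] by blast

lemma keys_diff_subset: "kys p \<subseteq> C \<Longrightarrow> kys q \<subseteq> C \<Longrightarrow> kys (p - q) \<subseteq> C" for p :: "'k \<Rightarrow>\<^sub>0 complex"
  by (simp add: in_keys_iff lookup_minus subset_iff) (metis diff_self)

lemma keys_uminus_subset: "kys p \<subseteq> C \<Longrightarrow> kys (- p) \<subseteq> C" for p :: "'k \<Rightarrow>\<^sub>0 complex"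
  using keys_diff_subset[of 0 C p] by simp

lemma keys_single_subset: "x \<in> C \<Longrightarrow> kys (sgl x c) \<subseteq> C"
  by (cases "c = 0") auto

lemma calgebra_pair_alg:
  assumes A: "calgebra A" and B: "calgebra B"
  shows "calgebra (pair_alg A B)"
proof -
  interpret A: calgebra A by fact
  interpret B: calgebra B by fact
  let ?C = "carrier A \<times> carrier B"
  let ?m = "monoid.mult (pair_alg A B)"
  have pm: "pmul A B x y \<in> ?C" if "x \<in> ?C" "y \<in> ?C" for x y
    using that by (auto simp: pmul_def)
  have pm_assoc: "pmul A B (pmul A B x y) z = pmul A B x (pmul A B y z)" if "x \<in> ?C" "y \<in> ?C" "z \<in> ?C" for x y z
    using that by (auto simp: pmul_def A.m_assoc B.m_assoc)
  have closed: "kys (?m p q) \<subseteq> ?C" if "kys p \<subseteq> ?C" "kys q \<subseteq> ?C" for p q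
    using that(1)
  proof (induction p rule: poly_mapping_induct)
    case (single x c)
    show ?case using that(2)
      by (induction q rule: poly_mapping_induct)
        (simp_all add: pair_mult_add_right keys_add_subset keys_single_subset pm single del: keys_single)
  qed (simp_all add: pair_mult_add_left keys_add_subset)
  have assoc: "?m (?m p q) r = ?m p (?m q r)" if "kys p \<subseteq> ?C" "kys q \<subseteq> ?C" "kys r \<subseteq> ?C" for p q r
    using that(1)
  proof (induction p rule: poly_mapping_induct)
    case (single x c)
    note x = this
    show ?case using that(2)
    proof (induction q rule: poly_mapping_induct)
      case (single y d)
      show ?case using that(3)
        by (induction r rule: poly_mapping_induct)
          (simp_all add: pair_mult_add_right pm_assoc x single mult.assoc)
    qed (simp_all add: pair_mult_add_left pair_mult_add_right)
  qed (simp_all add: pair_mult_add_left)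
  have one: "?m (sgl (\<one>\<^bsub>A\<^esub>, \<one>\<^bsub>B\<^esub>) 1) p = p \<and> ?m p (sgl (\<one>\<^bsub>A\<^esub>, \<one>\<^bsub>B\<^esub>) 1) = p" if "kys p \<subseteq> ?C" for p
    using that by (induction p rule: poly_mapping_induct)
      (auto simp: pair_mult_add_left pair_mult_add_right pmul_def)
  have sm: "?m (Poly_Mapping.map ((*) c) p) q = Poly_Mapping.map ((*) c) (?m p q) \<and>
      ?m p (Poly_Mapping.map ((*) c) q) = Poly_Mapping.map ((*) c) (?m p q)"
    if "kys p \<subseteq> ?C" "kys q \<subseteq> ?C" for p q c
    using that(1)
  proof (induction p rule: poly_mapping_induct)
    case (single x d)
    show ?case using that(2)
      by (induction q rule: poly_mapping_induct)
        (auto simp: pair_mult_add_right pair_mult_add_left pmap_times_add mult.assoc mult.left_commute[of d])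
  qed (auto simp: pair_mult_add_left pmap_times_add)
  show ?thesis
  proof (rule calgebraI)
    show "ring (pair_alg A B)"
    proof (rule ringI)
      show "abelian_group (pair_alg A B)"
      proof (rule abelian_groupI)
        fix p assume "p \<in> carrier (pair_alg A B)"
        thus "\<exists>y\<in>carrier (pair_alg A B). y \<oplus>\<^bsub>pair_alg A B\<^esub> p = \<zero>\<^bsub>pair_alg A B\<^esub>"
          by (intro bexI[of _ "- p"]) (auto intro!: keys_uminus_subset)
      qed (simp_all add: keys_add_subset add.assoc add.commute)
      show "Group.monoid (pair_alg A B)"
        by (rule monoidI) (use closed assoc one keys_single_subset[of _ ?C] in auto)
    qed (simp_all add: pair_mult_add_left pair_mult_add_right)
  qed (simp_all add: sm keys_pmap_times_subset poly_mapping_eq_iff fun_eq_iff lookup_add distrib_right distrib_left)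
qed

lemma pair_alg_minus:
  assumes "calgebra A" "calgebra B" "p \<in> carrier (pair_alg A B)" "q \<in> carrier (pair_alg A B)"
  shows "p \<ominus>\<^bsub>pair_alg A B\<^esub> q = p - q"
proof -
  interpret calgebra "pair_alg A B" by (rule calgebra_pair_alg[OF assms(1,2)])
  have "\<ominus>\<^bsub>pair_alg A B\<^esub> q = - q"
    by (rule minus_equality) (use assms(4) in \<open>auto intro!: keys_uminus_subset\<close>)
  thus ?thesis by (simp add: a_minus_def)
qed

text \<open>The linear extension with values in a record algebra, where sums are
  \<open>finsum\<close> and membership in the carrier has to be tracked.\<close>

definition lin_ext :: "'c calg \<Rightarrow> ('k \<Rightarrow> 'c) \<Rightarrow> ('k \<Rightarrow>\<^sub>0 complex) \<Rightarrow> 'c" where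
  "lin_ext C \<beta> p = (\<Oplus>\<^bsub>C\<^esub>x\<in>kys p. lkp p x \<odot>\<^bsub>C\<^esub> \<beta> x)"

lemma lin_ext_zero: "calgebra C \<Longrightarrow> lin_ext C \<beta> 0 = \<zero>\<^bsub>C\<^esub>"
  by (simp add: lin_ext_def calgebra_def ring_def abelian_group_def abelian_monoid.finsum_empty)

lemma finsum_cong_calg:
  assumes "calgebra C" "\<And>i. i \<in> I \<Longrightarrow> f i = g i" "\<And>i. i \<in> I \<Longrightarrow> g i \<in> carrier C"
  shows "(\<Oplus>\<^bsub>C\<^esub>i\<in>I. f i) = (\<Oplus>\<^bsub>C\<^esub>i\<in>I. g i)"
proof -
  interpret calgebra C by fact
  show ?thesis using assms(2,3) by (intro finsum_cong') auto
qed

context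
  fixes C :: "'c calg" and \<beta> :: "'k \<Rightarrow> 'c" and K
  assumes alg: "calgebra C" and \<beta>: "\<And>x. x \<in> K \<Longrightarrow> \<beta> x \<in> carrier C"
begin

interpretation C: calgebra C by (rule alg)

text \<open>Elements with different supports can be compared over a common finite set, because the
  added terms have coefficient 0.\<close>

lemma lin_ext_superset:
  assumes "finite S" "kys p \<subseteq> S" "S \<subseteq> K"
  shows "lin_ext C \<beta> p = (\<Oplus>\<^bsub>C\<^esub>x\<in>S. lkp p x \<odot>\<^bsub>C\<^esub> \<beta> x)"
  unfolding lin_ext_def using assms \<beta>
  by (intro C.add.finprod_mono_neutral_cong_left) (auto simp: in_keys_iff C.smult_zero_left)

lemma lin_ext_closed: "kys p \<subseteq> K \<Longrightarrow> lin_ext C \<beta> p \<in> carrier C"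
  unfolding lin_ext_def using \<beta> by (intro C.finsum_closed) auto

lemma lin_ext_add:
  assumes "kys p \<subseteq> K" "kys q \<subseteq> K"
  shows "lin_ext C \<beta> (p + q) = lin_ext C \<beta> p \<oplus>\<^bsub>C\<^esub> lin_ext C \<beta> q"
proof -
  let ?S = "kys p \<union> kys q"
  have "lin_ext C \<beta> (p + q) = (\<Oplus>\<^bsub>C\<^esub>x\<in>?S. lkp p x \<odot>\<^bsub>C\<^esub> \<beta> x \<oplus>\<^bsub>C\<^esub> lkp q x \<odot>\<^bsub>C\<^esub> \<beta> x)"
    using assms \<beta> keys_add[of p q]
    by (subst lin_ext_superset[of ?S])
       (auto simp: lookup_add C.smult_add_left subset_iff simp del: C.finsum_addf intro!: finsum_cong_calg[OF alg])
  also have "\<dots> = (\<Oplus>\<^bsub>C\<^esub>x\<in>?S. lkp p x \<odot>\<^bsub>C\<^esub> \<beta> x) \<oplus>\<^bsub>C\<^esub> (\<Oplus>\<^bsub>C\<^esub>x\<in>?S. lkp q x \<odot>\<^bsub>C\<^esub> \<beta> x)"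
    using assms \<beta> by (intro C.finsum_addf) (auto simp: subset_iff)
  also have "\<dots> = lin_ext C \<beta> p \<oplus>\<^bsub>C\<^esub> lin_ext C \<beta> q"
    using assms by (simp add: lin_ext_superset[of ?S])
  finally show ?thesis .
qed

lemma lin_ext_smult:
  assumes "kys p \<subseteq> K"
  shows "lin_ext C \<beta> (Poly_Mapping.map ((*) c) p) = c \<odot>\<^bsub>C\<^esub> lin_ext C \<beta> p"
  using assms \<beta> keys_pmap_times[of c p]
  by (subst lin_ext_superset[of "kys p"])
     (auto simp: C.smult_finsum lin_ext_def C.smult_smult subset_iff intro!: C.finsum_cong')

lemma lin_ext_single: "x \<in> K \<Longrightarrow> lin_ext C \<beta> (sgl x c) = c \<odot>\<^bsub>C\<^esub> \<beta> x"
  using \<beta> by (subst lin_ext_superset[of "{x}"]) (auto simp: keys_single_subset)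

end

subsection \<open>Tensor products\<close>

lemma bilin_rels_subset:
  assumes "calgebra A" "calgebra B"
  shows "bilin_rels A B \<subseteq> carrier (pair_alg A B)"
proof -
  interpret A: calgebra A by fact
  interpret B: calgebra B by fact
  show ?thesis
    by (auto simp: bilin_rels_def simp del: keys_single
        dest!: subsetD[OF keys_diff_subset[where C = "carrier A \<times> carrier B"], rotated 2]
        intro!: keys_single_subset keys_diff_subset)
qed

lemma tensor_ideal_ideal:
  assumes "calgebra A" "calgebra B"
  shows "ideal (tensor_ideal A B) (pair_alg A B)"
proof -
  interpret calgebra "pair_alg A B" by (rule calgebra_pair_alg[OF assms])
  show ?thesis unfolding tensor_ideal_def
    by (rule genideal_ideal) (rule bilin_rels_subset[OF assms])
qed

lemma tensor_rel:
  assumes "calgebra A" "calgebra B" "r \<in> bilin_rels A B"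
  shows "r \<in> tensor_ideal A B"
proof -
  interpret calgebra "pair_alg A B" by (rule calgebra_pair_alg[OF assms(1,2)])
  show ?thesis unfolding tensor_ideal_def
    using genideal_self[OF bilin_rels_subset[OF assms(1,2)]] assms(3) by auto
qed

locale tensor_algebras = A: calgebra A + B: calgebra B for A :: "'a calg" and B :: "'b calg"
begin

lemma algs: "calgebra A" "calgebra B"
  by unfold_locales

abbreviation "cls p \<equiv> tensor_ideal A B +>\<^bsub>pair_alg A B\<^esub> p"
abbreviation "AB \<equiv> carrier A \<times> carrier B"

lemmas q_pair = calgebra_pair_alg[OF algs]
lemmas q_ideal = tensor_ideal_ideal[OF algs]

lemma calgebra_tensor: "calgebra (tensor A B)"
  unfolding tensor_def by (rule calgebra_alg_quot[OF q_pair q_ideal])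

sublocale T: calgebra "tensor A B" by (rule calgebra_tensor)

lemma carrier_tensor: "carrier (tensor A B) = cls ` {p. kys p \<subseteq> AB}"
  unfolding tensor_def by (simp only: alg_quot_carrier[OF q_pair q_ideal] pair_alg_simps)

lemma cls_hom: "(\<lambda>p. cls p) \<in> alg_hom (pair_alg A B) (tensor A B)"
  unfolding tensor_def by (rule proj_alg_hom[OF q_pair q_ideal])

lemma cls_closed: "kys p \<subseteq> AB \<Longrightarrow> cls p \<in> carrier (tensor A B)"
  using alg_homD(1)[OF cls_hom, of p] by simp

lemma cls_add: "kys p \<subseteq> AB \<Longrightarrow> kys q \<subseteq> AB \<Longrightarrow> cls (p + q) = cls p \<oplus>\<^bsub>tensor A B\<^esub> cls q"
  using alg_homD(2)[OF cls_hom, of p q] by simp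

lemma cls_mult: "kys p \<subseteq> AB \<Longrightarrow> kys q \<subseteq> AB \<Longrightarrow> cls (p \<otimes>\<^bsub>pair_alg A B\<^esub> q) = cls p \<otimes>\<^bsub>tensor A B\<^esub> cls q"
  using alg_homD(3)[OF cls_hom, of p q] by simp

lemma cls_smult: "kys p \<subseteq> AB \<Longrightarrow> cls (Poly_Mapping.map ((*) c) p) = c \<odot>\<^bsub>tensor A B\<^esub> cls p"
  using alg_homD(5)[OF cls_hom, of p] by simp

lemma cls_zero: "cls 0 = \<zero>\<^bsub>tensor A B\<^esub>"
  using alg_hom_zero[OF cls_hom q_pair calgebra_tensor] by simp

lemma cls_eq_iff:
  "kys p \<subseteq> AB \<Longrightarrow> kys q \<subseteq> AB \<Longrightarrow> cls p = cls q \<longleftrightarrow> p - q \<in> tensor_ideal A B"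
  using coset_eq_iff[OF q_pair q_ideal, of p q] pair_alg_minus[OF algs, of p q] by simp

lemma cls_single: "a \<in> carrier A \<Longrightarrow> b \<in> carrier B \<Longrightarrow> cls (sgl (a, b) c) = c \<odot>\<^bsub>tensor A B\<^esub> tens A B a b"
  unfolding tens_def by (simp flip: cls_smult)

lemma tens_closed [simp, intro]: "a \<in> carrier A \<Longrightarrow> b \<in> carrier B \<Longrightarrow> tens A B a b \<in> carrier (tensor A B)"
  unfolding tens_def by (rule cls_closed) simp

lemma keys_sgl_AB: "a \<in> carrier A \<Longrightarrow> b \<in> carrier B \<Longrightarrow> kys (sgl (a, b) c) \<subseteq> AB"
  by (rule keys_single_subset) simp

lemma tens_add_left:
  assumes "a \<in> carrier A" "a' \<in> carrier A" "b \<in> carrier B"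
  shows "tens A B (a \<oplus>\<^bsub>A\<^esub> a') b = tens A B a b \<oplus>\<^bsub>tensor A B\<^esub> tens A B a' b"
proof -
  have "sgl (a \<oplus>\<^bsub>A\<^esub> a', b) 1 - (sgl (a, b) 1 + sgl (a', b) 1) \<in> tensor_ideal A B"
    by (rule tensor_rel[OF algs]) (use assms in \<open>auto simp: bilin_rels_def diff_diff_eq\<close>)
  thus ?thesis unfolding tens_def using assms
    by (subst cls_add[symmetric]) (auto simp: cls_eq_iff keys_add_subset keys_sgl_AB simp del: keys_single)
qed

lemma tens_add_right:
  assumes "a \<in> carrier A" "b \<in> carrier B" "b' \<in> carrier B"
  shows "tens A B a (b \<oplus>\<^bsub>B\<^esub> b') = tens A B a b \<oplus>\<^bsub>tensor A B\<^esub> tens A B a b'"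
proof -
  have "sgl (a, b \<oplus>\<^bsub>B\<^esub> b') 1 - (sgl (a, b) 1 + sgl (a, b') 1) \<in> tensor_ideal A B"
    by (rule tensor_rel[OF algs]) (use assms in \<open>auto simp: bilin_rels_def diff_diff_eq\<close>)
  thus ?thesis unfolding tens_def using assms
    by (subst cls_add[symmetric]) (auto simp: cls_eq_iff keys_add_subset keys_sgl_AB simp del: keys_single)
qed

lemma tens_smult_left:
  assumes "a \<in> carrier A" "b \<in> carrier B"
  shows "tens A B (c \<odot>\<^bsub>A\<^esub> a) b = c \<odot>\<^bsub>tensor A B\<^esub> tens A B a b"
proof -
  have "sgl (c \<odot>\<^bsub>A\<^esub> a, b) 1 - sgl (a, b) c \<in> tensor_ideal A B"
    by (rule tensor_rel[OF algs]) (use assms in \<open>auto simp: bilin_rels_def\<close>)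
  thus ?thesis using assms
    by (subst cls_single[symmetric]) (auto simp: tens_def cls_eq_iff keys_sgl_AB simp del: keys_single)
qed

lemma tens_smult_right:
  assumes "a \<in> carrier A" "b \<in> carrier B"
  shows "tens A B a (c \<odot>\<^bsub>B\<^esub> b) = c \<odot>\<^bsub>tensor A B\<^esub> tens A B a b"
proof -
  have "sgl (a, c \<odot>\<^bsub>B\<^esub> b) 1 - sgl (a, b) c \<in> tensor_ideal A B"
    by (rule tensor_rel[OF algs]) (use assms in \<open>unfold bilin_rels_def, blast\<close>)
  thus ?thesis using assms
    by (subst cls_single[symmetric]) (auto simp: tens_def cls_eq_iff keys_sgl_AB simp del: keys_single)
qed

lemma tens_mult:
  assumes "a \<in> carrier A" "b \<in> carrier B" "a' \<in> carrier A" "b' \<in> carrier B"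
  shows "tens A B a b \<otimes>\<^bsub>tensor A B\<^esub> tens A B a' b' = tens A B (a \<otimes>\<^bsub>A\<^esub> a') (b \<otimes>\<^bsub>B\<^esub> b')"
  using cls_mult[of "sgl (a, b) 1" "sgl (a', b') 1"] assms
  by (simp add: tens_def pmul_def)

lemma one_tensor: "\<one>\<^bsub>tensor A B\<^esub> = tens A B \<one>\<^bsub>A\<^esub> \<one>\<^bsub>B\<^esub>"
  using alg_homD(4)[OF cls_hom] by (simp add: tens_def)

lemma tens_zero_left: "b \<in> carrier B \<Longrightarrow> tens A B \<zero>\<^bsub>A\<^esub> b = \<zero>\<^bsub>tensor A B\<^esub>"
  using tens_smult_left[of "\<zero>\<^bsub>A\<^esub>" b 0] by (simp add: A.smult_zero_left T.smult_zero_left)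

lemma tens_zero_right: "a \<in> carrier A \<Longrightarrow> tens A B a \<zero>\<^bsub>B\<^esub> = \<zero>\<^bsub>tensor A B\<^esub>"
  using tens_smult_right[of a "\<zero>\<^bsub>B\<^esub>" 0] by (simp add: B.smult_zero_left T.smult_zero_left)

lemma tensor_induct [consumes 1, case_names smult_tens add]:
  assumes "X \<in> carrier (tensor A B)"
    "\<And>a b c. a \<in> carrier A \<Longrightarrow> b \<in> carrier B \<Longrightarrow> P (c \<odot>\<^bsub>tensor A B\<^esub> tens A B a b)"
    "\<And>X Y. X \<in> carrier (tensor A B) \<Longrightarrow> Y \<in> carrier (tensor A B) \<Longrightarrow> P X \<Longrightarrow> P Y \<Longrightarrow> P (X \<oplus>\<^bsub>tensor A B\<^esub> Y)"
  shows "P X"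
proof -
  obtain p where p: "kys p \<subseteq> AB" and X: "X = cls p"
    using assms(1) carrier_tensor by auto
  show ?thesis unfolding X using p
  proof (induction p rule: poly_mapping_induct)
    case zero
    have "cls 0 = 0 \<odot>\<^bsub>tensor A B\<^esub> tens A B \<zero>\<^bsub>A\<^esub> \<zero>\<^bsub>B\<^esub>"
      by (simp add: cls_zero T.smult_zero_left)
    thus ?case using assms(2) by simp
  next
    case (single x c) thus ?case using assms(2) cls_single by (cases x) auto
  next
    case (add p q) thus ?case using assms(3) by (simp add: cls_add cls_closed)
  qed
qed

text \<open>The universal property of the tensor product for bilinear, multiplicative and unital
  \<open>\<beta>\<close>. The conclusion gives \<open>h\<close> on every class, not only on pure
  tensors, because \<open>tensor_map\<close> is defined through arbitrary representatives.\<close>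

lemma tensor_lift:
  fixes C :: "'c calg"
  assumes C: "calgebra C"
    and cl: "\<And>a b. a \<in> carrier A \<Longrightarrow> b \<in> carrier B \<Longrightarrow> \<beta> a b \<in> carrier C"
    and al: "\<And>a a' b. a \<in> carrier A \<Longrightarrow> a' \<in> carrier A \<Longrightarrow> b \<in> carrier B \<Longrightarrow>
       \<beta> (a \<oplus>\<^bsub>A\<^esub> a') b = \<beta> a b \<oplus>\<^bsub>C\<^esub> \<beta> a' b"
    and ar: "\<And>a b b'. a \<in> carrier A \<Longrightarrow> b \<in> carrier B \<Longrightarrow> b' \<in> carrier B \<Longrightarrow>
       \<beta> a (b \<oplus>\<^bsub>B\<^esub> b') = \<beta> a b \<oplus>\<^bsub>C\<^esub> \<beta> a b'"
    and sl: "\<And>c a b. a \<in> carrier A \<Longrightarrow> b \<in> carrier B \<Longrightarrow> \<beta> (c \<odot>\<^bsub>A\<^esub> a) b = c \<odot>\<^bsub>C\<^esub> \<beta> a b"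
    and sr: "\<And>c a b. a \<in> carrier A \<Longrightarrow> b \<in> carrier B \<Longrightarrow> \<beta> a (c \<odot>\<^bsub>B\<^esub> b) = c \<odot>\<^bsub>C\<^esub> \<beta> a b"
    and m: "\<And>a a' b b'. a \<in> carrier A \<Longrightarrow> a' \<in> carrier A \<Longrightarrow> b \<in> carrier B \<Longrightarrow> b' \<in> carrier B \<Longrightarrow>
       \<beta> (a \<otimes>\<^bsub>A\<^esub> a') (b \<otimes>\<^bsub>B\<^esub> b') = \<beta> a b \<otimes>\<^bsub>C\<^esub> \<beta> a' b'"
    and one: "\<beta> \<one>\<^bsub>A\<^esub> \<one>\<^bsub>B\<^esub> = \<one>\<^bsub>C\<^esub>"
  shows "\<exists>h \<in> alg_hom (tensor A B) C. \<forall>p. kys p \<subseteq> AB \<longrightarrow> h (cls p) = lin_ext C (\<lambda>(a, b). \<beta> a b) p"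
proof -
  interpret C: calgebra C by fact
  interpret Q: calgebra "pair_alg A B" by (rule q_pair)
  let ?L = "lin_ext C (\<lambda>(a, b). \<beta> a b)"
  have cl': "(case x of (a, b) \<Rightarrow> \<beta> a b) \<in> carrier C" if "x \<in> AB" for x
    using that cl by auto
  note L = lin_ext_add[where K = AB, OF C cl'] lin_ext_smult[where K = AB, OF C cl'] lin_ext_single[where K = AB, OF C cl']
    lin_ext_zero[OF C]
  note Lc = lin_ext_closed[where K = AB, OF C cl']
  have Lm: "?L (p \<otimes>\<^bsub>pair_alg A B\<^esub> q) = ?L p \<otimes>\<^bsub>C\<^esub> ?L q" if p: "kys p \<subseteq> AB" and q: "kys q \<subseteq> AB" for p q
    using p
  proof (induction p rule: poly_mapping_induct)
    case (single x c)
    note x = this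
    show ?case using q
    proof (induction q rule: poly_mapping_induct)
      case (single y d)
      have "pmul A B x y \<in> AB" using x single by (auto simp: pmul_def)
      thus ?case using x single m cl
        by (auto simp: L pmul_def C.smult_mult_left C.smult_mult_right C.smult_smult mult.commute split: prod.splits)
    next
      case (add p q)
      have "kys (sgl x c \<otimes>\<^bsub>pair_alg A B\<^esub> p) \<subseteq> AB" "kys (sgl x c \<otimes>\<^bsub>pair_alg A B\<^esub> q) \<subseteq> AB"
        using add(1,2) x keys_single_subset[of x AB c] Q.m_closed[of "sgl x c"] by auto
      thus ?case using add x cl'[OF x]
        by (simp add: pair_mult_add_right L Lc keys_single_subset C.r_distr del: keys_single)
    qed (use x cl'[OF x] in \<open>simp add: L Lc keys_single_subset del: keys_single\<close>)
  next
    case (add p p')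
    have "kys (p \<otimes>\<^bsub>pair_alg A B\<^esub> q) \<subseteq> AB" "kys (p' \<otimes>\<^bsub>pair_alg A B\<^esub> q) \<subseteq> AB"
      using add(1,2) q Q.m_closed[of _ q] by auto
    thus ?case using add q by (simp add: pair_mult_add_left L Lc C.l_distr)
  qed (use q in \<open>simp add: L Lc\<close>)
  have hom: "?L \<in> alg_hom (pair_alg A B) C"
    by (auto simp: alg_hom_def ring_hom_def L(1,2) Lc Lm L(3)[where x = "(\<one>\<^bsub>A\<^esub>, \<one>\<^bsub>B\<^esub>)"] one C.smult_one)
  \<comment> \<open>The kernel is a two-sided ideal, so it suffices that it contains the bilinearity
    relations.\<close>
  have ker: "?L p = \<zero>\<^bsub>C\<^esub>" if "p \<in> tensor_ideal A B" for p
  proof -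
    have diff: "?L (p - q) = \<zero>\<^bsub>C\<^esub>" if "kys p \<subseteq> AB" "kys q \<subseteq> AB" "?L p = ?L q" for p q
      using alg_hom_minus[OF hom q_pair C, of p q] that Lc by (simp add: pair_alg_minus[OF algs] C.minus_eq C.r_neg)
    note simps = keys_add_subset keys_sgl_AB L C.smult_one
    have "?L (sgl (a \<oplus>\<^bsub>A\<^esub> a', b) 1 - (sgl (a, b) 1 + sgl (a', b) 1)) = \<zero>\<^bsub>C\<^esub>"
      if "a \<in> carrier A" "a' \<in> carrier A" "b \<in> carrier B" for a a' b
      by (rule diff) (use that al cl in \<open>simp_all add: simps del: keys_single\<close>)
    moreover have "?L (sgl (a, b \<oplus>\<^bsub>B\<^esub> b') 1 - (sgl (a, b) 1 + sgl (a, b') 1)) = \<zero>\<^bsub>C\<^esub>"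
      if "a \<in> carrier A" "b \<in> carrier B" "b' \<in> carrier B" for a b b'
      by (rule diff) (use that ar cl in \<open>simp_all add: simps del: keys_single\<close>)
    moreover have "?L (sgl (c \<odot>\<^bsub>A\<^esub> a, b) 1 - sgl (a, b) c) = \<zero>\<^bsub>C\<^esub>"
      if "a \<in> carrier A" "b \<in> carrier B" for a b c
      by (rule diff) (use that sl cl in \<open>simp_all add: simps del: keys_single\<close>)
    moreover have "?L (sgl (a, c \<odot>\<^bsub>B\<^esub> b) 1 - sgl (a, b) c) = \<zero>\<^bsub>C\<^esub>"
      if "a \<in> carrier A" "b \<in> carrier B" for a b c
      by (rule diff) (use that sr cl in \<open>simp_all add: simps del: keys_single\<close>)
    ultimately have "bilin_rels A B \<subseteq> {p. ?L p = \<zero>\<^bsub>C\<^esub>}"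
      unfolding bilin_rels_def diff_diff_eq by (intro Un_least subsetI CollectI) (elim CollectE exE conjE, simp)+
    hence "bilin_rels A B \<subseteq> {p \<in> carrier (pair_alg A B). ?L p = \<zero>\<^bsub>C\<^esub>}"
      using bilin_rels_subset[OF algs] by auto
    hence "tensor_ideal A B \<subseteq> {p \<in> carrier (pair_alg A B). ?L p = \<zero>\<^bsub>C\<^esub>}"
      unfolding tensor_ideal_def by (rule Q.genideal_minimal[OF alg_hom_kernel_ideal[OF hom q_pair C]])
    thus ?thesis using that by auto
  qed
  show ?thesis
    using alg_quot_lift[OF hom q_pair C q_ideal ker] by (simp flip: tensor_def)
qed

lemma tensor_lift_tens:
  assumes "calgebra C" "h \<in> alg_hom (tensor A B) C" "\<beta> a b \<in> carrier C" "a \<in> carrier A" "b \<in> carrier B"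
    and "\<forall>p. kys p \<subseteq> AB \<longrightarrow> h (cls p) = lin_ext C (\<lambda>(a, b). \<beta> a b) p"
  shows "h (tens A B a b) = \<beta> a b"
proof -
  interpret C: calgebra C by fact
  show ?thesis
    unfolding tens_def using assms(3-6) lin_ext_single[OF assms(1), of "{(a, b)}" "\<lambda>(a, b). \<beta> a b" "(a, b)" 1]
    by (simp add: C.smult_one)
qed

lemma alg_hom_tensor_eqI:
  assumes "h \<in> alg_hom (tensor A B) C" "k \<in> alg_hom (tensor A B) C"
    "\<And>a b. a \<in> carrier A \<Longrightarrow> b \<in> carrier B \<Longrightarrow> h (tens A B a b) = k (tens A B a b)"
    "X \<in> carrier (tensor A B)"
  shows "h X = k X"
  using assms(4)
  by (induction rule: tensor_induct) (simp_all add: alg_homD[OF assms(1)] alg_homD[OF assms(2)] assms(3))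

end

lemma tensor_map_hom:
  fixes A :: "'a calg" and B :: "'b calg" and A' :: "'c calg" and B' :: "'d calg"
  assumes A: "calgebra A" and B: "calgebra B" and A': "calgebra A'" and B': "calgebra B'"
    and f: "f \<in> alg_hom A A'" and g: "g \<in> alg_hom B B'"
  shows "tensor_map A' B' f g \<in> alg_hom (tensor A B) (tensor A' B')"
    and "a \<in> carrier A \<Longrightarrow> b \<in> carrier B \<Longrightarrow> tensor_map A' B' f g (tens A B a b) = tens A' B' (f a) (g b)"
proof -
  interpret T: tensor_algebras A B using A B by (simp add: tensor_algebras_def)
  interpret T': tensor_algebras A' B' using A' B' by (simp add: tensor_algebras_def)
  note D = alg_homD[OF f] alg_homD[OF g]
  let ?\<beta> = "\<lambda>a b. tens A' B' (f a) (g b)"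
  obtain h where h: "h \<in> alg_hom (tensor A B) (tensor A' B')"
    "\<forall>p. kys p \<subseteq> T.AB \<longrightarrow> h (T.cls p) = lin_ext (tensor A' B') (\<lambda>(a, b). ?\<beta> a b) p"
    using T.tensor_lift[OF T'.calgebra_tensor, of ?\<beta>]
    by (auto simp: D T'.tens_add_left T'.tens_add_right T'.tens_smult_left T'.tens_smult_right T'.tens_mult T'.one_tensor)
  have cl: "(case x of (a, b) \<Rightarrow> ?\<beta> a b) \<in> carrier (tensor A' B')" if "x \<in> T.AB" for x
    using that D by auto
  define M where "M p = (\<Sum>(a, b)\<in>kys p. sgl (f a, g b) (lkp p (a, b)))" for p :: "'a \<times> 'b \<Rightarrow>\<^sub>0 complex"
  have "lin_ext (tensor A' B') (\<lambda>(a, b). ?\<beta> a b) p = T'.cls (M p)" if p: "kys p \<subseteq> T.AB" for p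
  proof -
    let ?s = "\<lambda>x. case x of (a, b) \<Rightarrow> sgl (f a, g b) (lkp p (a, b))"
    let ?t = "\<lambda>x. lkp p x \<odot>\<^bsub>tensor A' B'\<^esub> (case x of (a, b) \<Rightarrow> ?\<beta> a b)"
    have "T'.cls (sum ?s K) = (\<Oplus>\<^bsub>tensor A' B'\<^esub>x\<in>K. ?t x) \<and> kys (sum ?s K) \<subseteq> T'.AB"
      if "finite K" "K \<subseteq> T.AB" for K
      using that
    proof (induction K rule: finite_induct)
      case (insert x K)
      have x: "kys (?s x) \<subseteq> T'.AB" "T'.cls (?s x) = ?t x"
      proof -
        obtain a b where ab: "x = (a, b)" "a \<in> carrier A" "b \<in> carrier B" using insert.prems by auto
        show "kys (?s x) \<subseteq> T'.AB" unfolding ab(1) prod.case by (rule T'.keys_sgl_AB) (simp_all add: ab D)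
        show "T'.cls (?s x) = ?t x" using ab by (simp add: T'.cls_single D)
      qed
      have t: "?t y \<in> carrier (tensor A' B')" if "y \<in> insert x K" for y
        using cl[of y] that insert.prems by blast
      have "T'.cls (sum ?s (insert x K)) = ?t x \<oplus>\<^bsub>tensor A' B'\<^esub> (\<Oplus>\<^bsub>tensor A' B'\<^esub>x\<in>K. ?t x)"
        using insert x T'.cls_add[of "?s x" "sum ?s K"] by simp
      also have "\<dots> = (\<Oplus>\<^bsub>tensor A' B'\<^esub>x\<in>insert x K. ?t x)"
        using insert.hyps t by (subst T'.T.finsum_insert) auto
      finally show ?case using insert x by (simp add: keys_add_subset)
    qed (simp add: T'.cls_zero)
    from this[of "kys p"] p show ?thesis by (simp add: M_def lin_ext_def)
  qed
  hence hM: "h (T.cls p) = T'.cls (M p)" if "kys p \<subseteq> T.AB" for p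
    using h(2) that by simp
  \<comment> \<open>By \<open>hM\<close> every representative of \<open>X\<close> is sent to the
    same class, so the union in \<open>tensor_map_def\<close> collapses to the value of the lifted
    homomorphism.\<close>
  have eq: "tensor_map A' B' f g X = h X" if X: "X \<in> carrier (tensor A B)" for X
  proof -
    obtain p where p: "kys p \<subseteq> T.AB" "X = T.cls p" using X T.carrier_tensor by auto
    have "T'.cls (M q) = h X" if "q \<in> X" for q
    proof -
      have "q \<in> carrier (pair_alg A B)" "T.cls q = X"
        using coset_mem[OF T.q_pair T.q_ideal _ that[unfolded p(2)]] p by auto
      thus ?thesis using hM[of q] by simp
    qed
    moreover have "X \<noteq> {}" using coset_self[OF T.q_pair T.q_ideal, of p] p by auto
    ultimately show ?thesis unfolding tensor_map_def M_def by auto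
  qed
  show "tensor_map A' B' f g \<in> alg_hom (tensor A B) (tensor A' B')"
    by (rule alg_hom_cong[OF h(1) T.calgebra_tensor eq])
  show "tensor_map A' B' f g (tens A B a b) = tens A' B' (f a) (g b)" if "a \<in> carrier A" "b \<in> carrier B"
    using T.tensor_lift_tens[OF T'.calgebra_tensor h(1) _ that h(2)] eq that D by auto
qed

lemma id_alg_hom: "(\<lambda>x. x) \<in> alg_hom A A"
  by (auto simp: alg_hom_def ring_hom_def)

lemma tensor_map_surj:
  assumes A: "calgebra A" and B: "calgebra B" and A': "calgebra A'" and B': "calgebra B'"
    and f: "f \<in> alg_hom A A'" and g: "g \<in> alg_hom B B'"
    and surj: "f ` carrier A = carrier A'" "g ` carrier B = carrier B'"
  shows "tensor_map A' B' f g ` carrier (tensor A B) = carrier (tensor A' B')"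
proof -
  interpret T: tensor_algebras A B using A B by (simp add: tensor_algebras_def)
  interpret T': tensor_algebras A' B' using A' B' by (simp add: tensor_algebras_def)
  note h = tensor_map_hom[OF A B A' B' f g]
  have "X \<in> tensor_map A' B' f g ` carrier (tensor A B)" if "X \<in> carrier (tensor A' B')" for X
    using that
  proof (induction rule: T'.tensor_induct)
    case (smult_tens a b c)
    then obtain a' b' where ab: "a' \<in> carrier A" "b' \<in> carrier B" "a = f a'" "b = g b'"
      using surj by blast
    hence "c \<odot>\<^bsub>tensor A' B'\<^esub> tens A' B' a b = tensor_map A' B' f g (c \<odot>\<^bsub>tensor A B\<^esub> tens A B a' b')"
      by (simp add: alg_homD(5)[OF h(1)] h(2))
    thus ?case using ab by auto
  next
    case (add X Y)
    thus ?case by (auto simp flip: alg_homD(2)[OF h(1)])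
  qed
  thus ?thesis using alg_homD(1)[OF h(1)] by blast
qed

text \<open>
  Right exactness of \<open>A \<otimes> -\<close>: lifting the second factor along \<open>g\<close> gives a well-defined
  homomorphism from \<open>A \<otimes> B'\<close> to the quotient of \<open>A \<otimes> B\<close> by the ideal on the right-hand side.
\<close>

lemma tensor_map_kernel:
  fixes A :: "'a calg" and B :: "'b calg" and B' :: "'d calg"
  assumes A: "calgebra A" and B: "calgebra B" and B': "calgebra B'"
    and g: "g \<in> alg_hom B B'" and surj: "g ` carrier B = carrier B'"
    and G: "G \<subseteq> carrier B" "\<And>b. b \<in> carrier B \<Longrightarrow> g b = \<zero>\<^bsub>B'\<^esub> \<longleftrightarrow> b \<in> Idl\<^bsub>B\<^esub> G"
    and X: "X \<in> carrier (tensor A B)"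
  shows "tensor_map A B' (\<lambda>x. x) g X = \<zero>\<^bsub>tensor A B'\<^esub>
     \<longleftrightarrow> X \<in> Idl\<^bsub>tensor A B\<^esub> (tens A B \<one>\<^bsub>A\<^esub> ` G)"
proof -
  interpret T: tensor_algebras A B using A B by (simp add: tensor_algebras_def)
  interpret T': tensor_algebras A B' using A B' by (simp add: tensor_algebras_def)
  let ?T = "tensor A B" and ?T' = "tensor A B'"
  note D = alg_homD[OF g]
  note h = tensor_map_hom[OF A B A B' id_alg_hom g]
  let ?h = "tensor_map A B' (\<lambda>x. x) g"
  have GT: "tens A B \<one>\<^bsub>A\<^esub> ` G \<subseteq> carrier ?T" using G(1) by auto
  define K where "K = Idl\<^bsub>?T\<^esub> (tens A B \<one>\<^bsub>A\<^esub> ` G)"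
  interpret K: ideal K ?T unfolding K_def by (rule T.T.genideal_ideal[OF GT])
  have Kid: "ideal K ?T" ..
  define Q where "Q = alg_quot ?T K"
  have Q: "calgebra Q" unfolding Q_def by (rule calgebra_alg_quot[OF T.calgebra_tensor Kid])
  interpret Q: calgebra Q by (rule Q)
  define k where "k X = K +>\<^bsub>?T\<^esub> X" for X
  have k: "k \<in> alg_hom ?T Q"
    unfolding k_def[abs_def] Q_def by (rule proj_alg_hom[OF T.calgebra_tensor Kid])
  note kD = alg_homD[OF k]
  have k0: "k X = \<zero>\<^bsub>Q\<^esub> \<longleftrightarrow> X \<in> K" if "X \<in> carrier ?T" for X
    unfolding k_def Q_def using coset_zero_iff[OF T.calgebra_tensor Kid that] .
  have inK: "tens A B \<one>\<^bsub>A\<^esub> b \<in> K" if "b \<in> Idl\<^bsub>B\<^esub> G" for b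
  proof -
    have "(\<lambda>b. tens A B \<one>\<^bsub>A\<^esub> b) \<in> alg_hom B ?T"
      by (simp add: alg_hom_def ring_hom_def T.tens_add_right T.tens_mult T.tens_smult_right T.one_tensor)
    from alg_hom_vimage_ideal[OF this B T.calgebra_tensor Kid]
    have "ideal {b \<in> carrier B. tens A B \<one>\<^bsub>A\<^esub> b \<in> K} B" .
    moreover have "G \<subseteq> {b \<in> carrier B. tens A B \<one>\<^bsub>A\<^esub> b \<in> K}"
      using G(1) T.T.genideal_self[OF GT] by (auto simp: K_def)
    ultimately have "Idl\<^bsub>B\<^esub> G \<subseteq> {b \<in> carrier B. tens A B \<one>\<^bsub>A\<^esub> b \<in> K}"
      by (rule T.B.genideal_minimal)
    thus ?thesis using that by auto
  qed
  \<comment> \<open>A set-theoretic section of \<open>g\<close>, in general not additive or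
    multiplicative; \<open>key\<close> shows that after passing to \<open>Q\<close> the choice no
    longer matters.\<close>
  define s where "s b' = (SOME b. b \<in> carrier B \<and> g b = b')" for b'
  have s: "s b' \<in> carrier B" "g (s b') = b'" if "b' \<in> carrier B'" for b'
  proof -
    have "\<exists>b. b \<in> carrier B \<and> g b = b'" using that unfolding surj[symmetric] by (elim imageE) auto
    from someI_ex[OF this] show "s b' \<in> carrier B" "g (s b') = b'" by (simp_all add: s_def)
  qed
  have key: "k (tens A B a b) = k (tens A B a c)"
    if "a \<in> carrier A" "b \<in> carrier B" "c \<in> carrier B" "g b = g c" for a b c
  proof -
    have "g (b \<ominus>\<^bsub>B\<^esub> c) = \<zero>\<^bsub>B'\<^esub>"
      unfolding alg_hom_minus[OF g B B' that(2,3)]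
      by (rule T'.B.minus_eq_zero_iff[THEN iffD2]) (use that(2-4) D(1) in auto)
    hence "tens A B \<one>\<^bsub>A\<^esub> (b \<ominus>\<^bsub>B\<^esub> c) \<in> K"
      using G(2)[of "b \<ominus>\<^bsub>B\<^esub> c"] that(2,3) inK by simp
    \<comment> \<open>Since a \<otimes> (b - c) = (a \<otimes> 1)(1 \<otimes> (b - c)), membership
      in the ideal \<open>K\<close> extends from 1 \<otimes> (b - c) to an arbitrary first
      factor.\<close>
    hence "tens A B a \<one>\<^bsub>B\<^esub> \<otimes>\<^bsub>?T\<^esub> tens A B \<one>\<^bsub>A\<^esub> (b \<ominus>\<^bsub>B\<^esub> c) \<in> K"
      using that(1-3) by (intro K.I_l_closed) auto
    hence "k (tens A B a (b \<ominus>\<^bsub>B\<^esub> c)) = \<zero>\<^bsub>Q\<^esub>"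
      using that(1-3) by (simp add: T.tens_mult k0)
    moreover have "tens A B a (b \<ominus>\<^bsub>B\<^esub> c) \<oplus>\<^bsub>?T\<^esub> tens A B a c = tens A B a b"
      using that(1-3) by (simp add: T.B.minus_eq T.B.a_assoc T.B.l_neg flip: T.tens_add_right)
    ultimately show ?thesis
      using that(1-3) kD(2)[of "tens A B a (b \<ominus>\<^bsub>B\<^esub> c)" "tens A B a c"] kD(1) by simp
  qed
  let ?\<beta> = "\<lambda>a b'. k (tens A B a (s b'))"
  have sr: "?\<beta> a b' = k (tens A B a b)" if "a \<in> carrier A" "b \<in> carrier B" "g b = b'" for a b b'
    by (rule key) (use that s[of b'] D(1) in auto)
  obtain e where e: "e \<in> alg_hom ?T' Q"
    "\<forall>p. kys p \<subseteq> T'.AB \<longrightarrow> e (T'.cls p) = lin_ext Q (\<lambda>(a, b). ?\<beta> a b) p"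
  proof (rule bexE[OF T'.tensor_lift[OF Q, of ?\<beta>]])
    show "?\<beta> a (b \<oplus>\<^bsub>B'\<^esub> b') = ?\<beta> a b \<oplus>\<^bsub>Q\<^esub> ?\<beta> a b'" if "a \<in> carrier A" "b \<in> carrier B'" "b' \<in> carrier B'" for a b b'
      using that s by (subst sr[of a "s b \<oplus>\<^bsub>B\<^esub> s b'"]) (auto simp: D T.tens_add_right kD)
    show "?\<beta> a (c \<odot>\<^bsub>B'\<^esub> b) = c \<odot>\<^bsub>Q\<^esub> ?\<beta> a b" if "a \<in> carrier A" "b \<in> carrier B'" for a b c
      using that s by (subst sr[of a "c \<odot>\<^bsub>B\<^esub> s b"]) (auto simp: D T.tens_smult_right kD)
    show "?\<beta> (a \<otimes>\<^bsub>A\<^esub> a') (b \<otimes>\<^bsub>B'\<^esub> b') = ?\<beta> a b \<otimes>\<^bsub>Q\<^esub> ?\<beta> a' b'"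
      if "a \<in> carrier A" "a' \<in> carrier A" "b \<in> carrier B'" "b' \<in> carrier B'" for a a' b b'
      using that s by (subst sr[of "a \<otimes>\<^bsub>A\<^esub> a'" "s b \<otimes>\<^bsub>B\<^esub> s b'"]) (auto simp: D kD simp flip: T.tens_mult)
    show "?\<beta> \<one>\<^bsub>A\<^esub> \<one>\<^bsub>B'\<^esub> = \<one>\<^bsub>Q\<^esub>"
      by (subst sr[of "\<one>\<^bsub>A\<^esub>" "\<one>\<^bsub>B\<^esub>"]) (auto simp: D kD simp flip: T.one_tensor)
  qed (use s kD in \<open>auto simp: T.tens_add_left T.tens_smult_left\<close>)
  \<comment> \<open>The projection \<open>k\<close> factors through \<open>?h\<close>; hence the
    kernel of \<open>?h\<close> is contained in the kernel \<open>K\<close> of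
    \<open>k\<close>.\<close>
  have "e (?h X) = k X"
  proof (rule T.alg_hom_tensor_eqI[OF alg_hom_comp[OF h(1) e(1)] k _ X])
    fix a b assume ab: "a \<in> carrier A" "b \<in> carrier B"
    have "e (tens A B' a (g b)) = ?\<beta> a (g b)"
      by (rule T'.tensor_lift_tens[OF Q e(1) _ _ _ e(2)]) (use ab D s kD in auto)
    also have "\<dots> = k (tens A B a b)" using ab by (intro sr) auto
    finally show "e (?h (tens A B a b)) = k (tens A B a b)" using h(2) ab by simp
  qed
  hence "X \<in> K" if "?h X = \<zero>\<^bsub>?T'\<^esub>"
    using that k0[OF X] alg_hom_zero[OF e(1) T'.calgebra_tensor Q] by simp
  moreover have "?h X = \<zero>\<^bsub>?T'\<^esub>" if "X \<in> K"
  proof -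
    have "K \<subseteq> {X \<in> carrier ?T. ?h X = \<zero>\<^bsub>?T'\<^esub>}"
      unfolding K_def
    proof (rule T.T.genideal_minimal[OF alg_hom_kernel_ideal[OF h(1) T.calgebra_tensor T'.calgebra_tensor]])
      show "tens A B \<one>\<^bsub>A\<^esub> ` G \<subseteq> {X \<in> carrier ?T. ?h X = \<zero>\<^bsub>?T'\<^esub>}"
      proof (rule image_subsetI)
        fix b assume "b \<in> G"
        hence b: "b \<in> carrier B" "g b = \<zero>\<^bsub>B'\<^esub>"
          using G(1) G(2)[of b] T.B.genideal_self[OF G(1)] by auto
        hence "?h (tens A B \<one>\<^bsub>A\<^esub> b) = tens A B' \<one>\<^bsub>A\<^esub> \<zero>\<^bsub>B'\<^esub>"
          using h(2)[of "\<one>\<^bsub>A\<^esub>" b] by simp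
        thus "tens A B \<one>\<^bsub>A\<^esub> b \<in> {X \<in> carrier ?T. ?h X = \<zero>\<^bsub>?T'\<^esub>}"
          using b by (simp add: T'.tens_zero_right)
      qed
    qed
    thus ?thesis using that by auto
  qed
  ultimately show ?thesis unfolding K_def by blast
qed

section \<open>Series over complex algebras\<close>

text \<open>A type class rather than a record, so that \<open>'a fps\<close> with its ring
  operations is available for generating series. Scalars enter through a central embedding.\<close>

class complex_alg = ring_1 +
  fixes sc :: "complex \<Rightarrow> 'a"
  assumes sc_add: "sc (a + b) = sc a + sc b"
    and sc_mult: "sc (a * b) = sc a * sc b"
    and sc_one [simp]: "sc 1 = 1"
    and sc_central: "sc c * x = x * sc c"
begin

lemma sc_zero [simp]: "sc 0 = 0"
  using sc_add[of 0 0] by simp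

lemma sc_uminus: "sc (- c) = - sc c"
  using sc_add[of c "- c"] by (simp add: eq_neg_iff_add_eq_0 add.commute)

lemma sc_sum: "sc (sum f I) = (\<Sum>i\<in>I. sc (f i))"
  by (induction I rule: infinite_finite_induct) (simp_all add: sc_add)

lemma sc_power_minus_one: "sc ((- 1) ^ n) = (- 1) ^ n"
  by (induction n) (simp_all add: sc_mult sc_uminus)

end

instantiation complex :: complex_alg
begin
definition sc_complex :: "complex \<Rightarrow> complex" where "sc_complex c = c"
instance by standard (simp_all add: sc_complex_def)
end

text \<open>With x = 1/u this is x / (1 - c x), the expansion of 1/(u - c).\<close>

definition geo :: "complex \<Rightarrow> complex fps" where
  "geo c = Abs_fps (\<lambda>n. if n = 0 then 0 else c ^ (n - 1))"

lemma geo_nth_0 [simp]: "geo c $ 0 = 0"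
  by (simp add: geo_def)

lemma geo_eq: "geo c = fps_X + fps_const c * (fps_X * geo c)"
proof (rule fps_ext)
  fix n show "geo c $ n = (fps_X + fps_const c * (fps_X * geo c)) $ n"
    by (cases n; cases "n - 1") (simp_all add: geo_def)
qed

text \<open>The powers of 1/(u - c) have the binomial coefficients that occur in
  \<open>ser_shift\<close>. The recurrence \<open>geo_eq\<close> turns the induction step into
  Pascal's rule.\<close>

lemma geo_power_nth: "geo c ^ r $ n = (if r \<le> n then of_nat ((n - 1) choose (n - r)) * c ^ (n - r) else 0)"
proof (induction n arbitrary: r)
  case 0
  show ?case by (cases r) (simp_all add: fps_nth_power_0)
next
  case (Suc n)
  show ?case
  proof (cases r)
    case (Suc r')
    have "geo c ^ r = fps_X * geo c ^ r' + fps_const c * (fps_X * geo c ^ r)"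
      unfolding Suc power_Suc by (subst (1) geo_eq) (simp add: algebra_simps)
    from arg_cong[OF this, of "\<lambda>f. f $ Suc n"]
    have "geo c ^ r $ Suc n = geo c ^ r' $ n + c * geo c ^ r $ n" by simp
    also have "\<dots> = (if r \<le> Suc n then of_nat ((Suc n - 1) choose (Suc n - r)) * c ^ (Suc n - r) else 0)"
      unfolding Suc.IH
    proof (cases "r \<le> n")
      case True
      then obtain m where m: "n = Suc (r' + m)" using Suc by (auto dest: le_Suc_ex)
      show "(if r' \<le> n then of_nat (n - 1 choose (n - r')) * c ^ (n - r') else 0) +
        c * (if r \<le> n then of_nat (n - 1 choose (n - r)) * c ^ (n - r) else 0) =
        (if r \<le> Suc n then of_nat (Suc n - 1 choose (Suc n - r)) * c ^ (Suc n - r) else 0)"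
        unfolding m Suc by (simp add: Suc_diff_le algebra_simps)
    qed (use Suc in \<open>auto simp: not_le less_Suc_eq_le\<close>)
    finally show ?thesis .
  qed simp
qed

lemma geo_mult: "geo c * (1 - fps_const c * fps_X) = fps_X"
  using geo_eq[of c] by (simp add: algebra_simps)

text \<open>Both sides become \<open>geo a\<close> when multiplied by 1 - b \<open>geo a\<close>,
  which has constant term 1 and can be cancelled. This is the one-variable fact behind the
  composition of two shifts.\<close>

lemma geo_compose: "geo b oo geo a = geo (a + b)"
proof -
  let ?F = "1 - fps_const b * geo a"
  have "(geo b * (1 - fps_const b * fps_X)) oo geo a = geo a"
    unfolding geo_mult by simp
  hence 1: "(geo b oo geo a) * ?F = geo a"
    by (simp add: fps_compose_mult_distrib fps_compose_sub_distrib)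
  have "geo (a + b) * ?F * (1 - fps_const a * fps_X) = geo (a + b) * (1 - fps_const a * fps_X - fps_const b * (geo a * (1 - fps_const a * fps_X)))"
    by (simp add: algebra_simps)
  also have "\<dots> = geo (a + b) * (1 - fps_const (a + b) * fps_X)"
    unfolding geo_mult[of a] by (simp add: algebra_simps flip: fps_const_add)
  also have "\<dots> = geo a * (1 - fps_const a * fps_X)"
    unfolding geo_mult ..
  finally have 2: "geo (a + b) * ?F = geo a"
    using mult_right_cancel[of "1 - fps_const a * fps_X"] fps_nonzeroI[of "1 - fps_const a * fps_X" 0] by auto
  have "?F \<noteq> 0" by (rule fps_nonzeroI[of _ 0]) simp
  with 1 2 show ?thesis using mult_right_cancel by metis
qed

definition fmap :: "('a \<Rightarrow> 'b) \<Rightarrow> 'a fps \<Rightarrow> 'b fps" where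
  "fmap h f = Abs_fps (\<lambda>n. h (f $ n))"

lemma fmap_nth [simp]: "fmap h f $ n = h (f $ n)"
  by (simp add: fmap_def)

section \<open>The substitutions u -> u - c and u -> -u\<close>

definition shift :: "complex \<Rightarrow> 'a::complex_alg fps \<Rightarrow> 'a fps" where
  "shift c f = Abs_fps (\<lambda>n. \<Sum>r\<le>n. sc (of_nat ((n - 1) choose (n - r)) * c ^ (n - r)) * (f $ r))"

text \<open>The series f(-u). The sign is given by parity instead of a power of -1, so that the
  definition makes sense over a \<open>ring\<close> without a unit, in particular over
  \<open>yt\<close>.\<close>

definition neg :: "'a::ring fps \<Rightarrow> 'a fps" where
  "neg f = Abs_fps (\<lambda>n. if even n then f $ n else - (f $ n))"

text \<open>The range of summation may be any \<open>N\<close> beyond \<open>n\<close>, because the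
  r-th power of \<open>geo c\<close> starts in degree r. A common range is what allows sums to be
  exchanged below.\<close>

lemma shift_nth:
  assumes "n \<le> N"
  shows "shift c f $ n = (\<Sum>r\<le>N. sc (geo c ^ r $ n) * f $ r)"
proof -
  have "shift c f $ n = (\<Sum>r\<le>n. sc (geo c ^ r $ n) * f $ r)"
    by (simp add: shift_def geo_power_nth)
  also have "\<dots> = (\<Sum>r\<le>N. sc (geo c ^ r $ n) * f $ r)"
    using assms by (intro sum.mono_neutral_left) (auto simp: geo_power_nth)
  finally show ?thesis .
qed

lemma shift_add: "shift c (f + g) = shift c f + shift c g"
  by (rule fps_ext) (simp add: shift_def distrib_left sum.distrib)

lemma shift_uminus: "shift c (- f) = - shift c f"
  by (rule fps_ext) (simp add: shift_def sum_negf)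

lemma shift_diff: "shift c (f - g) = shift c f - shift c g"
  using shift_add[of c f "- g"] by (simp add: shift_uminus)

lemma shift_zero [simp]: "shift c 0 = 0"
  by (rule fps_ext) (simp add: shift_def)

lemma shift_sum: "shift c (sum F I) = (\<Sum>i\<in>I. shift c (F i))"
  by (induction I rule: infinite_finite_induct) (simp_all add: shift_add)

lemma shift_const [simp]: "shift c (fps_const x) = fps_const x"
proof (rule fps_ext)
  fix n show "shift c (fps_const x) $ n = fps_const x $ n"
    by (subst shift_nth[OF order_refl]) (simp add: if_distrib[of "\<lambda>y. _ * y"] sum.delta cong: if_cong)
qed

lemma shift_one [simp]: "shift c 1 = 1"
  using shift_const[of c 1] by simp

text \<open>Shifting substitutes \<open>geo c\<close> for the variable. The scalars are central, so
  the coefficients of two powers of \<open>geo c\<close> can be collected into those of their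
  product.\<close>

lemma shift_mult: "shift c (f * g) = shift c f * shift c g"
proof (rule fps_ext)
  fix n
  have "(shift c f * shift c g) $ n =
      (\<Sum>m\<le>n. (\<Sum>i\<le>n. sc (geo c ^ i $ m) * f $ i) * (\<Sum>j\<le>n. sc (geo c ^ j $ (n - m)) * g $ j))"
    unfolding fps_mult_nth atLeast0AtMost by (intro sum.cong refl arg_cong2[of _ _ _ _ "(*)"] shift_nth) auto
  also have "\<dots> = (\<Sum>m\<le>n. \<Sum>i\<le>n. \<Sum>j\<le>n. sc (geo c ^ i $ m * geo c ^ j $ (n - m)) * (f $ i * g $ j))"
    unfolding sum_product by (intro sum.cong refl) (simp add: sc_mult mult.assoc, metis mult.assoc sc_central)
  also have "\<dots> = (\<Sum>i\<le>n. \<Sum>m\<le>n. \<Sum>j\<le>n. sc (geo c ^ i $ m * geo c ^ j $ (n - m)) * (f $ i * g $ j))"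
    by (rule sum.swap)
  also have "\<dots> = (\<Sum>i\<le>n. \<Sum>j\<le>n. \<Sum>m\<le>n. sc (geo c ^ i $ m * geo c ^ j $ (n - m)) * (f $ i * g $ j))"
    by (intro sum.cong refl sum.swap)
  also have "\<dots> = (\<Sum>i\<le>n. \<Sum>j\<le>n. sc (geo c ^ (i + j) $ n) * (f $ i * g $ j))"
    by (intro sum.cong refl) (simp add: power_add fps_mult_nth sc_sum sum_distrib_right atLeast0AtMost)
  also have "\<dots> = (\<Sum>(i, j)\<in>{..n} \<times> {..n}. sc (geo c ^ (i + j) $ n) * (f $ i * g $ j))"
    by (simp add: sum.cartesian_product)
  \<comment> \<open>For i + j > n the power \<open>geo c ^ (i + j)\<close> has no term in degree n,
    which cuts the square down to the triangle of the Cauchy product.\<close>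
  also have "\<dots> = (\<Sum>(i, j)\<in>{(i, j). i + j \<le> n}. sc (geo c ^ (i + j) $ n) * (f $ i * g $ j))"
    by (intro sum.mono_neutral_right) (auto simp: geo_power_nth split: if_splits)
  also have "\<dots> = (\<Sum>k\<le>n. \<Sum>i\<le>k. sc (geo c ^ k $ n) * (f $ i * g $ (k - i)))"
    by (subst sum.triangle_reindex_eq) simp
  also have "\<dots> = shift c (f * g) $ n"
    by (subst shift_nth[OF order_refl]) (simp add: fps_mult_nth sum_distrib_left atLeast0AtMost)
  finally show "shift c (f * g) $ n = (shift c f * shift c g) $ n" ..
qed

lemma shift_shift: "shift a (shift b f) = shift (a + b) f"
proof (rule fps_ext)
  fix n
  have "shift a (shift b f) $ n = (\<Sum>s\<le>n. sc (geo a ^ s $ n) * (\<Sum>r\<le>n. sc (geo b ^ r $ s) * f $ r))"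
    by (subst shift_nth[OF order_refl]) (intro sum.cong refl arg_cong2[of _ _ _ _ "(*)"] shift_nth, auto)
  also have "\<dots> = (\<Sum>r\<le>n. \<Sum>s\<le>n. sc (geo b ^ r $ s * geo a ^ s $ n) * f $ r)"
    unfolding sum_distrib_left
    by (subst sum.swap) (intro sum.cong refl, metis mult.assoc mult.commute sc_mult)
  also have "\<dots> = (\<Sum>r\<le>n. sc ((geo b ^ r oo geo a) $ n) * f $ r)"
    by (simp add: fps_compose_nth sc_sum sum_distrib_right atLeast0AtMost)
  also have "\<dots> = shift (a + b) f $ n"
    by (subst shift_nth[OF order_refl]) (simp add: geo_compose flip: fps_compose_power)
  finally show "shift a (shift b f) $ n = shift (a + b) f $ n" .
qed

lemma shift_0 [simp]: "shift 0 f = f"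
proof (rule fps_ext)
  fix n
  have "shift 0 f $ n = (\<Sum>r\<le>n. if r = n then f $ r else 0)"
    unfolding shift_def fps_nth_Abs_fps by (intro sum.cong refl) (auto simp: power_0_left)
  thus "shift 0 f $ n = f $ n" by simp
qed

lemma shift_nth_0 [simp]: "shift c f $ 0 = f $ 0"
  by (simp add: shift_def)

lemma shift_nth_lowest:
  assumes "\<And>m. m < n \<Longrightarrow> f $ m = 0"
  shows "shift c f $ n = f $ n" "m < n \<Longrightarrow> shift c f $ m = 0"
proof -
  have "shift c f $ n = (\<Sum>r\<le>n. if r = n then f $ n else 0)"
    unfolding shift_def fps_nth_Abs_fps by (intro sum.cong refl) (use assms in auto)
  thus "shift c f $ n = f $ n" by simp
  show "m < n \<Longrightarrow> shift c f $ m = 0"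
    unfolding shift_def fps_nth_Abs_fps by (intro sum.neutral) (use assms in auto)
qed

lemma neg_nth [simp]: "neg f $ n = (- 1) ^ n * f $ n" for f :: "'a::ring_1 fps"
  by (simp add: neg_def)

lemma minus_one_power_comm: "(- 1) ^ n * x = x * (- 1) ^ n" for x :: "'a::ring_1"
  by (cases "even n") auto

lemma neg_mult: "neg (f * g) = neg f * neg g"
proof (rule fps_ext)
  fix n
  have "neg (f * g) $ n = (\<Sum>i\<le>n. if even n then f $ i * g $ (n - i) else - (f $ i * g $ (n - i)))"
    by (simp add: neg_def fps_mult_nth atLeast0AtMost sum_negf)
  also have "\<dots> = (neg f * neg g) $ n"
    unfolding fps_mult_nth atLeast0AtMost
    by (intro sum.cong refl) (auto simp: neg_def)
  finally show "neg (f * g) $ n = (neg f * neg g) $ n" .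
qed

lemma neg_add: "neg (f + g) = neg f + neg g"
  by (rule fps_ext) (simp add: neg_def)

lemma neg_diff: "neg (f - g) = neg f - neg g"
  by (rule fps_ext) (simp add: neg_def)

lemma neg_zero [simp]: "neg 0 = 0"
  by (rule fps_ext) (simp add: neg_def)

lemma neg_one [simp]: "neg 1 = (1 :: 'a::ring_1 fps)"
  by (rule fps_ext) simp

lemma neg_sum: "neg (sum F I) = (\<Sum>i\<in>I. neg (F i))"
  by (induction I rule: infinite_finite_induct) (simp_all add: neg_add)

lemma neg_neg [simp]: "neg (neg f) = f"
  by (rule fps_ext) (simp add: neg_def)

text \<open>Both sides are f(-u - c).\<close>

lemma neg_shift: "neg (shift c f) = shift (- c) (neg f)"
proof (rule fps_ext)
  fix n
  have *: "sc (of_nat k * (- c) ^ (n - r)) * ((- 1) ^ r * x) = (- 1) ^ n * (sc (of_nat k * c ^ (n - r)) * x)"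
    if "r \<le> n" for k r and x :: 'a
  proof -
    have "of_nat k * (- c) ^ (n - r) * (- 1) ^ r = (- 1) ^ n * (of_nat k * c ^ (n - r))"
      using that by (simp add: power_minus[of c] mult_ac flip: power_add)
    from arg_cong[OF this, of "\<lambda>c. sc c * x"] show ?thesis by (simp add: sc_mult sc_power_minus_one mult.assoc)
  qed
  show "neg (shift c f) $ n = shift (- c) (neg f) $ n"
    by (simp add: shift_def sum_distrib_left *)
qed

lemma additive_zero: "(\<And>x y. h (x + y) = h x + h y) \<Longrightarrow> h 0 = 0" for h :: "'a::monoid_add \<Rightarrow> 'b::group_add"
  by (metis add.right_neutral add_left_imp_eq)

lemma additive_sum: "(\<And>x y. h (x + y) = h x + h y) \<Longrightarrow> h (sum f I) = (\<Sum>i\<in>I. h (f i))"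
  for h :: "'a::comm_monoid_add \<Rightarrow> 'b::ab_group_add"
  using additive_zero[of h] by (induction I rule: infinite_finite_induct) simp_all

lemma additive_minus: "(\<And>x y. h (x + y) = h x + h y) \<Longrightarrow> h (- x) = - h x"
  for h :: "'a::group_add \<Rightarrow> 'b::group_add"
  using additive_zero[of h] by (metis add.right_inverse neg_eq_iff_add_eq_0)

lemma additive_diff: "(\<And>x y. h (x + y) = h x + h y) \<Longrightarrow> h (x - y) = h x - h y"
  for h :: "'a::group_add \<Rightarrow> 'b::group_add"
  using additive_minus[of h y] by (metis diff_conv_add_uminus)

lemma fmap_mult:
  fixes h :: "'a::ring \<Rightarrow> 'b::ring"
  assumes "\<And>x y. h (x + y) = h x + h y" "\<And>x y. h (x * y) = h x * h y"
  shows "fmap h (f * g) = fmap h f * fmap h g"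
  by (rule fps_ext) (simp add: fps_mult_nth additive_sum[of h] assms)

section \<open>Series with central coefficients and the equation for g(u)\<close>

definition central :: "'a::ring_1 fps \<Rightarrow> bool" where
  "central f \<longleftrightarrow> (\<forall>n x. f $ n * x = x * f $ n)"

lemma central_commute: "central f \<Longrightarrow> f * g = g * f"
proof (rule fps_ext)
  fix n assume c: "central f"
  have "(f * g) $ n = (\<Sum>i\<le>n. g $ (n - i) * f $ i)"
    using c by (simp add: fps_mult_nth atLeast0AtMost central_def)
  also have "\<dots> = (g * f) $ n"
    unfolding fps_mult_nth atLeast0AtMost
    by (rule sum.reindex_bij_witness[of _ "\<lambda>i. n - i" "\<lambda>i. n - i"]) auto
  finally show "(f * g) $ n = (g * f) $ n" .
qed

lemma central_nth_mult: "central f \<Longrightarrow> central g \<Longrightarrow> central (f * g)"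
  unfolding central_def
proof (intro allI)
  fix n x assume *: "\<forall>n x. f $ n * x = x * f $ n" "\<forall>n x. g $ n * x = x * g $ n"
  show "(f * g) $ n * x = x * (f * g) $ n"
    unfolding fps_mult_nth sum_distrib_left sum_distrib_right
    by (intro sum.cong refl) (metis * mult.assoc)
qed

lemma central_shift: "central f \<Longrightarrow> central (shift c f)"
  unfolding central_def
proof (intro allI)
  fix n x assume *: "\<forall>n x. f $ n * x = x * f $ n"
  show "shift c f $ n * x = x * shift c f $ n"
    unfolding shift_def fps_nth_Abs_fps sum_distrib_left sum_distrib_right
    by (intro sum.cong refl) (metis * mult.assoc sc_central)
qed

lemma central_neg: "central f \<Longrightarrow> central (neg f)"
  unfolding central_def by (metis neg_nth minus_one_power_comm mult.assoc)

lemma fps_mult_nth_lowest: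
  fixes f g :: "'a::ring_1 fps"
  assumes "\<And>m. m < n \<Longrightarrow> f $ m = 0"
  shows "(f * g) $ n = f $ n * g $ 0" "(g * f) $ n = g $ 0 * f $ n" "m < n \<Longrightarrow> (f * g) $ m = 0"
proof -
  have "(f * g) $ n = (\<Sum>i\<le>n. if i = n then f $ n * g $ 0 else 0)"
    unfolding fps_mult_nth atLeast0AtMost by (intro sum.cong refl) (use assms in auto)
  thus "(f * g) $ n = f $ n * g $ 0" by simp
  have "(g * f) $ n = (\<Sum>i\<le>n. if i = 0 then g $ 0 * f $ n else 0)"
    unfolding fps_mult_nth atLeast0AtMost by (intro sum.cong refl) (use assms in auto)
  thus "(g * f) $ n = g $ 0 * f $ n" by simp
  show "m < n \<Longrightarrow> (f * g) $ m = 0"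
    unfolding fps_mult_nth by (intro sum.neutral) (use assms in auto)
qed

text \<open>
  The equation \<open>f(u - a) f(u - b) z(u) = 1\<close> determines the coefficients of \<open>f\<close> recursively,
  since the coefficient of index \<open>n\<close> enters with the factor 2.
\<close>

lemma shift_product_nth:
  assumes n: "n > 0" and f0: "f $ 0 = 1" and z0: "z $ 0 = 1"
    and eq: "\<And>m. m < n \<Longrightarrow> f' $ m = f $ m" and f'n: "f' $ n = 0"
  shows "(shift a f * shift b f * z) $ n = (shift a f' * shift b f' * z) $ n + (f $ n + f $ n)"
proof -
  \<comment> \<open>\<open>d\<close> starts in degree n, so each correction term below has
    coefficient \<open>f $ n\<close> there: a shift keeps the leading coefficient, and all other
    factors have constant term 1.\<close>
  define d where "d = f - f'"
  have f: "f = f' + d" by (simp add: d_def)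
  have d: "d $ m = 0" if "m < n" for m using eq[OF that] by (simp add: d_def)
  have dn: "d $ n = f $ n" using f'n by (simp add: d_def)
  have sd: "shift c d $ m = 0" if "m < n" for c m using shift_nth_lowest(2)[of n d, OF d that] .
  have sdn: "shift c d $ n = f $ n" for c using shift_nth_lowest(1)[of n d, OF d] dn by simp
  have f'0: "f' $ 0 = 1" using eq[OF n] f0 by simp
  have "shift a f * shift b f * z = shift a f' * shift b f' * z + shift a f' * (shift b d * z) + shift a d * (shift b f * z)"
    by (simp add: f shift_add algebra_simps)
  moreover have "(shift a d * (shift b f * z)) $ n = f $ n"
    using fps_mult_nth_lowest(1)[where n = n and f = "shift a d" and g = "shift b f * z", OF sd] by (simp add: sdn f0 z0)
  moreover have "(shift b d * z) $ n = f $ n"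
    using fps_mult_nth_lowest(1)[where n = n and f = "shift b d" and g = z, OF sd] by (simp add: sdn z0)
  hence "(shift a f' * (shift b d * z)) $ n = f $ n"
    using fps_mult_nth_lowest(2)[where n = n and f = "shift b d * z" and g = "shift a f'"]
      fps_mult_nth_lowest(3)[where n = n and f = "shift b d" and g = z, OF sd] by (simp add: f'0)
  ultimately show ?thesis by (simp add: add.assoc)
qed

text \<open>The coefficients of the solution of g(u) g(u - 1) q(u) = 1. If f' is g truncated below
  degree n, the coefficient of index n of the equation reads 0 = (f'(u) f'(u - 1) q(u))_n + 2 g_n,
  which is solved for g_n.\<close>

function sqc :: "'a::complex_alg fps \<Rightarrow> nat \<Rightarrow> 'a" where
  "sqc q n = (if n = 0 then 1 else
     (let f' = Abs_fps (\<lambda>m. if m < n then sqc q m else 0) in - (sc (1/2) * (f' * shift 1 f' * q) $ n)))"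
  by pat_completeness auto
termination by (relation "measure snd") auto

declare sqc.simps [simp del]

lemma exists_shift_inverse:
  fixes q :: "'a::complex_alg fps"
  assumes q: "central q" "q $ 0 = 1"
  shows "\<exists>g. central g \<and> g $ 0 = 1 \<and> g * shift 1 g * q = 1"
proof -
  define g where "g = Abs_fps (sqc q)"
  define t where "t n = Abs_fps (\<lambda>m. if m < n then g $ m else 0)" for n
  have g0: "g $ 0 = 1" by (simp add: g_def sqc.simps)
  have gn: "g $ n = - (sc (1/2) * (t n * shift 1 (t n) * q) $ n)" if "n > 0" for n
    unfolding t_def g_def fps_nth_Abs_fps using that by (subst sqc.simps) (simp add: Let_def)
  \<comment> \<open>The recursion expresses each coefficient through earlier ones and those of
    \<open>q\<close>, so centrality is inherited degree by degree.\<close>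
  have "g $ n * x = x * g $ n" for n x
  proof (induction n arbitrary: x rule: less_induct)
    case (less n)
    show ?case
    proof (cases "n = 0")
      case False
      have "central (t n)" using less by (simp add: central_def t_def)
      hence "central (t n * shift 1 (t n) * q)"
        by (intro central_nth_mult central_shift q)
      thus ?thesis using False unfolding central_def
        by (simp add: gn) (metis mult.assoc sc_central)
    qed (simp add: g0)
  qed
  hence "central g" by (simp add: central_def)
  moreover have "(g * shift 1 g * q) $ n = 1 $ n" for n
  proof (cases "n = 0")
    case False
    have "(g * shift 1 g * q) $ n = (t n * shift 1 (t n) * q) $ n + (g $ n + g $ n)"
      using shift_product_nth[where n = n and f = g and z = q and f' = "t n" and a = 0 and b = 1] False g0 q by (simp add: t_def)
    also have "g $ n + g $ n = - (sc (1/2 + 1/2) * (t n * shift 1 (t n) * q) $ n)"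
      unfolding sc_add distrib_right using False by (simp add: gn)
    finally show ?thesis using False by simp
  qed (simp add: g0 q)
  hence "g * shift 1 g * q = 1" by (rule fps_ext)
  ultimately show ?thesis using g0 by blast
qed

section \<open>The RTT relation in two variables\<close>

text \<open>
  In \<open>'a fps fps\<close> the outer variable stands for \<open>1/u\<close> and the inner one for \<open>1/v\<close>, so that
  \<open>u - v\<close> becomes \<open>(V - U) / (U V)\<close>.
\<close>

abbreviation UU :: "'a::ring_1 fps fps" where "UU \<equiv> fps_X"
abbreviation VV :: "'a::ring_1 fps fps" where "VV \<equiv> fps_const fps_X"

text \<open>In the two-variable ring, \<open>up f\<close> is f(u), while \<open>fps_const f\<close>
  is f(v).\<close>

definition up :: "'a::ring_1 fps \<Rightarrow> 'a fps fps" where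
  "up f = fmap fps_const f"

text \<open>The entrywise form (u - v) [t_ij(u), t_kl(v)] = t_kj(u) t_il(v) - t_kj(v) t_il(u) of the
  defining relation, multiplied by UV.\<close>

definition rtt :: "('i \<Rightarrow> 'i \<Rightarrow> 'a::ring_1 fps) \<Rightarrow> bool" where
  "rtt t \<longleftrightarrow> (\<forall>i j k l. (VV - UU) * (up (t i j) * fps_const (t k l) - fps_const (t k l) * up (t i j)) =
     UU * VV * (up (t k j) * fps_const (t i l) - fps_const (t k j) * up (t i l)))"

lemma up_nth [simp]: "up f $ n = fps_const (f $ n)"
  by (simp add: up_def)

lemma up_mult: "up (f * g) = up f * up g"
  unfolding up_def by (rule fmap_mult) (simp_all add: fps_const_mult)

lemma UU_commute: "UU * F = F * UU"
  by (rule fps_ext) simp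

lemma fps_X_commute: "fps_X * f = f * fps_X" for f :: "'a::ring_1 fps"
  by (rule fps_ext) simp

lemma VV_commute: "VV * F = F * VV"
  by (rule fps_ext) (simp add: fps_X_commute)

lemma UV_commute: "x * (UU * VV) = UU * VV * x"
proof -
  have "x * (UU * VV) = UU * x * VV"
    unfolding mult.assoc[symmetric] UU_commute[of x] ..
  also have "\<dots> = UU * VV * x"
    unfolding mult.assoc VV_commute[of x] ..
  finally show ?thesis .
qed

text \<open>Each term is quadratic with one entry at u and one at v, so the central factor g(u) g(v)
  can be taken out of both sides.\<close>

lemma rtt_scale:
  assumes g: "central g" and t: "rtt t"
  shows "rtt (\<lambda>i j. g * t i j)"
proof -
  let ?a = "up g" and ?b = "fps_const g"
  have upc: "up g * F = F * up g" for F :: "'a fps fps"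
  proof (rule central_commute)
    have "central (fps_const (g $ n))" for n
      using g by (simp add: central_def)
    thus "central (up g)" unfolding central_def[of "up g"] up_nth using central_commute by blast
  qed
  have cc: "fps_const g * F = F * fps_const g" for F :: "'a fps fps"
    by (rule central_commute) (use central_commute[OF g] in \<open>simp add: central_def\<close>)
  have 1: "up (g * x) * fps_const (g * y) = ?a * ?b * (up x * fps_const y)" for x y
    unfolding up_mult fps_const_mult[symmetric] by (metis cc mult.assoc)
  have 2: "fps_const (g * y) * up (g * x) = ?a * ?b * (fps_const y * up x)" for x y
    unfolding up_mult fps_const_mult[symmetric] by (metis upc mult.assoc)
  have c: "Z * (?a * ?b * F) = ?a * ?b * (Z * F)" for Z F :: "'a fps fps"
    by (metis cc upc mult.assoc)
  show ?thesis
    unfolding rtt_def 1 2 right_diff_distrib[symmetric] c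
    using t by (simp add: rtt_def right_diff_distrib)
qed

text \<open>The specialization v = u: the coefficient of index n collects all terms of total degree
  n.\<close>

definition diag :: "'a::ring_1 fps fps \<Rightarrow> 'a fps" where
  "diag F = Abs_fps (\<lambda>n. \<Sum>k\<le>n. F $ k $ (n - k))"

lemma diag_diff: "diag (F - G) = diag F - diag G"
  by (rule fps_ext) (simp add: diag_def sum_subtractf)

lemma diag_add: "diag (F + G) = diag F + diag G"
  by (rule fps_ext) (simp add: diag_def sum.distrib)

lemma diag_UU: "diag (UU * F) = fps_X * diag F"
proof (rule fps_ext)
  fix n show "diag (UU * F) $ n = (fps_X * diag F) $ n"
    by (cases n) (simp_all add: diag_def sum.atMost_Suc_shift del: sum.atMost_Suc)
qed

lemma diag_VV: "diag (VV * F) = fps_X * diag F"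
proof (rule fps_ext)
  fix n show "diag (VV * F) $ n = (fps_X * diag F) $ n"
    by (cases n) (simp_all add: diag_def Suc_diff_le)
qed

lemma diag_up_const: "diag (up f * fps_const g) = f * g"
proof (rule fps_ext)
  fix n
  have "diag (up f * fps_const g) $ n = (\<Sum>k\<le>n. f $ k * g $ (n - k))"
    by (simp add: diag_def)
  thus "diag (up f * fps_const g) $ n = (f * g) $ n"
    by (simp add: fps_mult_nth atLeast0AtMost)
qed

lemma diag_const_up: "diag (fps_const g * up f) = g * f"
proof (rule fps_ext)
  fix n
  have "diag (fps_const g * up f) $ n = (\<Sum>k\<le>n. g $ (n - k) * f $ k)"
    by (simp add: diag_def)
  also have "\<dots> = (\<Sum>k\<le>n. g $ k * f $ (n - k))"
    by (rule sum.reindex_bij_witness[of _ "\<lambda>i. n - i" "\<lambda>i. n - i"]) auto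
  finally show "diag (fps_const g * up f) $ n = (g * f) $ n"
    by (simp add: fps_mult_nth atLeast0AtMost)
qed

lemma fps_X_cancel: "fps_X * f = fps_X * g \<Longrightarrow> f = g" for f g :: "'a::ring_1 fps"
proof (rule fps_ext)
  fix n assume "fps_X * f = fps_X * g"
  from arg_cong[OF this, of "\<lambda>h. h $ Suc n"] show "f $ n = g $ n" by simp
qed

lemma shift_X: "shift 1 fps_X * (1 - fps_X) = (fps_X :: 'a::complex_alg fps)"
proof -
  have *: "shift 1 (fps_X :: 'a fps) $ n = (if n = 0 then 0 else 1)" for n
    by (simp add: shift_def if_distrib[of "\<lambda>y. _ * y"] sum.delta cong: if_cong)
  show ?thesis
  proof (rule fps_ext)
    fix n show "(shift 1 fps_X * (1 - fps_X)) $ n = (fps_X :: 'a fps) $ n"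
      by (simp add: right_diff_distrib *)
  qed
qed

text \<open>The relation after v -> v - 1, where u - v + 1 = (V - U + UV) / (UV). It arises by
  shifting the inner series.\<close>

lemma rtt_shift:
  fixes t :: "'i \<Rightarrow> 'i \<Rightarrow> 'a::complex_alg fps"
  assumes "rtt t"
  shows "(VV - UU + UU * VV) * (up (t i j) * fps_const (shift 1 (t k l)) - fps_const (shift 1 (t k l)) * up (t i j)) =
     UU * VV * (up (t k j) * fps_const (shift 1 (t i l)) - fps_const (shift 1 (t k j)) * up (t i l))"
proof -
  let ?s = "fmap (shift 1) :: 'a fps fps \<Rightarrow> 'a fps fps"
  let ?W = "fps_const (shift 1 fps_X) :: 'a fps fps"
  have m: "?s (F * G) = ?s F * ?s G" for F G
    by (rule fmap_mult) (simp_all add: shift_add shift_mult)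
  have d: "?s (F - G) = ?s F - ?s G" for F G
    by (rule fps_ext) (simp add: shift_diff)
  have c: "?s (fps_const f) = fps_const (shift 1 f)" for f
    by (rule fps_ext) simp
  have u: "?s (up f) = up f" for f
    by (rule fps_ext) simp
  have x: "?s UU = UU"
    by (rule fps_ext) (simp add: fps_X_def)
  let ?F = "up (t i j) * fps_const (shift 1 (t k l)) - fps_const (shift 1 (t k l)) * up (t i j)"
  let ?G = "up (t k j) * fps_const (shift 1 (t i l)) - fps_const (shift 1 (t k j)) * up (t i l)"
  have "?s ((VV - UU) * (up (t i j) * fps_const (t k l) - fps_const (t k l) * up (t i j))) =
     ?s (UU * VV * (up (t k j) * fps_const (t i l) - fps_const (t k j) * up (t i l)))"
    using assms by (simp add: rtt_def)
  hence *: "(?W - UU) * ?F = UU * ?W * ?G"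
    by (simp only: m d c u x)
  have W: "(1 - VV) * ?W = VV"
  proof -
    have "(1 - fps_X) * shift 1 fps_X = (fps_X :: 'a fps)"
      using shift_X[where 'a = 'a] fps_X_commute[of "shift 1 fps_X :: 'a fps"]
      by (simp add: left_diff_distrib right_diff_distrib)
    hence "fps_const ((1 - fps_X) * shift 1 fps_X) = (VV :: 'a fps fps)" by simp
    thus ?thesis by (simp add: left_diff_distrib)
  qed
  \<comment> \<open>\<open>?W\<close> is 1/(v - 1) = V / (1 - V); multiplication by 1 - V removes
    this denominator.\<close>
  have "(1 - VV) * ((?W - UU) * ?F) = (1 - VV) * (UU * ?W * ?G)"
    unfolding * ..
  also have "(1 - VV) * ((?W - UU) * ?F) = ((1 - VV) * ?W - (UU - VV * UU)) * ?F"
    by (simp only: left_diff_distrib right_diff_distrib mult_1_left mult.assoc)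
  also have "(1 - VV) * ?W - (UU - VV * UU) = VV - UU + UU * VV"
    unfolding W VV_commute by (simp only: diff_diff_eq2 add_diff_eq diff_add_eq)
  also have "(1 - VV) * (UU * ?W * ?G) = UU * ((1 - VV) * ?W) * ?G"
    by (simp only: mult.assoc[symmetric] UU_commute[symmetric, of "1 - VV"])
  finally show ?thesis unfolding W .
qed

text \<open>At v = u the factor V - U disappears, and the square of 1/u left on both sides can be
  cancelled. All identities for the quantum determinant at equal arguments are instances.\<close>

lemma rtt_shift_diag:
  assumes "rtt t"
  shows "t i j * shift 1 (t k l) - shift 1 (t k l) * t i j = t k j * shift 1 (t i l) - shift 1 (t k j) * t i l"
proof -
  have "diag ((VV - UU + UU * VV) * (up (t i j) * fps_const (shift 1 (t k l)) - fps_const (shift 1 (t k l)) * up (t i j))) =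
     diag (UU * VV * (up (t k j) * fps_const (shift 1 (t i l)) - fps_const (shift 1 (t k j)) * up (t i l)))"
    by (simp only: rtt_shift[OF assms])
  hence "fps_X * (fps_X * (t i j * shift 1 (t k l) - shift 1 (t k l) * t i j)) =
     fps_X * (fps_X * (t k j * shift 1 (t i l) - shift 1 (t k j) * t i l))"
    unfolding distrib_right left_diff_distrib
    by (simp only: diag_add diag_diff diag_UU diag_VV diag_up_const diag_const_up mult.assoc diff_self add_0)
  thus ?thesis by (metis fps_X_cancel)
qed

text \<open>\<open>V - U + x U V\<close> is not a zero divisor because its term free of \<open>U\<close> is \<open>V\<close>.\<close>

lemma VU_cancel:
  fixes F :: "'a::ring_1 fps fps"
  assumes "(VV - UU * (1 + fps_const x)) * F = 0"
  shows "F = 0"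
proof (rule fps_ext)
  fix n
  have *: "VV * F = UU * ((1 + fps_const x) * F)"
    using assms by (simp add: left_diff_distrib mult.assoc)
  have nth: "((1 + fps_const x) * F) $ n = (1 + x) * F $ n" for n
    by (simp add: distrib_right)
  show "F $ n = 0 $ n"
  proof (induction n)
    case 0
    from arg_cong[OF *, of "\<lambda>G. G $ 0"] have "fps_X * F $ 0 = fps_X * 0" by simp
    thus ?case by (metis fps_X_cancel fps_zero_nth)
  next
    case (Suc n)
    from arg_cong[OF *, of "\<lambda>G. G $ Suc n"] Suc nth[of n] have "fps_X * F $ Suc n = fps_X * 0"
      by simp
    thus ?case by (metis fps_X_cancel fps_zero_nth)
  qed
qed

text \<open>
  The quantum determinant commutes with the generators: here \<open>s\<close> and \<open>w\<close> stand for \<open>t(v - 1)\<close>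
  and \<open>t(v)\<close>, and \<open>N/D\<close> for \<open>u - v\<close>. Expanding the commutator twice gives
  \<open>(u - v)\<^sup>2 [t(u), q(v)] = [t(u), q(v)]\<close>.
\<close>

lemma qdet_commutator:
  fixes N D :: "'r::ring_1" and u s w :: "'i \<Rightarrow> 'i \<Rightarrow> 'r"
  assumes N: "\<And>x. x * N = N * x" and D: "\<And>x. x * D = D * x"
    and R1: "\<And>i j k l. N * (u i j * w k l - w k l * u i j) = D * (u k j * w i l - w k j * u i l)"
    and R2: "\<And>i j k l. (N + D) * (u i j * s k l - s k l * u i j) = D * (u k j * s i l - s k j * u i l)"
    and R3: "s i j * w i l = s i l * w i j"
    and q: "q = s i j * w k l - s i l * w k j" "q = s k l * w i j - s k j * w i l"
  shows "N * (N * (u i j * q - q * u i j)) = D * (D * (u i j * q - q * u i j))"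
proof -
  define a b c d where "a = u i j" and "b = u i l" and "c = u k j" and "d = u k l"
  define a1 b1 c1 d1 where "a1 = s i j" and "b1 = s i l" and "c1 = s k j" and "d1 = s k l"
  define a2 b2 c2 d2 where "a2 = w i j" and "b2 = w i l" and "c2 = w k j" and "d2 = w k l"
  note defs = a_def b_def c_def d_def a1_def b1_def c1_def d1_def a2_def b2_def c2_def d2_def
  have NL: "x * (N * y) = N * (x * y)" for x y by (metis N mult.assoc)
  have DL: "x * (D * y) = D * (x * y)" for x y by (metis D mult.assoc)
  have ND: "N * (D * y) = D * (N * y)" for y by (metis N mult.assoc)
  have e1: "N * (a * a1 - a1 * a) = 0"
    using R2[of i j i j] by (simp add: defs distrib_right)
  have e2: "N * (a * d2 - d2 * a) = D * (c * b2 - c2 * b)"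
    using R1[of i j k l] by (simp add: defs)
  have e3: "N * (a * b1 - b1 * a) = D * (b1 * a - a1 * b)"
    using R2[of i j i l] by (simp add: defs distrib_right algebra_simps)
  have e4: "N * (a * c2 - c2 * a) = D * (c * a2 - c2 * a)"
    using R1[of i j k j] by (simp add: defs)
  have e5: "N * (b * c2 - c2 * b) = D * (d * a2 - d2 * a)"
    using R1[of i l k j] by (simp add: defs)
  have e6: "N * (a1 * c) = (N + D) * (c * a1) - D * (a * c1)"
    using R2[of k j i j] by (simp add: defs algebra_simps)
  have e7: "N * (b1 * c) = (N + D) * (c * b1) - D * (a * d1) + D * (a1 * d) - D * (b1 * c)"
    using R2[of k j i l] by (simp add: defs algebra_simps)
  have q1: "q = a1 * d2 - b1 * c2" and q2: "q = d1 * a2 - c1 * b2" and r: "a1 * b2 = b1 * a2"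
    using q R3 by (simp_all add: defs)
  \<comment> \<open>The result of the first expansion. Its terms still have \<open>a1\<close> or
    \<open>b1\<close> to the left of \<open>c\<close>, and the second expansion moves them past
    it.\<close>
  define E where "E = a1 * (c * b2 - c2 * b) - (b1 * a - a1 * b) * c2 - b1 * (c * a2 - c2 * a)"
  have "N * (a * q - q * a) = N * (a * a1 - a1 * a) * d2 + a1 * (N * (a * d2 - d2 * a))
      - N * (a * b1 - b1 * a) * c2 - b1 * (N * (a * c2 - c2 * a))"
    unfolding q1 NL by (simp add: algebra_simps)
  also have "\<dots> = D * E"
    unfolding e1 e2 e3 e4 E_def DL by (simp add: algebra_simps)
  finally have 1: "N * (a * q - q * a) = D * E" .
  have "N * E = N * (a1 * c) * b2 - N * (b1 * c) * a2 + a1 * (N * (b * c2 - c2 * b)) - b1 * (N * (a * c2 - c2 * a))"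
    unfolding E_def NL by (simp add: algebra_simps)
  \<comment> \<open>The two terms beginning with \<open>c\<close> vanish by \<open>r\<close>. The
    other two are \<open>a * q\<close> and \<open>q * a\<close>, through the two different
    expansions \<open>q2\<close> and \<open>q1\<close>.\<close>
  also have "\<dots> = N * (c * (a1 * b2 - b1 * a2)) + D * (c * (a1 * b2 - b1 * a2)) + D * (a * (d1 * a2 - c1 * b2)) - D * ((a1 * d2 - b1 * c2) * a)"
    unfolding e4 e5 e6 e7 DL by (simp add: algebra_simps)
  also have "\<dots> = D * (a * q - q * a)"
    unfolding r q1[symmetric] q2[symmetric] by (simp add: right_diff_distrib)
  finally have 2: "N * E = D * (a * q - q * a)" .
  have "N * (N * (a * q - q * a)) = D * (N * E)" unfolding 1 ND ..
  thus ?thesis unfolding 2 a_def .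
qed

lemma comm_square_diff: "x * y = y * x \<Longrightarrow> x * x - y * y = (x - y) * (x + y)" for x y :: "'a::ring"
  by (simp add: algebra_simps)

section \<open>The quantum determinant of a matrix satisfying the RTT relation\<close>

definition qd :: "(ix2 \<Rightarrow> ix2 \<Rightarrow> 'a::complex_alg fps) \<Rightarrow> 'a fps" where
  "qd t = shift 1 (t Neg Neg) * t Pos Pos - shift 1 (t Neg Pos) * t Pos Neg"

text \<open>The transposition \<open>E\<^sub>i\<^sub>j \<mapsto> sign(i) sign(j) E\<^sub>-\<^sub>j\<^sub>,\<^sub>-\<^sub>i\<close>.\<close>

definition tr :: "(ix2 \<Rightarrow> ix2 \<Rightarrow> 'a::complex_alg fps) \<Rightarrow> ix2 \<Rightarrow> ix2 \<Rightarrow> 'a fps" where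
  "tr t i j = sgn2 i * sgn2 j * t (- j) (- i)"

lemma UNIV_ix2: "UNIV = {Neg, Pos}"
  using ix2.exhaust by auto

lemma sum_ix2: "(\<Sum>k\<in>UNIV. f k) = f Neg + f Pos"
  unfolding UNIV_ix2 by simp

context
  fixes t :: "ix2 \<Rightarrow> ix2 \<Rightarrow> 'a::complex_alg fps"
  assumes t: "rtt t"
begin

text \<open>The diagonal relation with both entries in one row: a quantum minor with a repeated row
  vanishes. \<open>qd_col\<close> is the analogue for columns.\<close>

lemma qd_row: "shift 1 (t i j) * t i l = shift 1 (t i l) * t i j"
  using rtt_shift_diag[OF t, of i l i j] by simp

lemma qd_col: "t i j * shift 1 (t k j) = t k j * shift 1 (t i j)"
  using rtt_shift_diag[OF t, of i j k j] by simp

text \<open>The other row and column expansions. They differ from the definition by commutators that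
  \<open>rtt_shift_diag\<close> evaluates.\<close>

lemma qd_alt:
  "shift 1 (t Pos Pos) * t Neg Neg - shift 1 (t Pos Neg) * t Neg Pos = qd t"
  "t Pos Pos * shift 1 (t Neg Neg) - t Neg Pos * shift 1 (t Pos Neg) = qd t"
  "t Neg Neg * shift 1 (t Pos Pos) - t Pos Neg * shift 1 (t Neg Pos) = qd t"
proof -
  note r = rtt_shift_diag[OF t]
  have 1: "t Pos Pos * shift 1 (t Neg Neg) - t Neg Pos * shift 1 (t Pos Neg) = qd t"
    using r[of Pos Pos Neg Neg] by (simp add: qd_def algebra_simps)
  have 2: "t Neg Neg * shift 1 (t Pos Pos) - t Pos Neg * shift 1 (t Neg Pos) =
      shift 1 (t Pos Pos) * t Neg Neg - shift 1 (t Pos Neg) * t Neg Pos"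
    using r[of Neg Neg Pos Pos] by (simp add: algebra_simps)
  have 3: "t Pos Neg * shift 1 (t Neg Pos) - t Neg Neg * shift 1 (t Pos Pos) = - qd t"
    using r[of Pos Neg Neg Pos] by (simp add: qd_def algebra_simps)
  show "t Pos Pos * shift 1 (t Neg Neg) - t Neg Pos * shift 1 (t Pos Neg) = qd t" by (rule 1)
  show 4: "t Neg Neg * shift 1 (t Pos Pos) - t Pos Neg * shift 1 (t Neg Pos) = qd t"
    using arg_cong[OF 3, of uminus] by simp
  show "shift 1 (t Pos Pos) * t Neg Neg - shift 1 (t Pos Neg) * t Neg Pos = qd t"
    using 2 4 by simp
qed

text \<open>Diagonal entries are expansions of the quantum determinant, off-diagonal ones are minors
  with a repeated row. The opposite order in \<open>tr_shift_t\<close> uses columns;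
  \<open>S_symmetry\<close> applies one order to the inner and the other to the outer
  factors.\<close>

lemma shift_t_tr: "(\<Sum>k\<in>UNIV. shift 1 (t i k) * tr t k j) = (if i = j then qd t else 0)"
  using qd_row[of i Neg Pos] qd_alt(1)
  by (cases i; cases j) (simp_all add: sum_ix2 tr_def qd_def algebra_simps)

lemma tr_shift_t: "(\<Sum>k\<in>UNIV. tr t i k * shift 1 (t k j)) = (if i = j then qd t else 0)"
  using qd_col[of Neg j Pos] qd_alt(2,3)
  by (cases i; cases j) (simp_all add: sum_ix2 tr_def algebra_simps)

lemma qd_commutes_up: "up (t i j) * fps_const (qd t) = fps_const (qd t) * up (t i j)"
proof -
  \<comment> \<open>The complementary row and column: the determinant has to be expanded so that the
    entry with indices i, j appears in it. \<open>e\<close> is the sign of this expansion.\<close>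
  define k l where "k = - i" and "l = - j"
  define e :: "'a fps" where "e = sgn2 i * sgn2 j"
  let ?q = "shift 1 (t i j) * t k l - shift 1 (t i l) * t k j"
  have q: "?q = e * qd t"
    using qd_row[of Neg] qd_row[of Pos] qd_alt(1)
    by (cases i; cases j) (simp_all add: k_def l_def e_def qd_def algebra_simps)
  have q': "shift 1 (t k l) * t i j - shift 1 (t k j) * t i l = ?q"
    using qd_alt(1) by (cases i; cases j) (simp_all add: k_def l_def qd_def algebra_simps)
  let ?N = "VV - UU :: 'a fps fps" and ?D = "UU * VV :: 'a fps fps"
  let ?F = "up (t i j) * fps_const ?q - fps_const ?q * up (t i j)"
  have "?N * (?N * ?F) = ?D * (?D * ?F)"
  proof (rule qdet_commutator[where s = "\<lambda>i j. fps_const (shift 1 (t i j))" and w = "\<lambda>i j. fps_const (t i j)"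
        and u = "\<lambda>i j. up (t i j)" and k = k and l = l])
    show "x * ?N = ?N * x" for x
      by (simp only: right_diff_distrib left_diff_distrib UU_commute[of x] VV_commute[of x])
    show "x * ?D = ?D * x" for x by (rule UV_commute)
    show "?N * (up (t i j) * fps_const (t k l) - fps_const (t k l) * up (t i j)) =
        ?D * (up (t k j) * fps_const (t i l) - fps_const (t k j) * up (t i l))" for i j k l
      using t by (simp add: rtt_def)
    show "(?N + ?D) * (up (t i j) * fps_const (shift 1 (t k l)) - fps_const (shift 1 (t k l)) * up (t i j)) =
        ?D * (up (t k j) * fps_const (shift 1 (t i l)) - fps_const (shift 1 (t k j)) * up (t i l))" for i j k l
      by (rule rtt_shift[OF t])
  qed (use qd_row q' in \<open>simp_all\<close>)
  \<comment> \<open>This is ((u - v)^2 - 1) F = 0 without denominators. It factors into u - v - 1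
    and u - v + 1, neither of which is a zero divisor.\<close>
  hence "(?N * ?N - ?D * ?D) * ?F = 0"
    by (simp add: left_diff_distrib mult.assoc)
  also have "?N * ?N - ?D * ?D = (?N - ?D) * (?N + ?D)"
    by (rule comm_square_diff) (rule UV_commute)
  also have "?N - ?D = VV - UU * (1 + fps_const fps_X)"
    by (simp only: distrib_left mult_1_right diff_diff_eq)
  also have "?N + ?D = VV - UU * (1 + fps_const (- fps_X))"
    by (simp only: distrib_left mult_1_right fps_const_neg[symmetric] mult_minus_right diff_add_eq_diff_diff_swap
        minus_minus) (simp only: diff_diff_eq diff_minus_eq_add add.commute diff_add_eq)
  finally have "(VV - UU * (1 + fps_const fps_X)) * ((VV - UU * (1 + fps_const (- fps_X))) * ?F) = 0"
    by (simp only: mult.assoc)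
  hence "?F = 0" by (metis VU_cancel)
  hence "up (t i j) * fps_const (e * qd t) = fps_const (e * qd t) * up (t i j)"
    unfolding q by simp
  moreover have "e = 1 \<or> e = - 1" by (cases i; cases j) (simp_all add: e_def)
  ultimately show ?thesis by (auto simp flip: fps_const_neg)
qed

lemma qd_commutes_coeff: "t i j $ r * qd t $ n = qd t $ n * t i j $ r"
  using arg_cong[OF qd_commutes_up[of i j], of "\<lambda>F. F $ r $ n"] by simp

end

section \<open>The free algebra\<close>

lemma scal_commute: "scal c * x = x * scal c"
proof -
  have "kys x \<subseteq> UNIV" by simp
  thus ?thesis
  proof (induction x rule: poly_mapping_induct)
    case (single w d) show ?case by (simp add: scal_def mult_single mult.commute)
  qed (simp_all add: distrib_left distrib_right)
qed

lemma scal_add: "scal (a + b) = scal a + scal b"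
  by (simp add: scal_def single_add)

lemma scal_mult: "scal (a * b) = scal a * scal b"
  by (simp add: scal_def mult_single)

lemma scal_one: "scal 1 = 1"
  by (simp add: scal_def)

lemma free_alg_simps [simp]:
  "carrier free_alg = UNIV" "zero free_alg = 0" "one free_alg = 1" "add free_alg = (+)"
  "monoid.mult free_alg = (*)" "smult free_alg = (\<lambda>c x. scal c * x)"
  by (simp_all add: free_alg_def)

lemma calgebra_free_alg: "calgebra (free_alg :: 'g free calg)"
proof (rule calgebraI)
  show "ring (free_alg :: 'g free calg)"
  proof (rule ringI)
    show "abelian_group (free_alg :: 'g free calg)"
      by (rule abelian_groupI) (auto simp: algebra_simps intro: exI[of _ "- _"])
    show "Group.monoid (free_alg :: 'g free calg)"
      by (rule monoidI) (auto simp: algebra_simps)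
  qed (auto simp: algebra_simps)
qed (auto simp: scal_add scal_mult scal_one distrib_left distrib_right mult.assoc, metis mult.assoc scal_commute)

text \<open>The homomorphism given by the universal property of the free algebra.\<close>

definition ev :: "('g \<Rightarrow> 'b::complex_alg) \<Rightarrow> 'g free \<Rightarrow> 'b" where
  "ev g = psum (\<lambda>w c. sc c * prod_list (map g (letters w)))"

lemma ev_add: "ev g (x + y) = ev g x + ev g y"
  unfolding ev_def by (rule psum_add) (simp_all add: sc_add distrib_right)

lemma ev_single: "ev g (sgl w c) = sc c * prod_list (map g (letters w))"
  unfolding ev_def by simp

lemma ev_scal: "ev g (scal c) = sc c"
  by (simp add: scal_def ev_single zero_word_def)

lemma ev_one: "ev g 1 = 1"
  using ev_scal[of g 1] by (simp add: scal_one)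

lemma ev_zero: "ev g 0 = 0"
  by (simp add: ev_def)

lemma ev_gen: "ev g (gen a) = g a"
  by (simp add: gen_def ev_single)

lemma ev_mult: "ev g (x * y) = ev g x * ev g y"
proof -
  have "kys x \<subseteq> UNIV" by simp
  thus ?thesis
  proof (induction x rule: poly_mapping_induct)
    case (single v c)
    have "kys y \<subseteq> UNIV" by simp
    thus ?case
    proof (induction y rule: poly_mapping_induct)
      case (single w d)
      show ?case
        by (simp add: mult_single ev_single plus_word_def sc_mult mult.assoc)
           (metis mult.assoc sc_central)
    qed (simp_all add: distrib_left ev_add ev_zero)
  qed (simp_all add: distrib_right ev_add ev_zero)
qed

subsection \<open>The defining relations as an identity of series in two variables\<close>

definition bis :: "'a::ring_1 fps fps \<Rightarrow> 'a biser" where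
  "bis F r s = (if 0 \<le> r \<and> 0 \<le> s then F $ nat r $ nat s else 0)"

lemma bis_diff: "bis (F - G) r s = bis F r s - bis G r s"
  by (simp add: bis_def)

text \<open>Multiplication by u - v lowers the indices by one, multiplication by V - U raises them,
  so the index (r, s) on the right belongs to (r + 1, s + 1) on the left. The boundary rows r = -1
  and s = -1 are therefore genuine conditions.\<close>

lemma bis_rel_iff:
  "(VV - UU) * F = UU * VV * H \<longleftrightarrow> (\<forall>r s. bis F (r + 1) s - bis F r (s + 1) = bis H r s)"
proof -
  have "(VV - UU) * F = UU * VV * H \<longleftrightarrow> (\<forall>p q. ((VV - UU) * F) $ p $ q = (UU * VV * H) $ p $ q)"
    by (simp add: fps_eq_iff)
  also have "\<dots> \<longleftrightarrow> (\<forall>p q. (if q = 0 then 0 else F $ p $ (q - 1)) - (if p = 0 then 0 else F $ (p - 1) $ q) =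
      (if p = 0 \<or> q = 0 then 0 else H $ (p - 1) $ (q - 1)))"
  proof -
    have "((VV - UU) * F) $ p $ q = (if q = 0 then 0 else F $ p $ (q - 1)) - (if p = 0 then 0 else F $ (p - 1) $ q)"
      "(UU * VV * H) $ p $ q = (if p = 0 \<or> q = 0 then 0 else H $ (p - 1) $ (q - 1))" for p q
      by (simp_all add: left_diff_distrib mult.assoc)
    thus ?thesis by simp
  qed
  also have "\<dots> \<longleftrightarrow> (\<forall>r s. bis F (r + 1) s - bis F r (s + 1) = bis H r s)"
  proof (intro iffI allI)
    fix r s :: int
    assume *: "\<forall>p q. (if q = 0 then 0 else F $ p $ (q - 1)) - (if p = 0 then 0 else F $ (p - 1) $ q) =
      (if p = 0 \<or> q = 0 then 0 else H $ (p - 1) $ (q - 1))"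
    \<comment> \<open>If r or s is below -1, all three terms are zero by the convention for negative
      indices.\<close>
    show "bis F (r + 1) s - bis F r (s + 1) = bis H r s"
    proof (cases "r < - 1 \<or> s < - 1")
      case False
      define p q where "p = nat (r + 1)" and "q = nat (s + 1)"
      have "r = int p - 1" "s = int q - 1" using False by (simp_all add: p_def q_def)
      thus ?thesis using *[rule_format, where p = p and q = q]
        by (cases p; cases q) (simp_all add: bis_def nat_add_distrib)
    qed (auto simp: bis_def)
  next
    fix p q :: nat
    assume "\<forall>r s. bis F (r + 1) s - bis F r (s + 1) = bis H r s"
    hence "bis F (int p) (int q - 1) - bis F (int p - 1) (int q) = bis H (int p - 1) (int q - 1)"
      by (metis diff_add_cancel)
    thus "(if q = 0 then 0 else F $ p $ (q - 1)) - (if p = 0 then 0 else F $ (p - 1) $ q) =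
      (if p = 0 \<or> q = 0 then 0 else H $ (p - 1) $ (q - 1))"
      by (cases p; cases q) (simp_all add: bis_def nat_add_distrib)
  qed
  finally show ?thesis .
qed

text \<open>Each row and column of P has a single nonzero entry: on the left it exchanges the two
  row indices, on the right the two column indices.\<close>

lemma R2_sums:
  fixes x y :: "'i::finite \<times> 'i"
  shows "(\<Sum>z\<in>UNIV. R2 x z (TT12 z y) r s) = mult_uv 0 (TT12 x y) r s - TT12 (snd x, fst x) y r s"
    and "(\<Sum>z\<in>UNIV. R2 z y (TT21 x z) r s) = mult_uv 0 (TT21 x y) r s - TT21 x (snd y, fst y) r s"
proof -
  have P: "Pmat x z = of_bool (z = (snd x, fst x))" "Pmat z y = of_bool (z = (snd y, fst y))" for z :: "'i \<times> 'i"
    unfolding Pmat_def by (cases z; auto)+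
  have d: "(\<Sum>z\<in>UNIV. of_bool (z = a) * f z) = f a" "(\<Sum>z\<in>UNIV. of_bool (a = z) * f z) = f a"
    for a and f :: "'i \<times> 'i \<Rightarrow> ('i \<times> 'i \<times> nat) free"
    by (simp_all add: of_bool_def if_distrib[of "\<lambda>y. y * _"] cong: if_cong)
  show "(\<Sum>z\<in>UNIV. R2 x z (TT12 z y) r s) = mult_uv 0 (TT12 x y) r s - TT12 (snd x, fst x) y r s"
    unfolding R2_def P sum_subtractf d ..
  show "(\<Sum>z\<in>UNIV. R2 z y (TT21 x z) r s) = mult_uv 0 (TT21 x y) r s - TT21 x (snd y, fst y) r s"
    unfolding R2_def P sum_subtractf d ..
qed

text \<open>Read from left to right it gives the relation for the generators of Y(2) itself; from
  right to left it yields homomorphisms out of Y(2).\<close>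

lemma RTT_rels_vanish_iff:
  fixes h :: "('i::finite \<times> 'i \<times> nat) free \<Rightarrow> 'b::ring_1"
  assumes add: "\<And>x y. h (x + y) = h x + h y" and mult: "\<And>x y. h (x * y) = h x * h y"
  shows "(\<forall>x\<in>RTT_rels R2. h x = 0) \<longleftrightarrow> rtt (\<lambda>i j. fmap h (Tmat i j))"
proof -
  let ?t = "\<lambda>i j. fmap h (Tmat i j)"
  have h0: "h 0 = 0" and hd: "h (x - y) = h x - h y" for x y
    using additive_zero[of h] additive_diff[of h] add by auto
  have h12: "h (TT12 (i, k) (j, l) r s) = bis (up (?t i j) * fps_const (?t k l)) r s" for i j k l r s
    by (simp add: TT12_def bis_def mult h0)
  have h21: "h (TT21 (i, k) (j, l) r s) = bis (fps_const (?t k l) * up (?t i j)) r s" for i j k l r s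
    by (simp add: TT21_def bis_def mult h0)
  let ?F = "\<lambda>i j k l. up (?t i j) * fps_const (?t k l) - fps_const (?t k l) * up (?t i j)"
  let ?H = "\<lambda>i j k l. up (?t k j) * fps_const (?t i l) - fps_const (?t k j) * up (?t i l)"
  have rel: "h ((\<Sum>z\<in>UNIV. R2 (i, k) z (TT12 z (j, l)) r s) - (\<Sum>z\<in>UNIV. R2 z (j, l) (TT21 (i, k) z) r s)) =
      (bis (?F i j k l) (r + 1) s - bis (?F i j k l) r (s + 1)) - bis (?H i j k l) r s" for i j k l r s
    unfolding R2_sums mult_uv_def hd fst_conv snd_conv h12 h21 bis_diff by (simp add: hd h12 h21 h0)
  have "(\<forall>x\<in>RTT_rels R2. h x = 0) \<longleftrightarrow> (\<forall>i k j l r s.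
      h ((\<Sum>z\<in>UNIV. R2 (i, k) z (TT12 z (j, l)) r s) - (\<Sum>z\<in>UNIV. R2 z (j, l) (TT21 (i, k) z) r s)) = 0)"
    unfolding RTT_rels_def by (auto simp: split_paired_all) blast
  also have "\<dots> \<longleftrightarrow> rtt ?t"
    unfolding rel rtt_def bis_rel_iff right_minus_eq by blast
  finally show ?thesis .
qed

section \<open>\<open>Y(2)\<close> as a type\<close>

lemma Y2_ideal_ideal: "ideal Y2_ideal free_alg"
proof -
  interpret calgebra "free_alg :: gen2 free calg" by (rule calgebra_free_alg)
  show ?thesis unfolding Y2_ideal_def by (rule genideal_ideal) simp
qed

lemma calgebra_Y2: "calgebra Y2"
  unfolding Y2_def by (rule calgebra_alg_quot[OF calgebra_free_alg Y2_ideal_ideal])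

interpretation Y2: calgebra Y2 by (rule calgebra_Y2)

lemma Y2_class_hom: "Y2_class \<in> alg_hom free_alg Y2"
  using proj_alg_hom[OF calgebra_free_alg Y2_ideal_ideal] unfolding Y2_def Y2_class_def[abs_def] .

lemma Y2_carrier: "carrier Y2 = range Y2_class"
  unfolding Y2_def alg_quot_carrier[OF calgebra_free_alg Y2_ideal_ideal] by (simp add: Y2_class_def)

lemma Y2_class_zero_iff: "Y2_class x = \<zero>\<^bsub>Y2\<^esub> \<longleftrightarrow> x \<in> Y2_ideal"
  using coset_zero_iff[OF calgebra_free_alg Y2_ideal_ideal, of x] by (simp add: Y2_class_def Y2_def)

text \<open>The universal property of Y(2): the kernel of \<open>h\<close> is a two-sided ideal
  containing the defining relations.\<close>

lemma Y2_ideal_vanish: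
  fixes h :: "gen2 free \<Rightarrow> 'b::ring_1"
  assumes add: "\<And>x y. h (x + y) = h x + h y" and mult: "\<And>x y. h (x * y) = h x * h y"
    and t: "rtt (\<lambda>i j. fmap h (Tmat i j))" and x: "x \<in> Y2_ideal"
  shows "h x = 0"
proof -
  interpret F: calgebra "free_alg :: gen2 free calg" by (rule calgebra_free_alg)
  have h0: "h 0 = 0" using additive_zero[of h] add by auto
  have "ideal {x. h x = 0} (free_alg :: gen2 free calg)"
  proof (rule idealI)
    show "ring (free_alg :: gen2 free calg)" ..
    have inv: "\<ominus>\<^bsub>free_alg\<^esub> y = - y" for y :: "gen2 free" by (rule F.minus_equality) auto
    show "subgroup {x. h x = 0} (add_monoid (free_alg :: gen2 free calg))"
      by (rule F.add.subgroupI) (auto simp: inv inv[unfolded a_inv_def] add additive_minus[of h, OF add] intro: exI[of _ 0] h0)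
  qed (auto simp: mult)
  moreover have "RTT_rels R2 \<subseteq> {x. h x = 0}"
    using RTT_rels_vanish_iff[of h] add mult t by auto
  ultimately have "Y2_ideal \<subseteq> {x. h x = 0}"
    unfolding Y2_ideal_def by (rule F.genideal_minimal)
  thus ?thesis using x by auto
qed

text \<open>Letters carry the superscript minus one, hence \<open>Suc r\<close>; the constant term
  is not a letter and must be prescribed.\<close>

lemma fmap_ev_Tmat:
  assumes "\<And>i j. F i j $ 0 = of_bool (i = j)"
  shows "fmap (ev (\<lambda>(i, j, r). F i j $ Suc r)) (Tmat i j) = F i j"
  by (rule fps_ext) (auto simp: Tmat_def ev_gen ev_zero ev_one assms split: nat.splits)

text \<open>T(u) -> I is a one-dimensional representation, and it sends 1 to 1. This provides the
  axiom 0 \<noteq> 1 of \<open>ring_1\<close> for the type \<open>y2\<close>.\<close>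

lemma Y2_nontrivial: "\<one>\<^bsub>Y2\<^esub> \<noteq> \<zero>\<^bsub>Y2\<^esub>"
proof
  assume "\<one>\<^bsub>Y2\<^esub> = \<zero>\<^bsub>Y2\<^esub>"
  hence *: "1 \<in> Y2_ideal"
    using alg_homD(4)[OF Y2_class_hom] by (simp flip: Y2_class_zero_iff)
  let ?F = "\<lambda>i j. fps_const (of_bool (i = j)) :: complex fps"
  let ?h = "ev (\<lambda>(i, j, r). ?F i j $ Suc r) :: gen2 free \<Rightarrow> complex"
  have "up (fps_const c) = fps_const (fps_const c)" for c :: complex
    by (rule fps_ext) simp
  hence "rtt ?F" unfolding rtt_def by (auto simp: mult.commute)
  moreover have "(\<lambda>i j. fmap ?h (Tmat i j)) = ?F" by (intro ext fmap_ev_Tmat) simp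
  ultimately have "rtt (\<lambda>i j. fmap ?h (Tmat i j))" by (simp only:)
  hence "?h 1 = 0"
    by (intro Y2_ideal_vanish[of ?h, OF ev_add ev_mult _ *])
  thus False by (simp add: ev_one)
qed

typedef y2 = "carrier Y2"
  using Y2.one_closed by blast

instantiation y2 :: complex_alg
begin

definition "0 = Abs_y2 \<zero>\<^bsub>Y2\<^esub>"
definition "1 = Abs_y2 \<one>\<^bsub>Y2\<^esub>"
definition "x + y = Abs_y2 (Rep_y2 x \<oplus>\<^bsub>Y2\<^esub> Rep_y2 y)"
definition "x - y = Abs_y2 (Rep_y2 x \<ominus>\<^bsub>Y2\<^esub> Rep_y2 y)"
definition "- x = Abs_y2 (\<ominus>\<^bsub>Y2\<^esub> Rep_y2 x)"
definition "x * y = Abs_y2 (Rep_y2 x \<otimes>\<^bsub>Y2\<^esub> Rep_y2 y)"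
definition "sc c = Abs_y2 (c \<odot>\<^bsub>Y2\<^esub> \<one>\<^bsub>Y2\<^esub>)"

lemma Rep_y2_closed [simp]: "Rep_y2 x \<in> carrier Y2"
  by (rule Rep_y2)

lemmas y2_defs = zero_y2_def one_y2_def plus_y2_def minus_y2_def uminus_y2_def times_y2_def sc_y2_def

lemma Rep_y2_simps:
  "Rep_y2 0 = \<zero>\<^bsub>Y2\<^esub>" "Rep_y2 1 = \<one>\<^bsub>Y2\<^esub>" "Rep_y2 (x + y) = Rep_y2 x \<oplus>\<^bsub>Y2\<^esub> Rep_y2 y"
  "Rep_y2 (x - y) = Rep_y2 x \<ominus>\<^bsub>Y2\<^esub> Rep_y2 y" "Rep_y2 (- x) = \<ominus>\<^bsub>Y2\<^esub> Rep_y2 x"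
  "Rep_y2 (x * y) = Rep_y2 x \<otimes>\<^bsub>Y2\<^esub> Rep_y2 y" "Rep_y2 (sc c) = c \<odot>\<^bsub>Y2\<^esub> \<one>\<^bsub>Y2\<^esub>"
  by (simp_all add: y2_defs Abs_y2_inverse)

instance
  by standard
    (simp_all add: Rep_y2_inject[symmetric] Rep_y2_simps Y2.a_ac Y2.m_assoc Y2.l_distr Y2.r_distr
      Y2.l_neg Y2.r_neg Y2.smult_one Y2.minus_eq Y2_nontrivial[symmetric] Y2.smult_add_left Y2.smult_mult_left Y2.smult_mult_right Y2.smult_smult mult.commute)

end

lemma Rep_y2_sc_mult: "Rep_y2 (sc c * x) = c \<odot>\<^bsub>Y2\<^esub> Rep_y2 x"
  by (simp add: Rep_y2_simps Y2.smult_mult_left)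

definition pr :: "gen2 free \<Rightarrow> y2" where
  "pr x = Abs_y2 (Y2_class x)"

lemma Rep_pr: "Rep_y2 (pr x) = Y2_class x"
  using alg_homD(1)[OF Y2_class_hom] by (simp add: pr_def Abs_y2_inverse)

lemma pr_simps:
  "pr (x + y) = pr x + pr y" "pr (x * y) = pr x * pr y" "pr 1 = 1" "pr (scal c * x) = sc c * pr x"
  using alg_homD[OF Y2_class_hom]
  by (simp_all add: Rep_y2_inject[symmetric] Rep_y2_simps Rep_pr Rep_y2_sc_mult del: Rep_y2_simps(6))
    (simp_all add: Rep_y2_simps Rep_pr)

lemma pr_zero_iff: "pr x = 0 \<longleftrightarrow> x \<in> Y2_ideal"
  by (simp add: Rep_y2_inject[symmetric] Rep_y2_simps Rep_pr Y2_class_zero_iff)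

lemma pr_surj: "\<exists>x. pr x = y"
  using Rep_y2[of y] unfolding Y2_carrier by (auto simp: Rep_y2_inject[symmetric] Rep_pr)

lemma fmap_shift:
  assumes "\<And>x y. h (x + y) = h x + h y" "\<And>c x. h (sc c * x) = sc c * h x"
  shows "fmap h (shift c f) = shift c (fmap h f)"
  by (rule fps_ext) (simp add: shift_def additive_sum[of h] assms)

lemma fmap_neg:
  fixes h :: "'a::ring \<Rightarrow> 'b::ring"
  assumes "\<And>x y. h (x + y) = h x + h y"
  shows "fmap h (neg f) = neg (fmap h f)"
proof (rule fps_ext)
  fix n show "fmap h (neg f) $ n = neg (fmap h f) $ n"
    using additive_minus[of h, OF assms] by (simp add: neg_def)
qed

section \<open>The quantum determinant and the symmetry relation\<close>

definition tY :: "ix2 \<Rightarrow> ix2 \<Rightarrow> y2 fps" where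
  "tY i j = fmap pr (Tmat i j)"

definition qdetY :: "y2 fps" where
  "qdetY = qd tY"

definition Sm :: "ix2 \<Rightarrow> ix2 \<Rightarrow> y2 fps" where
  "Sm i j = (\<Sum>k\<in>UNIV. tY i k * neg (tr tY k j))"

text \<open>The series Z(u): the first factor is the quantum determinant at u + 1/2, the second at
  1/2 - u.\<close>

definition zser :: "y2 fps" where
  "zser = shift (- 1/2) qdetY * neg (shift (- 1/2) qdetY)"

lemma rtt_T: "rtt tY"
proof -
  have "\<forall>x\<in>RTT_rels R2. pr x = 0"
    using calgebra.axioms(1)[OF calgebra_free_alg, THEN ring.genideal_self, of "RTT_rels R2"]
    by (auto simp: pr_zero_iff Y2_ideal_def)
  hence "rtt (\<lambda>i j. fmap pr (Tmat i j))"
    using RTT_rels_vanish_iff[of pr] pr_simps by blast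
  thus ?thesis by (simp add: tY_def[abs_def])
qed

lemma T_nth_0: "tY i j $ 0 = of_bool (i = j)"
  using additive_zero[of pr] by (simp add: tY_def Tmat_def pr_simps)

lemma pr_scal: "pr (scal c) = sc c"
  using pr_simps(4)[of c 1] by (simp add: pr_simps)

lemma pr_zero: "pr 0 = 0"
  using additive_zero[of pr] by (simp add: pr_simps)

lemma fmap_pr_sgn2: "fmap pr (sgn2 i) = sgn2 i"
  by (rule fps_ext, cases i) (simp_all add: additive_minus[of pr] pr_simps pr_zero)

lemma fmap_ser_shift: "fmap pr (ser_shift c f) = shift c (fmap pr f)"
  by (rule fps_ext) (simp add: ser_shift_def shift_def additive_sum[of pr] pr_simps pr_scal)

lemma fmap_ser_neg: "fmap pr (ser_neg f) = neg (fmap pr f)"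
proof (rule fps_ext)
  fix n show "fmap pr (ser_neg f) $ n = neg (fmap pr f) $ n"
    using additive_minus[of pr] pr_simps(1) by (cases "even n") (simp_all add: ser_neg_def)
qed

lemma fmap_pr_mult: "fmap pr (f * g) = fmap pr f * fmap pr g"
  by (rule fmap_mult) (simp_all add: pr_simps)

lemma fmap_pr_qdet: "fmap pr qdet = qdetY"
proof -
  have "fmap pr (f - g) = fmap pr f - fmap pr g" for f g
    by (rule fps_ext) (simp add: additive_diff[of pr] pr_simps)
  thus ?thesis
    by (simp add: qdet_def qdetY_def qd_def fmap_pr_mult fmap_ser_shift tY_def)
qed

lemma fmap_pr_sum: "fmap pr (sum F I) = (\<Sum>i\<in>I. fmap pr (F i))"
  by (rule fps_ext) (simp add: fps_sum_nth additive_sum[of pr] pr_simps)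

lemma sgn2_mult_neg: "neg (sgn2 i * f) = sgn2 i * neg f"
  using neg_diff[of 0 f] by (cases i) simp_all

lemma fmap_pr_S2mat: "fmap pr (S2mat i j) = Sm i j"
  unfolding S2mat_def Sm_def fmap_pr_sum
  by (intro sum.cong refl) (simp add: fmap_pr_mult fmap_pr_sgn2 fmap_ser_neg sgn2_mult_neg tr_def tY_def mult.assoc)

text \<open>Y(2) is generated as an algebra by the coefficients of T(u), so centrality can be tested
  on these generators.\<close>

lemma Tmat_induct:
  assumes "\<And>i j n. P (tY i j $ n)" "\<And>c. P (sc c)" "\<And>x y. P x \<Longrightarrow> P y \<Longrightarrow> P (x + y)" "\<And>x y. P x \<Longrightarrow> P y \<Longrightarrow> P (x * y)"
  shows "P x"
proof -
  obtain a where x: "x = pr a" using pr_surj by metis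
  have c: "pr (scal c) = sc c" for c using pr_simps(4)[of c 1] by (simp add: pr_simps)
  have w: "P (pr (sgl w 1))" for w :: "gen2 word"
  proof (cases w)
    case (Word xs)
    have "P (pr (sgl (Word xs) 1))"
    proof (induction xs)
      case Nil
      have "sgl (Word []) 1 = (scal 1 :: gen2 free)" by (simp add: scal_def zero_word_def)
      thus ?case using assms(2)[of 1] c[of 1] by simp
    next
      case (Cons a xs)
      obtain i j r where a: "a = (i, j, r)" by (cases a)
      have "sgl (Word (a # xs)) 1 = gen a * (sgl (Word xs) 1 :: gen2 free)"
        by (simp add: gen_def mult_single plus_word_def)
      moreover have "pr (gen a) = tY i j $ Suc r" by (simp add: tY_def Tmat_def a)
      ultimately show ?case using assms(1,4) Cons by (simp add: pr_simps)
    qed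
    thus ?thesis using Word by simp
  qed
  have "kys a \<subseteq> UNIV" by simp
  thus ?thesis unfolding x
  proof (induction a rule: poly_mapping_induct)
    case zero
    show ?case using assms(2)[of 0] additive_zero[of pr] by (simp add: pr_simps)
  next
    case (single v d)
    have "sgl v d = scal d * sgl v 1" by (simp add: scal_def mult_single)
    thus ?case using assms(2,4) w by (simp add: pr_simps pr_scal)
  next
    case (add a b)
    thus ?case using assms(3) by (simp add: pr_simps)
  qed
qed

lemma central_q: "central qdetY"
proof -
  have "qdetY $ n * x = x * qdetY $ n" for n x
  proof (induction x rule: Tmat_induct)
    case (1 i j r) thus ?case using qd_commutes_coeff[OF rtt_T, of i j r n] by (simp add: qdetY_def)
  next
    case (2 c) thus ?case by (metis sc_central)
  next
    case (3 x y) thus ?case by (simp add: distrib_left distrib_right)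
  next
    case (4 x y) thus ?case by (metis mult.assoc)
  qed
  thus ?thesis by (simp add: central_def)
qed

lemma q_nth_0: "qdetY $ 0 = 1"
  by (simp add: qdetY_def qd_def T_nth_0)

lemma Z_nth_0: "zser $ 0 = 1"
  by (simp add: zser_def q_nth_0)

text \<open>The product consists of A = T(u - 1/2), B = T^t(1/2 - u), C = T(-u - 1/2) and D = T^t(u
  + 1/2). In BC the arguments differ by one, so BC is the central scalar qdet T(1/2 - u). With it
  taken out, AD is qdet T(u + 1/2) for the same reason.\<close>

lemma S_symmetry:
  "(\<Sum>k\<in>UNIV. shift (1/2) (Sm i k) * neg (shift (1/2) (Sm k j))) = (if i = j then zser else 0)"
proof -
  let ?q1 = "shift (- 1/2) qdetY" and ?q2 = "neg (shift (- 1/2) qdetY)"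
  define A where "A i k = shift (1/2) (tY i k)" for i k
  define B where "B k j = shift (1/2) (neg (tr tY k j))" for k j
  define C where "C i k = neg (shift (1/2) (tY i k))" for i k
  define D where "D k j = shift (- 1/2) (tr tY k j)" for k j
  have sS: "shift (1/2) (Sm i k) = (\<Sum>l\<in>UNIV. A i l * B l k)" for i k
    by (simp add: Sm_def shift_sum shift_mult A_def B_def)
  have nS: "neg (shift (1/2) (Sm k j)) = (\<Sum>m\<in>UNIV. C k m * D m j)" for k j
    by (simp add: Sm_def shift_sum shift_mult neg_sum neg_mult neg_shift C_def D_def)
  have BC: "(\<Sum>k\<in>UNIV. B l k * C k m) = (if l = m then ?q2 else 0)" for l m
  proof -
    have "(\<Sum>k\<in>UNIV. B l k * C k m) = neg (shift (- 1/2) (\<Sum>k\<in>UNIV. tr tY l k * shift 1 (tY k m)))"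
      by (simp add: shift_sum shift_mult neg_sum neg_mult neg_shift B_def C_def shift_shift)
    also have "\<dots> = (if l = m then ?q2 else 0)"
      unfolding tr_shift_t[OF rtt_T] qdetY_def by simp
    finally show ?thesis .
  qed
  have AD: "(\<Sum>l\<in>UNIV. A i l * D l j) = (if i = j then ?q1 else 0)"
  proof -
    have "(\<Sum>l\<in>UNIV. A i l * D l j) = shift (- 1/2) (\<Sum>l\<in>UNIV. shift 1 (tY i l) * tr tY l j)"
      by (simp add: shift_sum shift_mult A_def D_def shift_shift)
    also have "\<dots> = (if i = j then ?q1 else 0)"
      unfolding shift_t_tr[OF rtt_T] qdetY_def by simp
    finally show ?thesis .
  qed
  have c2: "x * ?q2 = ?q2 * x" for x
    using central_commute[of ?q2 x] by (simp add: central_neg central_shift central_q)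
  have "(\<Sum>k\<in>UNIV. shift (1/2) (Sm i k) * neg (shift (1/2) (Sm k j))) =
      (\<Sum>k\<in>UNIV. \<Sum>l\<in>UNIV. \<Sum>m\<in>UNIV. A i l * (B l k * C k m) * D m j)"
    unfolding nS unfolding sS sum_product by (simp add: mult.assoc)
  also have "\<dots> = (\<Sum>l\<in>UNIV. \<Sum>m\<in>UNIV. \<Sum>k\<in>UNIV. A i l * (B l k * C k m) * D m j)"
    by (subst sum.swap) (intro sum.cong refl sum.swap)
  also have "\<dots> = (\<Sum>l\<in>UNIV. \<Sum>m\<in>UNIV. A i l * (if l = m then ?q2 else 0) * D m j)"
    unfolding BC[symmetric] sum_distrib_left sum_distrib_right ..
  also have "\<dots> = (\<Sum>l\<in>UNIV. A i l * ?q2 * D l j)"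
    by (simp add: if_distrib[of "\<lambda>y. _ * y"] if_distrib[of "\<lambda>y. y * _"] cong: if_cong)
  also have "\<dots> = ?q2 * (\<Sum>l\<in>UNIV. A i l * D l j)"
  proof -
    have "A i l * ?q2 * D l j = ?q2 * (A i l * D l j)" for l
      unfolding c2[of "A i l"] mult.assoc ..
    thus ?thesis unfolding sum_distrib_left by simp
  qed
  also have "\<dots> = (if i = j then zser else 0)"
    unfolding AD zser_def c2[of ?q1] by simp
  finally show ?thesis .
qed

section \<open>The kernel of the projection to \<open>SY\<^sup>-(2)\<close>\<close>

text \<open>\<open>I\<close> is a two-sided ideal of the subalgebra \<open>M\<close> only, not of
  the whole algebra. The locale serves for three pairs: Y^-(2) with itself, Y^-(2) with the ideal of
  Z(u) - 1, and Y(2) with the ideal of qdet T(u) - 1.\<close>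

locale subalgebra_ideal =
  fixes M I :: "'a::complex_alg set"
  assumes one_M: "1 \<in> M" and add_M: "x \<in> M \<Longrightarrow> y \<in> M \<Longrightarrow> x + y \<in> M"
    and mult_M: "x \<in> M \<Longrightarrow> y \<in> M \<Longrightarrow> x * y \<in> M" and sc_M: "x \<in> M \<Longrightarrow> sc c * x \<in> M"
    and sub: "I \<subseteq> M" and zero_I: "0 \<in> I" and add_I: "x \<in> I \<Longrightarrow> y \<in> I \<Longrightarrow> x + y \<in> I"
    and left_I: "x \<in> M \<Longrightarrow> y \<in> I \<Longrightarrow> x * y \<in> I" and right_I: "x \<in> I \<Longrightarrow> y \<in> M \<Longrightarrow> x * y \<in> I"
begin

lemma sc_I: "x \<in> I \<Longrightarrow> sc c * x \<in> I"
  using left_I[OF sc_M[OF one_M]] by simp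

lemma sum_I: "(\<And>i. i \<in> A \<Longrightarrow> f i \<in> I) \<Longrightarrow> sum f A \<in> I"
  by (induction A rule: infinite_finite_induct) (auto simp: zero_I add_I)

lemma sum_M: "(\<And>i. i \<in> A \<Longrightarrow> f i \<in> M) \<Longrightarrow> sum f A \<in> M"
  using subsetD[OF sub zero_I] by (induction A rule: infinite_finite_induct) (auto simp: add_M)

definition serM :: "'a fps \<Rightarrow> bool" where
  "serM f \<longleftrightarrow> (\<forall>n. f $ n \<in> M)"

definition serI :: "'a fps \<Rightarrow> bool" where
  "serI f \<longleftrightarrow> (\<forall>n. f $ n \<in> I)"

lemma serI_serM: "serI f \<Longrightarrow> serM f"
  using sub by (auto simp: serI_def serM_def)

lemma serM_one: "serM 1"
  using one_M subsetD[OF sub zero_I] by (simp add: serM_def)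

lemma serM_add: "serM f \<Longrightarrow> serM g \<Longrightarrow> serM (f + g)"
  by (simp add: serM_def add_M)

lemma serI_add: "serI f \<Longrightarrow> serI g \<Longrightarrow> serI (f + g)"
  by (simp add: serI_def add_I)

lemma serM_mult: "serM f \<Longrightarrow> serM g \<Longrightarrow> serM (f * g)"
  by (simp add: serM_def fps_mult_nth sum_M mult_M)

lemma serI_mult_right: "serI f \<Longrightarrow> serM g \<Longrightarrow> serI (f * g)"
  by (simp add: serM_def serI_def fps_mult_nth sum_I right_I)

lemma serM_shift: "serM f \<Longrightarrow> serM (shift c f)"
  by (simp add: serM_def shift_def sum_M sc_M)

lemma serI_shift: "serI f \<Longrightarrow> serI (shift c f)"
  by (simp add: serI_def shift_def sum_I sc_I)

lemma serM_neg: "serM f \<Longrightarrow> serM (neg f)"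
  using sc_M[of _ "(- 1) ^ n" for n] by (simp add: serM_def sc_power_minus_one)

lemma serI_neg: "serI f \<Longrightarrow> serI (neg f)"
  using sc_I[of _ "(- 1) ^ n" for n] by (simp add: serI_def sc_power_minus_one)

lemma serM_sum: "(\<And>i. i \<in> A \<Longrightarrow> serM (F i)) \<Longrightarrow> serM (sum F A)"
  by (simp add: serM_def fps_sum_nth sum_M)

lemma cong1_mult: "serI (f - 1) \<Longrightarrow> serI (g - 1) \<Longrightarrow> serI (f * g - 1)"
proof -
  assume f: "serI (f - 1)" and g: "serI (g - 1)"
  have "serM (g - 1 + 1)" by (intro serM_add serI_serM g serM_one)
  hence "serI ((f - 1) * g + (g - 1))" by (intro serI_add serI_mult_right f g) simp
  thus ?thesis by (simp add: algebra_simps)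
qed

lemma cong1_shift: "serI (f - 1) \<Longrightarrow> serI (shift c f - 1)"
  using serI_shift[of "f - 1" c] by (simp add: shift_diff)

lemma cong1_neg: "serI (f - 1) \<Longrightarrow> serI (neg f - 1)"
  using serI_neg[of "f - 1"] by (simp add: neg_diff)

text \<open>The equation determines h from z degree by degree, and z is congruent to 1, for which
  the solution would be 1.\<close>

lemma cong1_of_shift_product:
  assumes eq: "shift a h * shift b h * z = 1" and h0: "h $ 0 = 1" and z0: "z $ 0 = 1" and z: "serI (z - 1)"
  shows "serI (h - 1)"
proof -
  have "(h - 1) $ n \<in> I" for n
  proof (induction n rule: less_induct)
    case (less n)
    show ?case
    proof (cases "n = 0")
      case False
      \<comment> \<open>The truncation is congruent to 1 by induction, so the coefficient of index n
        of its product with \<open>z\<close> lies in \<open>I\<close>. By the equation that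
        coefficient is -2 times \<open>h $ n\<close>.\<close>
      define f where "f = Abs_fps (\<lambda>m. if m < n then h $ m else 0)"
      have "(f - 1) $ m \<in> I" for m
        using less[of m] False zero_I by (cases "m < n") (simp_all add: f_def)
      hence "serI (f - 1)" by (simp add: serI_def)
      hence "serI (shift a f * shift b f * z - 1)" by (intro cong1_mult cong1_shift z)
      hence "(shift a f * shift b f * z) $ n \<in> I" using False unfolding serI_def by (metis diff_zero fps_one_nth fps_sub_nth)
      moreover have "(shift a f * shift b f * z) $ n + (h $ n + h $ n) = 0"
        using shift_product_nth[where n = n and f = h and z = z and f' = f and a = a and b = b] eq False h0 z0
        by (simp add: f_def)
      hence "h $ n + h $ n = - ((shift a f * shift b f * z) $ n)"
        by (simp add: add_eq_0_iff)
      hence "sc (1/2) * (h $ n + h $ n) = sc (- (1/2)) * (shift a f * shift b f * z) $ n"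
        by (simp only: sc_uminus mult_minus_left mult_minus_right)
      moreover have "sc (1/2) * (h $ n + h $ n) = sc (1/2 + 1/2) * h $ n"
        by (simp only: sc_add distrib_left distrib_right)
      ultimately have "h $ n \<in> I" using sc_I[of _ "- (1/2)"] by simp
      thus ?thesis using False by simp
    qed (simp add: h0 zero_I)
  qed
  thus ?thesis by (simp add: serI_def)
qed

end

section \<open>The ideals of Z(u) - 1 in Y^-(2) and of qdet T(u) - 1 in Y(2)\<close>

definition GY :: "gen2 free set set" where
  "GY = {Y2_class (S2mat i j $ n) | i j n. True}"

definition GZ :: "gen2 free set set" where
  "GZ = {Rep_y2 ((zser - 1) $ n) | n. True}"

lemma Y2m_eq: "Y2m = subalg Y2 GY"
  by (simp add: Y2m_def GY_def)

lemma GY_Rep: "Y2_class (S2mat i j $ n) = Rep_y2 (Sm i j $ n)"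
  by (simp add: Rep_pr flip: fmap_pr_S2mat)

lemma GY_subset: "GY \<subseteq> carrier Y2"
  by (auto simp: GY_def GY_Rep)

lemma calgebra_Y2m: "calgebra Y2m"
  unfolding Y2m_eq by (rule calgebra_subalg[OF calgebra_Y2 GY_subset])

interpretation Y2m: calgebra Y2m by (rule calgebra_Y2m)

lemma Y2m_simps [simp]:
  "zero Y2m = zero Y2" "one Y2m = one Y2" "add Y2m = add Y2" "monoid.mult Y2m = monoid.mult Y2" "smult Y2m = smult Y2"
  by (simp_all add: Y2m_eq)

lemma Y2m_carrier: "carrier Y2m = alg_gen Y2 GY"
  by (simp add: Y2m_eq)

lemma Y2m_subset: "carrier Y2m \<subseteq> carrier Y2"
  unfolding Y2m_carrier by (rule alg_gen_subset[OF calgebra_Y2 GY_subset])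

definition SY2_gens :: "gen2 free set set" where
  "SY2_gens = {Y2_class ((qdet - 1) $ n) | n. True}"

lemma SY2_gens_Rep: "Y2_class ((qdet - 1) $ n) = Rep_y2 ((qdetY - 1) $ n)"
  using additive_diff[of pr] pr_simps
  by (simp flip: Rep_pr fmap_pr_qdet) (simp add: pr_simps pr_zero)

lemma SY2_gens_subset: "SY2_gens \<subseteq> carrier Y2"
  by (auto simp: SY2_gens_def SY2_gens_Rep simp del: fps_sub_nth)

lemma SY2_ideal_eq: "SY2_ideal = Idl\<^bsub>Y2\<^esub> SY2_gens"
  by (simp add: SY2_ideal_def SY2_gens_def)

lemma SY2_ideal_ideal: "ideal SY2_ideal Y2"
  unfolding SY2_ideal_eq by (rule Y2.genideal_ideal[OF SY2_gens_subset])

lemma calgebra_SY2: "calgebra SY2"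
  unfolding SY2_def by (rule calgebra_alg_quot[OF calgebra_Y2 SY2_ideal_ideal])

lemma SY2_proj_hom: "SY2_proj \<in> alg_hom Y2 SY2"
  using proj_alg_hom[OF calgebra_Y2 SY2_ideal_ideal] unfolding SY2_def SY2_proj_def[abs_def] .

lemma SY2_proj_zero_iff: "x \<in> carrier Y2 \<Longrightarrow> SY2_proj x = \<zero>\<^bsub>SY2\<^esub> \<longleftrightarrow> x \<in> SY2_ideal"
  using coset_zero_iff[OF calgebra_Y2 SY2_ideal_ideal] by (simp add: SY2_def SY2_proj_def)

lemma SY2m_eq: "SY2m = subalg SY2 (SY2_proj ` GY)"
  unfolding SY2m_def GY_def by (rule arg_cong[of _ _ "subalg SY2"]) auto

lemma calgebra_SY2m: "calgebra SY2m"
  unfolding SY2m_eq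
  by (rule calgebra_subalg[OF calgebra_SY2]) (use GY_subset alg_homD(1)[OF SY2_proj_hom] in auto)

interpretation SY2m: calgebra SY2m by (rule calgebra_SY2m)

lemma SY2m_simps [simp]:
  "zero SY2m = zero SY2" "one SY2m = one SY2" "add SY2m = add SY2" "monoid.mult SY2m = monoid.mult SY2" "smult SY2m = smult SY2"
  by (simp_all add: SY2m_eq)

lemma SY2_proj_surj: "SY2_proj ` carrier Y2m = carrier SY2m"
  unfolding Y2m_carrier SY2m_eq subalg_simps
  by (rule alg_hom_image_alg_gen[OF SY2_proj_hom calgebra_Y2 GY_subset])

lemma SY2_proj_hom_m: "SY2_proj \<in> alg_hom Y2m SY2m"
  using SY2_proj_hom SY2_proj_surj Y2m_subset
  unfolding alg_hom_def ring_hom_def by (auto simp: subset_iff)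

text \<open>Transports ideals of the record subalgebra to subsets of the type \<open>y2\<close>,
  where congruences of series can be formed.\<close>

lemma subalgebra_ideal_Rep:
  assumes K: "ideal K (subalg Y2 G)"
  shows "subalgebra_ideal {y. Rep_y2 y \<in> alg_gen Y2 G} {y. Rep_y2 y \<in> K}"
proof -
  interpret K: ideal K "subalg Y2 G" by fact
  show ?thesis
  proof
    show "{y. Rep_y2 y \<in> K} \<subseteq> {y. Rep_y2 y \<in> alg_gen Y2 G}"
      using K.a_subset by auto
    show "sc c * x \<in> {y. Rep_y2 y \<in> alg_gen Y2 G}" if "x \<in> {y. Rep_y2 y \<in> alg_gen Y2 G}" for x c
      using that by (simp only: mem_Collect_eq Rep_y2_sc_mult alg_gen.smult)
  qed (use additive_subgroup.a_closed[OF K.additive_subgroup_axioms] K.I_l_closed K.I_r_closed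
        additive_subgroup.zero_closed[OF K.additive_subgroup_axioms]
      in \<open>auto simp: Rep_y2_simps(1-6) intro: alg_gen.intros\<close>)
qed

abbreviation "M\<^sub>Y \<equiv> {y. Rep_y2 y \<in> alg_gen Y2 GY}"
abbreviation "I\<^sub>Z \<equiv> {y. Rep_y2 y \<in> Idl\<^bsub>Y2m\<^esub> GZ}"

lemma Sm_in: "Sm i j $ n \<in> M\<^sub>Y"
proof -
  have "Y2_class (S2mat i j $ n) \<in> GY" by (auto simp: GY_def)
  thus ?thesis by (simp add: alg_gen.incl GY_Rep)
qed

text \<open>\<open>zser\<close> is built from elements of Y(2), but a diagonal entry of
  \<open>S_symmetry\<close> writes it through the coefficients of S(u). Only closure of the
  subalgebra is at stake, so the locale is used with the whole subalgebra as its ideal.\<close>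

lemma Z_in: "zser $ n \<in> M\<^sub>Y"
proof -
  have "ideal (carrier Y2m) Y2m" by (rule Y2m.oneideal)
  then interpret subalgebra_ideal M\<^sub>Y M\<^sub>Y
    using subalgebra_ideal_Rep[of "carrier Y2m" GY] by (simp add: Y2m_carrier Y2m_eq)
  have S: "serM (Sm i j)" for i j using Sm_in by (simp add: serM_def)
  have "serM zser"
    using S_symmetry[of Neg Neg] serM_sum[of UNIV "\<lambda>k. shift (1/2) (Sm Neg k) * neg (shift (1/2) (Sm k Neg))"]
    by (simp add: serM_mult serM_shift serM_neg S)
  thus ?thesis unfolding serM_def by blast
qed

lemma GZ_subset: "GZ \<subseteq> carrier Y2m"
proof -
  have "Rep_y2 (zser $ n) \<in> carrier Y2m" for n using Z_in by (simp add: Y2m_carrier)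
  moreover have "Rep_y2 (x - y) = Rep_y2 x \<ominus>\<^bsub>Y2m\<^esub> Rep_y2 y" if "Rep_y2 x \<in> carrier Y2m" "Rep_y2 y \<in> carrier Y2m" for x y
    using that subalg_a_inv[OF calgebra_Y2 GY_subset, of "Rep_y2 x" "Rep_y2 y"]
    by (simp add: Rep_y2_simps Y2m_carrier Y2m_eq)
  moreover have "Rep_y2 ((1 :: y2 fps) $ n) \<in> carrier Y2m" for n
    using Y2m.one_closed Y2m.zero_closed by (simp add: Rep_y2_simps)
  ultimately have "Rep_y2 ((zser - 1) $ n) \<in> carrier Y2m" for n
    unfolding fps_sub_nth using Y2m.minus_closed by presburger
  thus ?thesis unfolding GZ_def by blast
qed

lemma IZ_ideal: "ideal (Idl\<^bsub>Y2m\<^esub> GZ) Y2m"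
  by (rule Y2m.genideal_ideal[OF GZ_subset])

interpretation MI: subalgebra_ideal "M\<^sub>Y" "I\<^sub>Z"
  using subalgebra_ideal_Rep[OF IZ_ideal[unfolded Y2m_eq]] by (simp add: Y2m_eq)

lemma Z_cong1: "MI.serI (zser - 1)"
proof -
  have "Rep_y2 ((zser - 1) $ n) \<in> GZ" for n unfolding GZ_def by blast
  thus ?thesis using Y2m.genideal_self[OF GZ_subset] unfolding MI.serI_def by blast
qed

text \<open>qdet T(u) is 1 modulo this ideal, and congruence to 1 survives shift, reflection and
  product. The ideal lives in all of Y(2), which is therefore presented as generated by its own
  carrier.\<close>

lemma Z_in_SY2_ideal: "Rep_y2 ((zser - 1) $ n) \<in> SY2_ideal"
proof -
  have Y2: "subalg Y2 (carrier Y2) = Y2"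
  proof -
    have "alg_gen Y2 (carrier Y2) = carrier Y2"
      using alg_gen_subset[OF calgebra_Y2, of "carrier Y2"] by (auto intro: alg_gen.incl)
    thus ?thesis unfolding subalg_def by simp
  qed
  interpret S: subalgebra_ideal "{y. Rep_y2 y \<in> alg_gen Y2 (carrier Y2)}" "{y. Rep_y2 y \<in> SY2_ideal}"
    by (rule subalgebra_ideal_Rep) (simp add: Y2 SY2_ideal_ideal)
  have "S.serI (qdetY - 1)"
  proof -
    have "Rep_y2 ((qdetY - 1) $ n) \<in> SY2_gens" for n unfolding SY2_gens_def SY2_gens_Rep by blast
    hence "Rep_y2 ((qdetY - 1) $ n) \<in> SY2_ideal" for n
      unfolding SY2_ideal_eq by (rule subsetD[OF Y2.genideal_self[OF SY2_gens_subset]])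
    thus ?thesis unfolding S.serI_def by (simp del: fps_sub_nth)
  qed
  hence "S.serI (zser - 1)"
    unfolding zser_def by (intro S.cong1_mult S.cong1_neg S.cong1_shift)
  thus ?thesis unfolding S.serI_def by (simp del: fps_sub_nth)
qed

text \<open>
  Rescaling \<open>T(u)\<close> by the central series \<open>g(u)\<close> with \<open>g(u) g(u - 1) qdet tY(u) = 1\<close> is an
  endomorphism of \<open>Y(2)\<close> that kills the kernel of the projection to \<open>SY(2)\<close>. It multiplies \<open>S(u)\<close>
  by \<open>g(u) g(-u)\<close>, which is congruent to 1 modulo \<open>Z(u) - 1\<close>.
\<close>

lemma rescaling:
  obtains \<theta> :: "y2 \<Rightarrow> y2" and h where
    "\<And>x y. \<theta> (x + y) = \<theta> x + \<theta> y" "\<And>x y. \<theta> (x * y) = \<theta> x * \<theta> y" "\<And>c x. \<theta> (sc c * x) = sc c * \<theta> x"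
    "\<theta> 1 = 1" "fmap \<theta> qdetY = 1" "\<And>i j. fmap \<theta> (Sm i j) = h * Sm i j" "MI.serI (h - 1)"
proof -
  obtain g where g: "central g" "g $ 0 = 1" "g * shift 1 g * qdetY = 1"
    using exists_shift_inverse[OF central_q q_nth_0] by blast
  define \<Theta> where "\<Theta> = ev (\<lambda>(i, j, r). (g * tY i j) $ Suc r)"
  have \<Theta>: "\<Theta> (x + y) = \<Theta> x + \<Theta> y" "\<Theta> (x * y) = \<Theta> x * \<Theta> y" "\<Theta> 1 = 1" "\<Theta> (scal c) = sc c" for x y c
    by (simp_all add: \<Theta>_def ev_add ev_mult ev_one ev_scal)
  have \<Theta>T: "fmap \<Theta> (Tmat i j) = g * tY i j" for i j
    unfolding \<Theta>_def by (rule fmap_ev_Tmat) (simp add: g T_nth_0)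
  \<comment> \<open>The matrix g(u) T(u) satisfies the RTT relation, so \<open>\<Theta>\<close>
    descends from the free algebra to Y(2); the descended map is \<open>\<theta>\<close>.\<close>
  have \<Theta>0: "\<Theta> x = 0" if "x \<in> Y2_ideal" for x
    using Y2_ideal_vanish[of \<Theta>, OF \<Theta>(1,2) _ that] rtt_scale[OF g(1) rtt_T] by (simp add: \<Theta>T)
  define \<theta> where "\<theta> y = \<Theta> (SOME a. pr a = y)" for y
  have \<theta>pr: "\<theta> (pr a) = \<Theta> a" for a
  proof -
    define b where "b = (SOME b. pr b = pr a)"
    have "pr b = pr a" unfolding b_def by (rule someI[of _ a]) simp
    hence "pr (b - a) = 0" using additive_diff[of pr b a] pr_simps(1) by simp
    hence "\<Theta> (b - a) = 0" using \<Theta>0 pr_zero_iff by blast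
    thus ?thesis using additive_diff[of \<Theta> b a] \<Theta>(1) by (simp add: \<theta>_def b_def)
  qed
  have add: "\<theta> (x + y) = \<theta> x + \<theta> y" for x y
    using pr_surj[of x] pr_surj[of y] \<theta>pr \<Theta>(1) pr_simps(1) by metis
  have mult: "\<theta> (x * y) = \<theta> x * \<theta> y" for x y
    using pr_surj[of x] pr_surj[of y] \<theta>pr \<Theta>(2) pr_simps(2) by metis
  have one: "\<theta> 1 = 1" using \<theta>pr[of 1] by (simp add: pr_simps \<Theta>)
  have sc: "\<theta> (sc c * x) = sc c * \<theta> x" for c x
    using mult[of "sc c" x] \<theta>pr[of "scal c"] by (simp add: pr_scal \<Theta>)
  have \<theta>T: "fmap \<theta> (tY i j) = g * tY i j" for i j
  proof -
    have "fmap \<theta> (tY i j) = fmap \<Theta> (Tmat i j)" by (rule fps_ext) (simp add: tY_def \<theta>pr)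
    thus ?thesis by (simp only: \<Theta>T)
  qed
  note fm = fmap_mult[of \<theta>, OF add mult] fmap_shift[of \<theta>, OF add sc] fmap_neg[of \<theta>, OF add]
  have fdiff: "fmap \<theta> (f - f') = fmap \<theta> f - fmap \<theta> f'" for f f'
    by (rule fps_ext) (simp add: additive_diff[of \<theta>, OF add])
  have fsum: "fmap \<theta> (sum F I) = (\<Sum>i\<in>I. fmap \<theta> (F i))" for F :: "ix2 \<Rightarrow> y2 fps" and I
    by (rule fps_ext) (simp add: fps_sum_nth additive_sum[of \<theta>, OF add])
  have fsgn: "fmap \<theta> (sgn2 i * f) = sgn2 i * fmap \<theta> f" for i f
    by (rule fps_ext, cases i) (simp_all add: additive_minus[of \<theta>, OF add])
  have pull: "a * x * (b * y) = a * b * (x * y)" if "central b" for a b x y :: "y2 fps"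
    using central_commute[OF that, of x] by (metis mult.assoc)
  have "fmap \<theta> qdetY = shift 1 g * g * qdetY"
    unfolding qdetY_def qd_def fdiff fm \<theta>T shift_mult by (simp only: pull[OF g(1)] right_diff_distrib)
  hence \<theta>q: "fmap \<theta> qdetY = 1"
    using g(3) central_commute[OF g(1), of "shift 1 g"] by simp
  define h where "h = g * neg g"
  have \<theta>tr: "fmap \<theta> (tr tY k j) = g * tr tY k j" for k j
    unfolding tr_def mult.assoc fsgn \<theta>T by (cases k; cases j) simp_all
  have \<theta>S: "fmap \<theta> (Sm i j) = h * Sm i j" for i j
    unfolding Sm_def fsum fm \<theta>tr \<theta>T neg_mult h_def sum_distrib_left pull[OF central_neg[OF g(1)]] ..
  \<comment> \<open>\<open>G1\<close>, \<open>G2\<close> and \<open>Q\<close> are g(u + 1/2), g(u -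
    1/2) and qdet T(u + 1/2). The equation for g at u + 1/2 is \<open>e1\<close>, its reflection u
    -> -u is \<open>e2\<close>.\<close>
  define G1 G2 Q where "G1 = shift (- 1/2) g" and "G2 = shift (1/2) g" and "Q = shift (- 1/2) qdetY"
  have "shift (- 1/2) (g * shift 1 g * qdetY) = 1" by (simp add: g(3))
  hence e1: "G1 * G2 * Q = 1" by (simp add: shift_mult shift_shift G1_def G2_def Q_def)
  hence "neg (G1 * G2 * Q) = 1" by simp
  hence e2: "neg G1 * neg G2 * neg Q = 1" by (simp add: neg_mult)
  have c: "central (neg G1)" "central (neg G2)" "central G2" "central Q"
    by (auto simp: G1_def G2_def Q_def intro!: central_neg central_shift g central_q)
  have lc: "x * (y * z) = y * (x * z)" if "central x" for x y z :: "y2 fps"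
    using central_commute[OF that, of y] by (metis mult.assoc)
  \<comment> \<open>Regrouping the central factors turns the product into the left-hand side of
    \<open>e1\<close> times that of \<open>e2\<close>.\<close>
  have "shift (- 1/2) h * shift (1/2) h * zser = G1 * neg G2 * (G2 * neg G1) * (Q * neg Q)"
    by (simp add: h_def shift_mult zser_def G1_def G2_def Q_def neg_shift)
  also have "\<dots> = G1 * (G2 * (Q * (neg G1 * (neg G2 * neg Q))))"
    by (simp only: mult.assoc lc[OF c(2), of G2] lc[OF c(1), of Q] lc[OF c(2), of Q] lc[OF c(2), of "neg G1"])
  also have "\<dots> = 1"
    using e1 e2 by (simp flip: mult.assoc)
  finally have "MI.serI (h - 1)"
    by (rule MI.cong1_of_shift_product) (simp_all add: h_def g Z_nth_0 Z_cong1)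
  with that[of \<theta> h] add mult sc one \<theta>q \<theta>S show thesis by blast
qed

lemma SY2_kernel:
  assumes x: "x \<in> carrier Y2m"
  shows "SY2_proj x = \<zero>\<^bsub>SY2m\<^esub> \<longleftrightarrow> x \<in> Idl\<^bsub>Y2m\<^esub> GZ"
proof
  assume "SY2_proj x = \<zero>\<^bsub>SY2m\<^esub>"
  hence xS: "x \<in> SY2_ideal" using x SY2_proj_zero_iff Y2m_subset by auto
  obtain \<theta> :: "y2 \<Rightarrow> y2" and h where \<theta>:
    "\<And>x y. \<theta> (x + y) = \<theta> x + \<theta> y" "\<And>x y. \<theta> (x * y) = \<theta> x * \<theta> y" "\<And>c x. \<theta> (sc c * x) = sc c * \<theta> x"
    "\<theta> 1 = 1" "fmap \<theta> qdetY = 1" "\<And>i j. fmap \<theta> (Sm i j) = h * Sm i j" "MI.serI (h - 1)"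
    by (rule rescaling) blast
  have "\<theta> (Abs_y2 x) - Abs_y2 x \<in> I\<^sub>Z \<and> x \<in> alg_gen Y2 GY" if "x \<in> alg_gen Y2 GY" for x
    using that
  proof induction
    case (incl x)
    then obtain i j n where xS: "x = Rep_y2 (Sm i j $ n)" by (auto simp: GY_def GY_Rep)
    have "MI.serM (Sm i j)" using Sm_in by (simp add: MI.serM_def)
    hence "MI.serI ((h - 1) * Sm i j)" by (intro MI.serI_mult_right \<theta>)
    hence "(fmap \<theta> (Sm i j) - Sm i j) $ n \<in> I\<^sub>Z"
      unfolding \<theta> MI.serI_def by (simp add: left_diff_distrib)
    thus ?case using incl by (simp add: xS Rep_y2_inverse alg_gen.incl)
  next
    case one
    have "Abs_y2 \<one>\<^bsub>Y2\<^esub> = 1" by (simp add: one_y2_def)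
    thus ?case using MI.zero_I by (simp add: \<theta> alg_gen.one)
  next
    case (add x y)
    define a b where "a = Abs_y2 x" and "b = Abs_y2 y"
    have xy: "x = Rep_y2 a" "y = Rep_y2 b"
      using add.hyps alg_gen_subset[OF calgebra_Y2 GY_subset] by (auto simp: a_def b_def Abs_y2_inverse)
    have "(\<theta> a - a) + (\<theta> b - b) \<in> I\<^sub>Z"
      using add.IH by (intro MI.add_I) (simp_all add: a_def b_def)
    moreover have "\<theta> (a + b) - (a + b) = (\<theta> a - a) + (\<theta> b - b)" by (simp add: \<theta>)
    moreover have "x \<oplus>\<^bsub>Y2\<^esub> y = Rep_y2 (a + b)" by (simp add: xy Rep_y2_simps)
    moreover have "x \<oplus>\<^bsub>Y2\<^esub> y \<in> alg_gen Y2 GY" using add.hyps by (rule alg_gen.add)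
    ultimately show ?case by (simp only: Rep_y2_inverse simp_thms)
  next
    case (mult x y)
    define a b where "a = Abs_y2 x" and "b = Abs_y2 y"
    have xy: "x = Rep_y2 a" "y = Rep_y2 b"
      using mult.hyps alg_gen_subset[OF calgebra_Y2 GY_subset] by (auto simp: a_def b_def Abs_y2_inverse)
    have I: "\<theta> a - a \<in> I\<^sub>Z" "\<theta> b - b \<in> I\<^sub>Z" using mult.IH by (simp_all add: a_def b_def)
    have "a \<in> M\<^sub>Y" "b \<in> M\<^sub>Y" using mult.hyps by (simp_all add: xy)
    \<comment> \<open>It is not known beforehand that \<open>\<theta>\<close> preserves Y^-(2). Here
      \<theta>(b) is in it because it differs from b by an element of the ideal.\<close>
    moreover have "\<theta> b - b + b \<in> M\<^sub>Y" using I(2) MI.sub calculation by (intro MI.add_M) auto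
    ultimately have "(\<theta> a - a) * \<theta> b + a * (\<theta> b - b) \<in> I\<^sub>Z"
      using I by (intro MI.add_I MI.left_I MI.right_I) simp_all
    moreover have "\<theta> (a * b) - a * b = (\<theta> a - a) * \<theta> b + a * (\<theta> b - b)" by (simp add: \<theta> algebra_simps)
    moreover have "x \<otimes>\<^bsub>Y2\<^esub> y = Rep_y2 (a * b)" by (simp add: xy Rep_y2_simps)
    moreover have "x \<otimes>\<^bsub>Y2\<^esub> y \<in> alg_gen Y2 GY" using mult.hyps by (rule alg_gen.mult)
    ultimately show ?case by (simp only: Rep_y2_inverse simp_thms)
  next
    case (smult x c)
    define a where "a = Abs_y2 x"
    have xy: "x = Rep_y2 a"
      using smult.hyps alg_gen_subset[OF calgebra_Y2 GY_subset] by (auto simp: a_def Abs_y2_inverse)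
    have "sc c * (\<theta> a - a) \<in> I\<^sub>Z" using smult.IH by (intro MI.sc_I) (simp add: a_def)
    moreover have "\<theta> (sc c * a) - sc c * a = sc c * (\<theta> a - a)" by (simp only: \<theta>(3) right_diff_distrib)
    moreover have "c \<odot>\<^bsub>Y2\<^esub> x = Rep_y2 (sc c * a)" by (simp add: xy Rep_y2_sc_mult)
    moreover have "c \<odot>\<^bsub>Y2\<^esub> x \<in> alg_gen Y2 GY" using smult.hyps by (rule alg_gen.smult)
    ultimately show ?case by (simp only: Rep_y2_inverse simp_thms)
  qed
  hence "\<theta> (Abs_y2 x) - Abs_y2 x \<in> I\<^sub>Z" using x by (simp add: Y2m_carrier)
  \<comment> \<open>The kernel of \<open>\<theta>\<close> is an ideal of all of Y(2) and contains
    the coefficients of qdet T(u) - 1, hence all of \<open>SY2_ideal\<close>.\<close>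
  moreover have "\<theta> (Abs_y2 x) = 0"
  proof -
    have "Rep_y2 (\<theta> (Abs_y2 (x \<otimes>\<^bsub>Y2\<^esub> y))) = Rep_y2 (\<theta> (Abs_y2 x)) \<otimes>\<^bsub>Y2\<^esub> Rep_y2 (\<theta> (Abs_y2 y))"
      "Rep_y2 (\<theta> (Abs_y2 (x \<oplus>\<^bsub>Y2\<^esub> y))) = Rep_y2 (\<theta> (Abs_y2 x)) \<oplus>\<^bsub>Y2\<^esub> Rep_y2 (\<theta> (Abs_y2 y))"
      if "x \<in> carrier Y2" "y \<in> carrier Y2" for x y
    proof -
      obtain a b where ab: "x = Rep_y2 a" "y = Rep_y2 b" using \<open>x \<in> carrier Y2\<close> \<open>y \<in> carrier Y2\<close> by (metis Abs_y2_inverse)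
      show "Rep_y2 (\<theta> (Abs_y2 (x \<otimes>\<^bsub>Y2\<^esub> y))) = Rep_y2 (\<theta> (Abs_y2 x)) \<otimes>\<^bsub>Y2\<^esub> Rep_y2 (\<theta> (Abs_y2 y))"
        "Rep_y2 (\<theta> (Abs_y2 (x \<oplus>\<^bsub>Y2\<^esub> y))) = Rep_y2 (\<theta> (Abs_y2 x)) \<oplus>\<^bsub>Y2\<^esub> Rep_y2 (\<theta> (Abs_y2 y))"
        unfolding ab by (simp_all only: Rep_y2_simps(3,6)[symmetric] Rep_y2_inverse \<theta>(1,2))
    qed
    moreover have "Rep_y2 (\<theta> (Abs_y2 (c \<odot>\<^bsub>Y2\<^esub> x))) = c \<odot>\<^bsub>Y2\<^esub> Rep_y2 (\<theta> (Abs_y2 x))"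
      if x: "x \<in> carrier Y2" for c x
    proof -
      obtain a where a: "x = Rep_y2 a" using x by (metis Abs_y2_inverse)
      show ?thesis unfolding a by (simp only: Rep_y2_sc_mult[symmetric] Rep_y2_inverse \<theta>(3))
    qed
    moreover have "Rep_y2 (\<theta> (Abs_y2 \<one>\<^bsub>Y2\<^esub>)) = \<one>\<^bsub>Y2\<^esub>"
      using \<theta>(4) by (simp add: Rep_y2_simps flip: one_y2_def)
    ultimately have "(\<lambda>x. Rep_y2 (\<theta> (Abs_y2 x))) \<in> alg_hom Y2 Y2"
      by (simp add: alg_hom_def ring_hom_def)
    from alg_hom_kernel_ideal[OF this calgebra_Y2 calgebra_Y2]
    have idl: "ideal {x \<in> carrier Y2. Rep_y2 (\<theta> (Abs_y2 x)) = \<zero>\<^bsub>Y2\<^esub>} Y2" .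
    have gens: "SY2_gens \<subseteq> {x \<in> carrier Y2. Rep_y2 (\<theta> (Abs_y2 x)) = \<zero>\<^bsub>Y2\<^esub>}"
    proof -
      have "\<theta> ((qdetY - 1) $ n) = 0" for n
      proof -
        have "\<theta> ((qdetY - 1) $ n) = fmap \<theta> qdetY $ n - \<theta> ((1 :: y2 fps) $ n)"
          using additive_diff[of \<theta>] \<theta>(1) by simp
        thus ?thesis using additive_zero[of \<theta>] \<theta>(1) unfolding \<theta>(5) by (simp add: \<theta>(4))
      qed
      thus ?thesis by (auto simp: SY2_gens_def SY2_gens_Rep Rep_y2_inverse Rep_y2_simps(1) simp del: fps_sub_nth)
    qed
    have "SY2_ideal \<subseteq> {x \<in> carrier Y2. Rep_y2 (\<theta> (Abs_y2 x)) = \<zero>\<^bsub>Y2\<^esub>}"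
      unfolding SY2_ideal_eq by (rule Y2.genideal_minimal[OF idl gens])
    hence "Rep_y2 (\<theta> (Abs_y2 x)) = Rep_y2 0" using xS by (auto simp: Rep_y2_simps)
    thus ?thesis by (simp add: Rep_y2_inject)
  qed
  ultimately have "sc (- 1) * (- Abs_y2 x) \<in> I\<^sub>Z" by (intro MI.sc_I) simp
  hence "Abs_y2 x \<in> I\<^sub>Z" by (simp add: sc_uminus)
  thus "x \<in> Idl\<^bsub>Y2m\<^esub> GZ" using x Y2m_subset by (simp add: Abs_y2_inverse subset_iff)
next
  assume "x \<in> Idl\<^bsub>Y2m\<^esub> GZ"
  moreover have "Idl\<^bsub>Y2m\<^esub> GZ \<subseteq> {x \<in> carrier Y2m. SY2_proj x = \<zero>\<^bsub>SY2m\<^esub>}"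
  proof (rule Y2m.genideal_minimal[OF alg_hom_kernel_ideal[OF SY2_proj_hom_m calgebra_Y2m calgebra_SY2m]])
    show "GZ \<subseteq> {x \<in> carrier Y2m. SY2_proj x = \<zero>\<^bsub>SY2m\<^esub>}"
    proof
      fix y assume y: "y \<in> GZ"
      then obtain n where "y = Rep_y2 ((zser - 1) $ n)" unfolding GZ_def by blast
      hence "y \<in> SY2_ideal" using Z_in_SY2_ideal by simp
      thus "y \<in> {x \<in> carrier Y2m. SY2_proj x = \<zero>\<^bsub>SY2m\<^esub>}"
        using y GZ_subset Y2m_subset by (simp add: SY2_proj_zero_iff subset_iff)
    qed
  qed
  ultimately show "SY2_proj x = \<zero>\<^bsub>SY2m\<^esub>" by auto
qed

section \<open>The tensor square of \<open>Y\<^sup>-(2)\<close> as a type\<close>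

interpretation YY: tensor_algebras Y2m Y2m
  by unfold_locales

interpretation SY: tensor_algebras SY2m Y2m
  by unfold_locales

interpretation SS: tensor_algebras SY2m SY2m
  by unfold_locales

abbreviation (input) "TY \<equiv> tensor Y2m Y2m"

typedef yt = "carrier TY"
  using YY.T.one_closed by blast

text \<open>The class \<open>ring_1\<close> would demand 0 \<noteq> 1 in the tensor square; products
  of series are already defined over a \<open>ring\<close>.\<close>

instantiation yt :: ring
begin

definition "0 = Abs_yt \<zero>\<^bsub>TY\<^esub>"
definition "x + y = Abs_yt (Rep_yt x \<oplus>\<^bsub>TY\<^esub> Rep_yt y)"
definition "x - y = Abs_yt (Rep_yt x \<ominus>\<^bsub>TY\<^esub> Rep_yt y)"
definition "- x = Abs_yt (\<ominus>\<^bsub>TY\<^esub> Rep_yt x)"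
definition "x * y = Abs_yt (Rep_yt x \<otimes>\<^bsub>TY\<^esub> Rep_yt y)"

lemma Rep_yt_closed [simp]: "Rep_yt x \<in> carrier TY"
  by (rule Rep_yt)

lemma Rep_yt_simps:
  "Rep_yt 0 = \<zero>\<^bsub>TY\<^esub>" "Rep_yt (x + y) = Rep_yt x \<oplus>\<^bsub>TY\<^esub> Rep_yt y"
  "Rep_yt (x - y) = Rep_yt x \<ominus>\<^bsub>TY\<^esub> Rep_yt y" "Rep_yt (- x) = \<ominus>\<^bsub>TY\<^esub> Rep_yt x"
  "Rep_yt (x * y) = Rep_yt x \<otimes>\<^bsub>TY\<^esub> Rep_yt y"
  by (simp_all add: zero_yt_def plus_yt_def minus_yt_def uminus_yt_def times_yt_def Abs_yt_inverse)

instance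
  by standard
    (simp_all add: Rep_yt_inject[symmetric] Rep_yt_simps YY.T.a_ac YY.T.m_assoc YY.T.l_distr YY.T.r_distr
      YY.T.l_neg YY.T.r_neg YY.T.minus_eq)

end

lemma Rep_yt_sum: "Rep_yt (sum f I) = (\<Oplus>\<^bsub>TY\<^esub>i\<in>I. Rep_yt (f i))" if "finite I"
  using that by (induction I rule: finite_induct) (simp_all add: Rep_yt_simps)

text \<open>The embeddings a -> a \<otimes> 1 and a -> 1 \<otimes> a. As functions they are total on
  \<open>y2\<close>, but they behave as homomorphisms only on the subalgebra
  \<open>M\<^sub>Y\<close>.\<close>

definition tensL :: "y2 \<Rightarrow> yt" where "tensL a = Abs_yt (tens Y2m Y2m (Rep_y2 a) \<one>\<^bsub>Y2\<^esub>)"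
definition tensR :: "y2 \<Rightarrow> yt" where "tensR a = Abs_yt (tens Y2m Y2m \<one>\<^bsub>Y2\<^esub> (Rep_y2 a))"

lemma M_closed: "a \<in> M\<^sub>Y \<Longrightarrow> Rep_y2 a \<in> carrier Y2m"
  by (simp add: Y2m_carrier)

lemma one_Y2m [simp]: "\<one>\<^bsub>Y2\<^esub> \<in> carrier Y2m"
  using Y2m.one_closed by simp

lemma Rep_L: "a \<in> M\<^sub>Y \<Longrightarrow> Rep_yt (tensL a) = tens Y2m Y2m (Rep_y2 a) \<one>\<^bsub>Y2\<^esub>"
  and Rep_R: "a \<in> M\<^sub>Y \<Longrightarrow> Rep_yt (tensR a) = tens Y2m Y2m \<one>\<^bsub>Y2\<^esub> (Rep_y2 a)"
  by (simp_all add: tensL_def tensR_def Abs_yt_inverse YY.tens_closed M_closed del: mem_Collect_eq)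

lemma LR_simps:
  assumes "a \<in> M\<^sub>Y" "b \<in> M\<^sub>Y"
  shows "tensL (a + b) = tensL a + tensL b" "tensR (a + b) = tensR a + tensR b" "tensL (a * b) = tensL a * tensL b" "tensR (a * b) = tensR a * tensR b"
    "tensL a * tensR b = Abs_yt (tens Y2m Y2m (Rep_y2 a) (Rep_y2 b))" "tensR b * tensL a = tensL a * tensR b"
proof -
  note M = MI.add_M[OF assms] MI.mult_M[OF assms] assms
  note simps = Rep_yt_inject[symmetric] Rep_L[OF M(1)] Rep_L[OF M(2)] Rep_L[OF M(3)] Rep_L[OF M(4)]
    Rep_R[OF M(1)] Rep_R[OF M(2)] Rep_R[OF M(3)] Rep_R[OF M(4)] Rep_yt_simps Rep_y2_simps
  note c = M_closed[OF assms(1)] M_closed[OF assms(2)]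
  show "tensL (a + b) = tensL a + tensL b" "tensR (a + b) = tensR a + tensR b"
    using c YY.tens_add_left[of "Rep_y2 a" "Rep_y2 b" "\<one>\<^bsub>Y2\<^esub>"] YY.tens_add_right[of "\<one>\<^bsub>Y2\<^esub>" "Rep_y2 a" "Rep_y2 b"]
    by (simp_all add: simps)
  note m = YY.tens_mult[of "Rep_y2 a" "\<one>\<^bsub>Y2\<^esub>" "Rep_y2 b" "\<one>\<^bsub>Y2\<^esub>"] YY.tens_mult[of "\<one>\<^bsub>Y2\<^esub>" "Rep_y2 a" "\<one>\<^bsub>Y2\<^esub>" "Rep_y2 b"]
    YY.tens_mult[of "Rep_y2 a" "\<one>\<^bsub>Y2\<^esub>" "\<one>\<^bsub>Y2\<^esub>" "Rep_y2 b"] YY.tens_mult[of "\<one>\<^bsub>Y2\<^esub>" "Rep_y2 b" "Rep_y2 a" "\<one>\<^bsub>Y2\<^esub>"]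
  show "tensL (a * b) = tensL a * tensL b" "tensR (a * b) = tensR a * tensR b"
    using c m by (simp_all add: simps)
  show "tensL a * tensR b = Abs_yt (tens Y2m Y2m (Rep_y2 a) (Rep_y2 b))" "tensR b * tensL a = tensL a * tensR b"
    using c m by (simp_all add: simps Abs_yt_inverse YY.tens_closed)
qed

text \<open>The lemmas on partial homomorphisms repeat those on additive maps for functions that are
  controlled only on \<open>M\<^sub>Y\<close>, such as \<open>tensL\<close> and
  \<open>tensR\<close>.\<close>

lemma partial_hom_sum:
  fixes h :: "y2 \<Rightarrow> yt"
  assumes h: "\<And>x y. x \<in> M\<^sub>Y \<Longrightarrow> y \<in> M\<^sub>Y \<Longrightarrow> h (x + y) = h x + h y"
    and f: "\<And>i. i \<in> I \<Longrightarrow> f i \<in> M\<^sub>Y"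
  shows "h (sum f I) = (\<Sum>i\<in>I. h (f i))"
proof -
  have z: "(0 :: y2) \<in> M\<^sub>Y" using MI.zero_I MI.sub by blast
  have 0: "h 0 = 0" using h[OF z z] by simp
  show ?thesis using f
    by (induction I rule: infinite_finite_induct) (simp_all add: 0 h MI.sum_M del: mem_Collect_eq)
qed

lemma partial_hom_fmap_mult:
  fixes h :: "y2 \<Rightarrow> yt"
  assumes h: "\<And>x y. x \<in> M\<^sub>Y \<Longrightarrow> y \<in> M\<^sub>Y \<Longrightarrow> h (x + y) = h x + h y"
    "\<And>x y. x \<in> M\<^sub>Y \<Longrightarrow> y \<in> M\<^sub>Y \<Longrightarrow> h (x * y) = h x * h y"
    and f: "MI.serM f" and g: "MI.serM g"
  shows "fmap h (f * g) = fmap h f * fmap h g"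
proof (rule fps_ext)
  fix n
  have "h ((f * g) $ n) = (\<Sum>i=0..n. h (f $ i * g $ (n - i)))"
    unfolding fps_mult_nth by (rule partial_hom_sum[OF h(1)]) (use f g MI.mult_M in \<open>auto simp: MI.serM_def simp del: mem_Collect_eq\<close>)
  also have "\<dots> = (fmap h f * fmap h g) $ n"
    using f g h(2) by (simp add: fps_mult_nth MI.serM_def del: mem_Collect_eq)
  finally show "fmap h (f * g) $ n = (fmap h f * fmap h g) $ n" by simp
qed

lemma partial_hom_fmap_neg:
  fixes h :: "y2 \<Rightarrow> yt"
  assumes h: "\<And>x y. x \<in> M\<^sub>Y \<Longrightarrow> y \<in> M\<^sub>Y \<Longrightarrow> h (x + y) = h x + h y" and f: "MI.serM f"
  shows "fmap h (neg f) = neg (fmap h f)"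
proof (rule fps_ext)
  fix n
  have z: "(0 :: y2) \<in> M\<^sub>Y" using MI.zero_I MI.sub by blast
  have fn: "f $ n \<in> M\<^sub>Y" "- (f $ n) \<in> M\<^sub>Y"
    using f MI.sc_M[of "f $ n" "- 1"] by (simp_all add: MI.serM_def sc_uminus)
  have "h (f $ n) + h (- (f $ n)) = h 0" "h 0 = 0"
    using h[OF fn] h[OF z z] by simp_all
  hence "h (- (f $ n)) = - h (f $ n)" by (simp add: add_eq_0_iff)
  thus "fmap h (neg f) $ n = neg (fmap h f) $ n" by (simp add: neg_def)
qed

lemma LR_commute:
  assumes "MI.serM f" "MI.serM g"
  shows "fmap tensR g * fmap tensL f = fmap tensL f * fmap tensR g"
proof (rule fps_ext)
  fix n
  have "(fmap tensR g * fmap tensL f) $ n = (\<Sum>i\<le>n. tensL (f $ (n - i)) * tensR (g $ i))"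
    using assms LR_simps(6) by (simp add: fps_mult_nth atLeast0AtMost MI.serM_def del: mem_Collect_eq)
  also have "\<dots> = (fmap tensL f * fmap tensR g) $ n"
    unfolding fps_mult_nth atLeast0AtMost
    by (rule sum.reindex_bij_witness[of _ "\<lambda>i. n - i" "\<lambda>i. n - i"]) auto
  finally show "(fmap tensR g * fmap tensL f) $ n = (fmap tensL f * fmap tensR g) $ n" .
qed

section \<open>The symmetry relation of \<open>X(so\<^sub>4, so\<^sub>4)\<^sup>t\<^sup>w\<close>\<close>

text \<open>Multiplication by \<open>vsign i\<close>, expressed by negation because
  \<open>yt\<close> carries no scalars; the sign is that of v_2.\<close>

definition vs :: "ix4 \<Rightarrow> 'a::ring \<Rightarrow> 'a" where
  "vs i x = (if i = Pos2 then - x else x)"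

definition Sh :: "ix2 \<Rightarrow> ix2 \<Rightarrow> y2 fps" where
  "Sh i j = shift (1/2) (Sm i j)"

text \<open>The matrix \<open>phi_image\<close> as a matrix of series, so that symmetry can be
  computed by multiplying series.\<close>

definition Simg :: "ix4 \<Rightarrow> ix4 \<Rightarrow> yt fps" where
  "Simg i j = vs i (vs j (fmap tensL (Sh (fac1 i) (fac1 j)) * fmap tensR (Sh (fac2 i) (fac2 j))))"

lemma UNIV_ix4: "UNIV = {Neg2, Neg1, Pos1, Pos2}"
  using ix4.exhaust by auto

lemma sum_ix4: "(\<Sum>k\<in>UNIV. F (fac1 k) (fac2 k)) = (\<Sum>a\<in>UNIV. \<Sum>b\<in>UNIV. F a b)"
  by (simp add: UNIV_ix4 UNIV_ix2 add.assoc)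

lemma serM_Sh: "MI.serM (Sh i j)"
  unfolding Sh_def by (rule MI.serM_shift) (use Sm_in in \<open>simp add: MI.serM_def\<close>)

lemma fac_eq_iff: "i = j \<longleftrightarrow> fac1 i = fac1 j \<and> fac2 i = fac2 j"
  by (cases i; cases j) simp_all

text \<open>The two tensor factors commute, so the product of two such matrices is the product of
  the first factors times that of the second, and \<open>S_symmetry\<close> applies to each.\<close>

lemma E_symmetry: "(\<Sum>k\<in>UNIV. Simg i k * neg (Simg k j)) = (if i = j then fmap tensL zser * fmap tensR zser else 0)"
proof -
  note Lh = LR_simps(1,3) and Rh = LR_simps(2,4)
  note sM = MI.serM_mult[OF serM_Sh MI.serM_neg[OF serM_Sh]]
  let ?B = "\<lambda>i k j. Sh i k * neg (Sh k j)"
  have prod: "fmap tensL (Sh a b) * fmap tensR (Sh a' b') * neg (fmap tensL (Sh b c) * fmap tensR (Sh b' c')) =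
      fmap tensL (?B a b c) * fmap tensR (?B a' b' c')" for a b c a' b' c'
  proof -
    have "fmap tensL (Sh a b) * fmap tensR (Sh a' b') * neg (fmap tensL (Sh b c) * fmap tensR (Sh b' c')) =
        fmap tensL (Sh a b) * (fmap tensR (Sh a' b') * fmap tensL (neg (Sh b c))) * fmap tensR (neg (Sh b' c'))"
    proof -
      have "fmap tensL (neg (Sh b c)) = neg (fmap tensL (Sh b c))" "fmap tensR (neg (Sh b' c')) = neg (fmap tensR (Sh b' c'))"
        by (rule partial_hom_fmap_neg[OF _ serM_Sh]; erule (1) LR_simps)+
      thus ?thesis by (simp only: neg_mult mult.assoc)
    qed
    also have "\<dots> = fmap tensL (Sh a b) * fmap tensL (neg (Sh b c)) * (fmap tensR (Sh a' b') * fmap tensR (neg (Sh b' c')))"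
      by (simp add: LR_commute[OF MI.serM_neg[OF serM_Sh] serM_Sh] mult.assoc)
    also have "\<dots> = fmap tensL (?B a b c) * fmap tensR (?B a' b' c')"
    proof -
      have "fmap tensL (?B a b c) = fmap tensL (Sh a b) * fmap tensL (neg (Sh b c))"
        "fmap tensR (?B a' b' c') = fmap tensR (Sh a' b') * fmap tensR (neg (Sh b' c'))"
        by (rule partial_hom_fmap_mult[OF _ _ serM_Sh MI.serM_neg[OF serM_Sh]]; erule (1) LR_simps)+
      thus ?thesis by simp
    qed
    finally show ?thesis .
  qed
  \<comment> \<open>The sign of the summation index occurs once in each factor and cancels.\<close>
  have vsm: "vs i (vs k x) * neg (vs k (vs j y)) = vs i (vs j (x * neg y))" for k and x y :: "yt fps"
    using neg_diff[of 0 y] by (simp add: vs_def)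
  have vss: "(\<Sum>k\<in>UNIV. vs i (vs j (F k))) = vs i (vs j (\<Sum>k\<in>UNIV. F k))" for F :: "ix4 \<Rightarrow> yt fps"
    by (simp add: vs_def sum_negf)
  have hs: "(\<Sum>k\<in>UNIV. fmap h (?B a k b)) = fmap h (if a = b then zser else 0)"
    if "\<And>x y. x \<in> M\<^sub>Y \<Longrightarrow> y \<in> M\<^sub>Y \<Longrightarrow> h (x + y) = h x + h y" for h :: "y2 \<Rightarrow> yt" and a b
  proof -
    have "(\<Sum>k\<in>UNIV. fmap h (?B a k b)) = fmap h (\<Sum>k\<in>UNIV. ?B a k b)"
    proof (rule fps_ext)
      fix n
      have "?B a k b $ n \<in> M\<^sub>Y" for k using sM unfolding MI.serM_def by blast
      thus "(\<Sum>k\<in>UNIV. fmap h (?B a k b)) $ n = fmap h (\<Sum>k\<in>UNIV. ?B a k b) $ n"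
        using partial_hom_sum[of h UNIV "\<lambda>k. ?B a k b $ n", OF that] by (simp only: fps_sum_nth fmap_nth)
    qed
    thus ?thesis using S_symmetry[of a b] by (simp add: Sh_def)
  qed
  have hL: "(\<Sum>k\<in>UNIV. fmap tensL (?B a k b)) = fmap tensL (if a = b then zser else 0)"
    and hR: "(\<Sum>k\<in>UNIV. fmap tensR (?B a k b)) = fmap tensR (if a = b then zser else 0)" for a b
    by (rule hs, erule (1) LR_simps)+
  have f0: "fmap tensL 0 = 0" "fmap tensR 0 = 0"
    by (rule fps_ext, use partial_hom_sum[of tensL "{}"] partial_hom_sum[of tensR "{}"] LR_simps in simp)+
  have "(\<Sum>k\<in>UNIV. Simg i k * neg (Simg k j)) =
      vs i (vs j (\<Sum>k\<in>UNIV. fmap tensL (?B (fac1 i) (fac1 k) (fac1 j)) * fmap tensR (?B (fac2 i) (fac2 k) (fac2 j))))"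
    unfolding Simg_def vsm prod vss ..
  also have "(\<Sum>k\<in>UNIV. fmap tensL (?B (fac1 i) (fac1 k) (fac1 j)) * fmap tensR (?B (fac2 i) (fac2 k) (fac2 j))) =
      (\<Sum>a\<in>UNIV. fmap tensL (?B (fac1 i) a (fac1 j))) * (\<Sum>b\<in>UNIV. fmap tensR (?B (fac2 i) b (fac2 j)))"
    unfolding sum_product by (rule sum_ix4)
  also have "\<dots> = (if i = j then fmap tensL zser * fmap tensR zser else 0)"
    unfolding hL hR by (simp add: fac_eq_iff f0)
  finally show ?thesis by (simp add: vs_def)
qed

lemma phi_image_eq: "phi_image i j n = Rep_yt (Simg i j $ n)"
proof -
  have c: "Y2_class (ser_shift (1/2) (S2mat i j) $ m) = Rep_y2 (Sh i j $ m)" for i j m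
    by (simp add: Sh_def fmap_ser_shift flip: fmap_pr_S2mat) (simp add: Rep_pr flip: fmap_ser_shift)
  have AM: "Sh i j $ m \<in> M\<^sub>Y" for i j m
    using serM_Sh unfolding MI.serM_def by blast
  have vsR: "(vsign i * vsign j) \<odot>\<^bsub>TY\<^esub> Rep_yt x = Rep_yt (vs i (vs j x))" for x
    by (cases i; cases j) (simp_all add: vs_def Rep_yt_simps YY.T.smult_one YY.T.smult_minus_one)
  have vsn: "vs i f $ n = vs i (f $ n)" for i and f :: "yt fps"
    by (simp add: vs_def)
  have "Rep_yt ((fmap tensL (Sh (fac1 i) (fac1 j)) * fmap tensR (Sh (fac2 i) (fac2 j))) $ n) =
     (\<Oplus>\<^bsub>TY\<^esub>m\<in>{..n}. tens Y2m Y2m (Rep_y2 (Sh (fac1 i) (fac1 j) $ m)) (Rep_y2 (Sh (fac2 i) (fac2 j) $ (n - m))))"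
    unfolding fps_mult_nth atLeast0AtMost Rep_yt_sum[OF finite_atMost] fmap_nth
    by (intro finsum_cong_calg YY.calgebra_tensor)
       (simp_all add: LR_simps(5) AM M_closed Abs_yt_inverse YY.tens_closed del: mem_Collect_eq)
  thus ?thesis
    unfolding phi_image_def c Simg_def vsn vsR[symmetric] by simp
qed

section \<open>The quotient by \<open>w(u) = 1\<close>\<close>

lemma X4_ideal_ideal: "ideal X4_ideal free_alg"
proof -
  interpret calgebra "free_alg :: gen4 free calg" by (rule calgebra_free_alg)
  show ?thesis unfolding X4_ideal_def by (rule genideal_ideal) simp
qed

lemma calgebra_X4: "calgebra X4"
  unfolding X4_def by (rule calgebra_alg_quot[OF calgebra_free_alg X4_ideal_ideal])

lemma X4_class_hom: "X4_class \<in> alg_hom free_alg X4"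
  using proj_alg_hom[OF calgebra_free_alg X4_ideal_ideal] unfolding X4_def X4_class_def[abs_def] .

lemma X4_gens_subset: "{X4_class (S4mat i j $ n) | i j n. True} \<subseteq> carrier X4"
  using alg_homD(1)[OF X4_class_hom] by auto

lemma calgebra_X4tw: "calgebra X4tw"
  unfolding X4tw_def by (rule calgebra_subalg[OF calgebra_X4 X4_gens_subset])

interpretation X4tw: calgebra X4tw by (rule calgebra_X4tw)

lemma X4tw_simps [simp]:
  "zero X4tw = zero X4" "one X4tw = one X4" "add X4tw = add X4" "monoid.mult X4tw = monoid.mult X4" "smult X4tw = smult X4"
  by (simp_all add: X4tw_def)

lemma X4tw_gen: "X4_class (S4mat i j $ n) \<in> carrier X4tw"
  unfolding X4tw_def subalg_simps by (rule alg_gen.incl) blast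

section \<open>The series w(u) and its images\<close>

definition Sprod :: "ix4 \<Rightarrow> ix4 \<Rightarrow> nat \<Rightarrow> gen4 free" where
  "Sprod i j n = (\<Sum>k\<in>UNIV. S4mat i k * ser_neg (S4mat k j)) $ n"

text \<open>The products S(u) S(-u) are formed in the free algebra, whereas \<phi> is a homomorphism
  only on X^tw. The set \<open>?D\<close> of free elements whose class lies in X^tw is closed under
  all operations involved, and on it \<open>\<rho>\<close> can be computed term by term.\<close>

lemma phi_W:
  assumes hom: "\<phi> \<in> alg_hom X4tw TY" and gens: "\<And>i j n. \<phi> (X4_class (S4mat i j $ n)) = phi_image i j n"
  shows "X4_class (Sprod i j n) \<in> carrier X4tw"
    and "\<phi> (X4_class (Sprod i j n)) = Rep_yt ((if i = j then fmap tensL zser * fmap tensR zser else 0) $ n)"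
proof -
  let ?D = "{x. X4_class x \<in> carrier X4tw}"
  define \<rho> where "\<rho> x = Abs_yt (\<phi> (X4_class x))" for x
  have Rep\<rho>: "Rep_yt (\<rho> x) = \<phi> (X4_class x)" if "x \<in> ?D" for x
    using that alg_homD(1)[OF hom] by (simp add: \<rho>_def Abs_yt_inverse)
  note X = alg_homD(2,3)[OF X4_class_hom, simplified]
  have D: "x + y \<in> ?D" "x * y \<in> ?D" if "x \<in> ?D" "y \<in> ?D" for x y
    using that X4tw.a_closed X4tw.m_closed by (simp_all add: X)
  have \<rho>_add: "\<rho> (x + y) = \<rho> x + \<rho> y" if "x \<in> ?D" "y \<in> ?D" for x y
    using that D[OF that] alg_homD(2)[OF hom, of "X4_class x" "X4_class y"]
    by (simp add: Rep_yt_inject[symmetric] Rep\<rho> Rep_yt_simps X)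
  have \<rho>_mult: "\<rho> (x * y) = \<rho> x * \<rho> y" if "x \<in> ?D" "y \<in> ?D" for x y
    using that D[OF that] alg_homD(3)[OF hom, of "X4_class x" "X4_class y"]
    by (simp add: Rep_yt_inject[symmetric] Rep\<rho> Rep_yt_simps X)
  have X0: "X4_class 0 = \<zero>\<^bsub>X4\<^esub>"
    using alg_hom_zero[OF X4_class_hom calgebra_free_alg calgebra_X4] by simp
  have D0: "0 \<in> ?D" using X4tw.zero_closed by (simp add: X0)
  have \<rho>0: "\<rho> 0 = 0" using \<rho>_add[OF D0 D0] by simp
  have Dm: "- x \<in> ?D" if "x \<in> ?D" for x
  proof -
    have "X4_class (scal (- 1) * x) = (- 1) \<odot>\<^bsub>X4tw\<^esub> X4_class x"
      using alg_homD(5)[OF X4_class_hom, of x "- 1"] by simp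
    moreover have "scal (- 1) * x = - x"
    proof -
      have "scal (- 1) + 1 = (scal (- 1 + 1) :: gen4 free)" by (simp only: scal_add scal_one)
      also have "\<dots> = 0" by (simp add: scal_def)
      finally have "scal (- 1) = (- 1 :: gen4 free)" by (simp only: eq_neg_iff_add_eq_0)
      thus ?thesis by simp
    qed
    ultimately show ?thesis using that X4tw.smult_closed by simp
  qed
  have \<rho>m: "\<rho> (- x) = - \<rho> x" if "x \<in> ?D" for x
    using \<rho>_add[OF that Dm[OF that]] by (simp add: \<rho>0 add_eq_0_iff)
  have sum: "sum f I \<in> ?D \<and> \<rho> (sum f I) = (\<Sum>i\<in>I. \<rho> (f i))" if "\<And>i. i \<in> I \<Longrightarrow> f i \<in> ?D" for f :: "'z \<Rightarrow> gen4 free" and I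
    using that
    by (induction I rule: infinite_finite_induct) (simp_all add: D0 \<rho>0 D \<rho>_add del: mem_Collect_eq)
  have S: "S4mat i j $ n \<in> ?D" "\<rho> (S4mat i j $ n) = Simg i j $ n" for i j n
    using X4tw_gen by (simp_all add: \<rho>_def gens phi_image_eq Rep_yt_inverse)
  have N: "ser_neg (S4mat i j) $ n \<in> ?D" "\<rho> (ser_neg (S4mat i j) $ n) = neg (Simg i j) $ n" for i j n
    by (cases "even n"; use S Dm \<rho>m in \<open>simp add: ser_neg_def neg_def del: mem_Collect_eq\<close>)+
  note SN = D(2)[OF S(1) N(1)]
  have P: "(S4mat i k * ser_neg (S4mat k j)) $ n \<in> ?D \<and> \<rho> ((S4mat i k * ser_neg (S4mat k j)) $ n) = (Simg i k * neg (Simg k j)) $ n" for k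
    unfolding fps_mult_nth using sum[of "{0..n}" "\<lambda>m. S4mat i k $ m * ser_neg (S4mat k j) $ (n - m)", OF SN]
    by (simp add: \<rho>_mult[OF S(1) N(1)] S(2) N(2) del: mem_Collect_eq)
  have "Sprod i j n \<in> ?D \<and> \<rho> (Sprod i j n) = (\<Sum>k\<in>UNIV. (Simg i k * neg (Simg k j)) $ n)"
    unfolding Sprod_def fps_sum_nth using sum[of UNIV "\<lambda>k. (S4mat i k * ser_neg (S4mat k j)) $ n"] P
    by (simp del: mem_Collect_eq)
  hence Sprod: "Sprod i j n \<in> ?D" "\<rho> (Sprod i j n) = (if i = j then fmap tensL zser * fmap tensR zser else 0) $ n"
    using E_symmetry[of i j] by (simp_all only: flip: fps_sum_nth)
  show "X4_class (Sprod i j n) \<in> carrier X4tw" using Sprod(1) by simp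
  show "\<phi> (X4_class (Sprod i j n)) = Rep_yt ((if i = j then fmap tensL zser * fmap tensR zser else 0) $ n)"
    using Rep\<rho>[OF Sprod(1)] by (simp only: Sprod(2))
qed

lemma w_ser:
  assumes hom: "\<phi> \<in> alg_hom X4tw TY" and gens: "\<And>i j n. \<phi> (X4_class (S4mat i j $ n)) = phi_image i j n"
    and inj: "inj_on \<phi> (carrier X4tw)"
  shows "w_ser n \<in> carrier X4tw" "\<phi> (w_ser n) = Rep_yt ((fmap tensL zser * fmap tensR zser) $ n)"
proof -
  note Sprod = phi_W[OF hom gens]
  \<comment> \<open>The definite description in \<open>w_ser_def\<close> has to be justified. The
    off-diagonal products have image zero and the diagonal ones have equal images, so injectivity
    carries both facts back to X^tw.\<close>
  have neq: "X4_class (Sprod i j n) = \<zero>\<^bsub>X4\<^esub>" if "i \<noteq> j" for i j n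
  proof (rule inj_onD[OF inj _ Sprod(1)])
    show "\<phi> (X4_class (Sprod i j n)) = \<phi> \<zero>\<^bsub>X4\<^esub>"
      using Sprod(2)[of i j n] that alg_hom_zero[OF hom calgebra_X4tw YY.calgebra_tensor] by (simp add: Rep_yt_simps)
    show "\<zero>\<^bsub>X4\<^esub> \<in> carrier X4tw" using X4tw.zero_closed by simp
  qed
  have eq: "X4_class (Sprod i i n) = X4_class (Sprod Neg2 Neg2 n)" for i n
    by (rule inj_onD[OF inj _ Sprod(1) Sprod(1)]) (simp only: Sprod(2) refl if_True)
  \<comment> \<open>Any diagonal entry would do; by \<open>eq\<close> all of them agree.\<close>
  have "w_ser = (\<lambda>n. X4_class (Sprod Neg2 Neg2 n))"
    unfolding w_ser_def Sprod_def[symmetric]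
  proof (rule the_equality)
    show "\<forall>i j n. X4_class (Sprod i j n) = (if i = j then X4_class (Sprod Neg2 Neg2 n) else \<zero>\<^bsub>X4\<^esub>)"
      using neq eq by simp
    show "w = (\<lambda>n. X4_class (Sprod Neg2 Neg2 n))" if "\<forall>i j n. X4_class (Sprod i j n) = (if i = j then w n else \<zero>\<^bsub>X4\<^esub>)" for w
      using that by (intro ext) (metis (full_types))
  qed
  hence "w_ser n = X4_class (Sprod Neg2 Neg2 n)" by (rule fun_cong)
  thus "w_ser n \<in> carrier X4tw" "\<phi> (w_ser n) = Rep_yt ((fmap tensL zser * fmap tensR zser) $ n)"
    using Sprod(1)[of Neg2 Neg2 n] Sprod(2)[of Neg2 Neg2 n] by simp_all
qed

lemma proj_Z: "SY2_proj (Rep_y2 (zser $ n)) = (if n = 0 then \<one>\<^bsub>SY2m\<^esub> else \<zero>\<^bsub>SY2m\<^esub>)"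
proof -
  have Zn: "Rep_y2 (zser $ n) \<in> carrier Y2m" using Z_in by (rule M_closed)
  show ?thesis
  proof (cases "n = 0")
    case True
    thus ?thesis using alg_homD(4)[OF SY2_proj_hom_m] by (simp add: Z_nth_0 Rep_y2_simps)
  next
    case False
    thus ?thesis using Z_in_SY2_ideal[of n] Zn Y2m_subset by (simp add: SY2_proj_zero_iff subset_iff)
  qed
qed

text \<open>The projection turns Z(u) into 1 on the first factor, so only the summand m = 0 of the
  Cauchy product remains.\<close>

lemma proj_LR:
  "tensor_map SY2m Y2m SY2_proj (\<lambda>y. y) (Rep_yt ((fmap tensL zser * fmap tensR zser) $ n)) = tens SY2m Y2m \<one>\<^bsub>SY2m\<^esub> (Rep_y2 (zser $ n))"
proof -
  note h = tensor_map_hom[OF calgebra_Y2m calgebra_Y2m calgebra_SY2m calgebra_Y2m SY2_proj_hom_m id_alg_hom]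
  let ?h = "tensor_map SY2m Y2m SY2_proj (\<lambda>y. y)"
  let ?T = "tensor SY2m Y2m"
  have Zn: "Rep_y2 (zser $ n) \<in> carrier Y2m" for n using Z_in by (rule M_closed)
  have "Rep_yt ((fmap tensL zser * fmap tensR zser) $ n) = (\<Oplus>\<^bsub>TY\<^esub>m\<in>{..n}. tens Y2m Y2m (Rep_y2 (zser $ m)) (Rep_y2 (zser $ (n - m))))"
    unfolding fps_mult_nth atLeast0AtMost Rep_yt_sum[OF finite_atMost] fmap_nth
    by (intro finsum_cong_calg YY.calgebra_tensor)
       (simp_all add: LR_simps(5) Z_in Zn Abs_yt_inverse YY.tens_closed del: mem_Collect_eq)
  hence "?h (Rep_yt ((fmap tensL zser * fmap tensR zser) $ n)) =
      (\<Oplus>\<^bsub>?T\<^esub>m\<in>{..n}. ?h (tens Y2m Y2m (Rep_y2 (zser $ m)) (Rep_y2 (zser $ (n - m)))))"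
    using alg_hom_finsum[OF h(1) YY.calgebra_tensor SY.calgebra_tensor, of "{..n}"] Zn YY.tens_closed by simp
  also have "\<dots> = (\<Oplus>\<^bsub>?T\<^esub>m\<in>{..n}. if m = 0 then tens SY2m Y2m \<one>\<^bsub>SY2m\<^esub> (Rep_y2 (zser $ n)) else \<zero>\<^bsub>?T\<^esub>)"
  proof (intro finsum_cong_calg SY.calgebra_tensor)
    fix m assume "m \<in> {..n}"
    show "?h (tens Y2m Y2m (Rep_y2 (zser $ m)) (Rep_y2 (zser $ (n - m)))) =
        (if m = 0 then tens SY2m Y2m \<one>\<^bsub>SY2m\<^esub> (Rep_y2 (zser $ n)) else \<zero>\<^bsub>?T\<^esub>)"
      using h(2)[OF Zn Zn, of m "n - m"] SY.tens_zero_left[OF Zn, of "n - m"] by (simp add: proj_Z)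
    show "(if m = 0 then tens SY2m Y2m \<one>\<^bsub>SY2m\<^esub> (Rep_y2 (zser $ n)) else \<zero>\<^bsub>?T\<^esub>) \<in> carrier ?T"
      using SY.tens_closed[OF SY2m.one_closed Zn] by simp
  qed
  also have "\<dots> = tens SY2m Y2m \<one>\<^bsub>SY2m\<^esub> (Rep_y2 (zser $ n))"
    using SY.T.add.finprod_singleton[of 0 "{..n}" "\<lambda>_. tens SY2m Y2m \<one>\<^bsub>SY2m\<^esub> (Rep_y2 (zser $ n))"]
      SY.tens_closed[OF SY2m.one_closed Zn] by (simp add: eq_commute)
  finally show ?thesis .
qed

section \<open>The isomorphism induced on the quotients\<close>

theorem corollary4p14:
  fixes \<phi>\<^sub>1 :: "gen4 free set \<Rightarrow> (gen2 free set \<times> gen2 free set \<Rightarrow>\<^sub>0 complex) set"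
    and \<chi> :: "gen4 free set \<Rightarrow> (gen2 free set set \<times> gen2 free set \<Rightarrow>\<^sub>0 complex) set"
  assumes phi_hom: "\<phi>\<^sub>1 \<in> alg_hom X4tw (tensor Y2m Y2m)"
    and phi_inj: "inj_on \<phi>\<^sub>1 (carrier X4tw)"
    and phi_gen: "\<And>i j n. \<phi>\<^sub>1 (X4_class (S4mat i j $ n)) = phi_image i j n"
    and chi_def: "\<And>x. x \<in> carrier X4tw \<Longrightarrow> \<chi> x = tensor_map SY2m Y2m SY2_proj (\<lambda>y. y) (\<phi>\<^sub>1 x)"
    and chi_iso: "\<chi> \<in> alg_iso X4tw (tensor SY2m Y2m)"
  shows "\<exists>\<psi> \<in> alg_iso Y4tw (tensor SY2m SY2m).
           \<forall>x \<in> carrier X4tw.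
             \<psi> (Y4tw_proj x) = tensor_map SY2m SY2m (\<lambda>y. y) SY2_proj (\<chi> x)"
proof -
  let ?T = "tensor SY2m Y2m"
  let ?h = "tensor_map SY2m SY2m (\<lambda>y. y) SY2_proj"
  note w = w_ser[OF phi_hom phi_gen phi_inj]
  have chi_hom: "\<chi> \<in> alg_hom X4tw ?T" and chi_surj: "\<chi> ` carrier X4tw = carrier ?T"
    using chi_iso by (auto simp: alg_iso_def bij_betw_def)
  define d where "d n = (if n = 0 then \<one>\<^bsub>X4tw\<^esub> else \<zero>\<^bsub>X4tw\<^esub>)" for n :: nat
  define G where "G = {w_ser n \<ominus>\<^bsub>X4tw\<^esub> d n | n. True}"
  have d: "d n \<in> carrier X4tw" for n using X4tw.one_closed X4tw.zero_closed by (simp add: d_def)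
  have G: "G \<subseteq> carrier X4tw" using w(1) d X4tw.minus_closed by (auto simp: G_def)
  have ideal_eq: "Y4tw_ideal = Idl\<^bsub>X4tw\<^esub> G" by (simp add: Y4tw_ideal_def G_def d_def)
  have idl: "ideal Y4tw_ideal X4tw" unfolding ideal_eq by (rule X4tw.genideal_ideal[OF G])
  have right: "(\<lambda>b. tens SY2m Y2m \<one>\<^bsub>SY2m\<^esub> b) \<in> alg_hom Y2m ?T"
    using SY.tens_add_right[of "\<one>\<^bsub>SY2m\<^esub>"] SY.tens_mult[of "\<one>\<^bsub>SY2m\<^esub>" _ "\<one>\<^bsub>SY2m\<^esub>"]
      SY.tens_smult_right[of "\<one>\<^bsub>SY2m\<^esub>"] SY.one_tensor SY2m.one_closed SY2m.l_one SY.tens_closed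
    by (simp add: alg_hom_def ring_hom_def)
  have chi_w: "\<chi> (w_ser n \<ominus>\<^bsub>X4tw\<^esub> d n) = tens SY2m Y2m \<one>\<^bsub>SY2m\<^esub> (Rep_y2 ((zser - 1) $ n))" for n
  proof -
    \<comment> \<open>\<open>e\<close> is the coefficient of index n of the series 1 in Y^-(2); both
      \<open>d n\<close> and \<open>e\<close> are mapped to 1 \<otimes> e.\<close>
    define e where "e = (if n = 0 then \<one>\<^bsub>Y2m\<^esub> else \<zero>\<^bsub>Y2m\<^esub>)"
    have e: "e \<in> carrier Y2m" using Y2m.one_closed Y2m.zero_closed by (simp add: e_def)
    have Zn: "Rep_y2 (zser $ n) \<in> carrier Y2m" using Z_in by (rule M_closed)
    have "\<chi> (d n) = tens SY2m Y2m \<one>\<^bsub>SY2m\<^esub> e"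
      using alg_homD(4)[OF chi_hom] alg_homD(4)[OF right] alg_hom_zero[OF chi_hom calgebra_X4tw SY.calgebra_tensor]
        alg_hom_zero[OF right calgebra_Y2m SY.calgebra_tensor]
      by (simp add: d_def e_def)
    moreover have "\<chi> (w_ser n) = tens SY2m Y2m \<one>\<^bsub>SY2m\<^esub> (Rep_y2 (zser $ n))"
      using chi_def[OF w(1)] by (simp only: w(2) proj_LR)
    ultimately have "\<chi> (w_ser n \<ominus>\<^bsub>X4tw\<^esub> d n) = tens SY2m Y2m \<one>\<^bsub>SY2m\<^esub> (Rep_y2 (zser $ n) \<ominus>\<^bsub>Y2m\<^esub> e)"
      using alg_hom_minus[OF chi_hom calgebra_X4tw SY.calgebra_tensor w(1) d, of n n]
        alg_hom_minus[OF right calgebra_Y2m SY.calgebra_tensor Zn e] by simp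
    also have "Rep_y2 (zser $ n) \<ominus>\<^bsub>Y2m\<^esub> e = Rep_y2 (zser $ n) \<ominus>\<^bsub>Y2\<^esub> e"
      using subalg_a_inv[OF calgebra_Y2 GY_subset, of "Rep_y2 (zser $ n)" e] Zn e by (simp only: Y2m_eq subalg_simps)
    also have "e = Rep_y2 ((1 :: y2 fps) $ n)" by (simp add: e_def Rep_y2_simps)
    finally show ?thesis by (simp only: fps_sub_nth Rep_y2_simps(4))
  qed
  \<comment> \<open>An equality of generating sets, not merely of ideals, so
    \<open>alg_iso_genideal\<close> applies directly.\<close>
  have image: "\<chi> ` G = tens SY2m Y2m \<one>\<^bsub>SY2m\<^esub> ` GZ"
  proof -
    have "\<chi> ` G = range (\<lambda>n. \<chi> (w_ser n \<ominus>\<^bsub>X4tw\<^esub> d n))" by (auto simp: G_def)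
    also have "\<dots> = tens SY2m Y2m \<one>\<^bsub>SY2m\<^esub> ` GZ"
      unfolding chi_w GZ_def by (auto simp del: fps_sub_nth)
    finally show ?thesis .
  qed
  note h = tensor_map_hom(1)[OF calgebra_SY2m calgebra_Y2m calgebra_SY2m calgebra_SY2m id_alg_hom SY2_proj_hom_m]
  have "\<exists>\<psi> \<in> alg_iso (alg_quot X4tw Y4tw_ideal) (tensor SY2m SY2m).
      \<forall>x \<in> carrier X4tw. \<psi> (Y4tw_ideal +>\<^bsub>X4tw\<^esub> x) = ?h (\<chi> x)"
  proof (rule alg_quot_induced_iso[OF alg_hom_comp[OF chi_hom h] calgebra_X4tw SS.calgebra_tensor idl])
    have "(\<lambda>x. ?h (\<chi> x)) ` carrier X4tw = ?h ` (\<chi> ` carrier X4tw)" by (simp add: image_image)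
    also have "\<dots> = carrier (tensor SY2m SY2m)"
      unfolding chi_surj
      by (rule tensor_map_surj[OF calgebra_SY2m calgebra_Y2m calgebra_SY2m calgebra_SY2m id_alg_hom SY2_proj_hom_m])
        (simp_all add: SY2_proj_surj)
    finally show "(\<lambda>x. ?h (\<chi> x)) ` carrier X4tw = carrier (tensor SY2m SY2m)" .
  next
    fix x assume x: "x \<in> carrier X4tw"
    \<comment> \<open>Right exactness describes the kernel of the second projection inside SY^-(2)
      \<otimes> Y^-(2); the isomorphism \<open>\<chi>\<close> then pulls that ideal back to
      X^tw.\<close>
    have "?h (\<chi> x) = \<zero>\<^bsub>tensor SY2m SY2m\<^esub> \<longleftrightarrow> \<chi> x \<in> Idl\<^bsub>?T\<^esub> (tens SY2m Y2m \<one>\<^bsub>SY2m\<^esub> ` GZ)"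
      by (rule tensor_map_kernel[OF calgebra_SY2m calgebra_Y2m calgebra_SY2m SY2_proj_hom_m SY2_proj_surj GZ_subset SY2_kernel])
        (use x alg_homD(1)[OF chi_hom] in auto)
    also have "\<dots> \<longleftrightarrow> x \<in> Y4tw_ideal"
      unfolding image[symmetric] ideal_eq
      by (rule alg_iso_genideal[OF chi_iso calgebra_X4tw SY.calgebra_tensor G x])
    finally show "?h (\<chi> x) = \<zero>\<^bsub>tensor SY2m SY2m\<^esub> \<longleftrightarrow> x \<in> Y4tw_ideal" .
  qed
  thus ?thesis by (simp only: Y4tw_def Y4tw_proj_def)
qed

end
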